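(* Let $p$ be an odd prime, let $s\ge0$ be an integer, let $\delta\in\{1,-1\}$, and let $r$ be an integer with $r\ge\max\{3,s+1\}$ and $p\nmid r$. Let $G$ be a group of automorphisms of the augmented Praeger–Xu graph $\mathrm{C}^*(p,r,s,\delta)$ acting regularly on its arcs. Then $G\cong\mathbb{Z}_p^{s+1}\rtimes\mathrm{D}_{2r}$.
   Context: $\mathrm{D}_{2r}$ is the dihedral group of order $2r$. For $s\ge1$, the Praeger–Xu graph $\mathrm{C}(p,r,s)$ is the simple graph with vertex set $\mathbb{Z}_r\times\mathbb{Z}_p^s$ whose edges are all pairs $\{(i,x_0,\dots,x_{s-1}),(i+1,x_1,\dots,x_s)\}$, $i\in\mathbb{Z}_r$, $x_j\in\mathbb{Z}_p$. The augmented Praeger–Xu graph $\mathrm{C}^*(p,r,s,\delta)$ is: $\mathrm{C}(p,r,s)$ if $s\ge1$; the multicycle $\mathrm{C}_r^{(p)}$ (a cycle of length $r$ in which each pair of adjacent vertices is joined by $p$ parallel edges) if $s=0,\delta=1$; the cycle $\mathrm{C}_{pr}$ if $s=0,\delta=-1$. Graphs may have multiple edges; an arc is an edge together with a direction. *)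

theory Defs
  imports "HOL-Algebra.Algebra" "HOL-Computational_Algebra.Primes"
begin

text \<open>A (multi)graph is a pair (V, E): a vertex set V and an edge set E.
  Each edge is a pair (S, k) where S is the set of its (two) end vertices and
  k is a label distinguishing parallel edges.\<close>

type_synonym 'v mgraph = "'v set \<times> ('v set \<times> nat) set"

definition gverts :: "'v mgraph \<Rightarrow> 'v set" where "gverts Gr = fst Gr"
definition gedges :: "'v mgraph \<Rightarrow> ('v set \<times> nat) set" where "gedges Gr = snd Gr"

text \<open>Arcs: an edge together with a direction, represented as (edge, initial vertex).\<close>
definition arcs :: "'v mgraph \<Rightarrow> (('v set \<times> nat) \<times> 'v) set" where
  "arcs Gr = {(e, u). e \<in> gedges Gr \<and> u \<in> fst e}"

text \<open>Automorphisms: a permutation of the vertices and a permutation of the edges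
  preserving incidence (functions are taken extensional for uniqueness).\<close>
definition is_graph_aut :: "'v mgraph \<Rightarrow> ('v \<Rightarrow> 'v) \<times> (('v set \<times> nat) \<Rightarrow> ('v set \<times> nat)) \<Rightarrow> bool" where
  "is_graph_aut Gr g \<longleftrightarrow>
     bij_betw (fst g) (gverts Gr) (gverts Gr) \<and> fst g \<in> extensional (gverts Gr) \<and>
     bij_betw (snd g) (gedges Gr) (gedges Gr) \<and> snd g \<in> extensional (gedges Gr) \<and>
     (\<forall>e \<in> gedges Gr. fst (snd g e) = fst g ` fst e)"

definition aut_group :: "'v mgraph \<Rightarrow>
    (('v \<Rightarrow> 'v) \<times> (('v set \<times> nat) \<Rightarrow> ('v set \<times> nat))) monoid" where
  "aut_group Gr = \<lparr> carrier = {g. is_graph_aut Gr g},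
     monoid.mult = (\<lambda>g h. (compose (gverts Gr) (fst g) (fst h), compose (gedges Gr) (snd g) (snd h))),
     one = ((\<lambda>x \<in> gverts Gr. x), (\<lambda>e \<in> gedges Gr. e)) \<rparr>"

definition arc_act :: "('v \<Rightarrow> 'v) \<times> (('v set \<times> nat) \<Rightarrow> ('v set \<times> nat)) \<Rightarrow>
    (('v set \<times> nat) \<times> 'v) \<Rightarrow> (('v set \<times> nat) \<times> 'v)" where
  "arc_act g a = (snd g (fst a), fst g (snd a))"

definition arc_regular :: "'v mgraph \<Rightarrow>
    (('v \<Rightarrow> 'v) \<times> (('v set \<times> nat) \<Rightarrow> ('v set \<times> nat))) set \<Rightarrow> bool" where
  "arc_regular Gr H \<longleftrightarrow> (\<forall>a \<in> arcs Gr. \<forall>b \<in> arcs Gr. \<exists>!g. g \<in> H \<and> arc_act g a = b)"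

definition PX_verts :: "nat \<Rightarrow> nat \<Rightarrow> nat \<Rightarrow> (nat \<times> nat list) set" where
  "PX_verts p r s = {(i, xs). i < r \<and> length xs = s \<and> set xs \<subseteq> {..<p}}"

definition PX_graph :: "nat \<Rightarrow> nat \<Rightarrow> nat \<Rightarrow> (nat \<times> nat list) mgraph" where
  "PX_graph p r s = (PX_verts p r s,
     {({(i, take s xs), ((i + 1) mod r, drop 1 xs)}, 0) | i xs.
        i < r \<and> length xs = s + 1 \<and> set xs \<subseteq> {..<p}})"

definition multicycle :: "nat \<Rightarrow> nat \<Rightarrow> (nat \<times> nat list) mgraph" where
  "multicycle p r = ({(i, []) | i. i < r},
     {({(i, []), ((i + 1) mod r, [])}, k) | i k. i < r \<and> k < p})"

definition cycle_graph :: "nat \<Rightarrow> (nat \<times> nat list) mgraph" where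
  "cycle_graph n = ({(j, []) | j. j < n},
     {({(j, []), ((j + 1) mod n, [])}, 0) | j. j < n})"

definition aug_PX :: "nat \<Rightarrow> nat \<Rightarrow> nat \<Rightarrow> int \<Rightarrow> (nat \<times> nat list) mgraph" where
  "aug_PX p r s \<delta> =
     (if s \<ge> 1 then PX_graph p r s
      else if \<delta> = 1 then multicycle p r
      else cycle_graph (p * r))"

definition Zp_power :: "nat \<Rightarrow> nat \<Rightarrow> nat list monoid" where
  "Zp_power p k = \<lparr> carrier = {xs. length xs = k \<and> set xs \<subseteq> {..<p}},
     monoid.mult = (\<lambda>xs ys. map2 (\<lambda>a b. (a + b) mod p) xs ys),
     one = replicate k 0 \<rparr>"

text \<open>Dihedral group of order 2r: (i, a) stands for rho^i tau^a, with
  tau rho tau = rho^{-1}.\<close>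
definition dihedral_group :: "nat \<Rightarrow> (nat \<times> nat) monoid" where
  "dihedral_group r = \<lparr> carrier = {..<r} \<times> {..<2},
     monoid.mult = (\<lambda>(i, a) (j, b). ((if a = 0 then i + j else i + r - j) mod r, (a + b) mod 2)),
     one = (0, 0) \<rparr>"

definition is_semidirect_product_of :: "('g, 'm) monoid_scheme \<Rightarrow> ('a, 'n) monoid_scheme \<Rightarrow> ('b, 'o) monoid_scheme \<Rightarrow> bool" where
  "is_semidirect_product_of G A B \<longleftrightarrow>
     (\<exists>N K. N \<lhd> G \<and> subgroup K G \<and> N \<inter> K = {\<one>\<^bsub>G\<^esub>} \<and> N <#>\<^bsub>G\<^esub> K = carrier G \<and>
            G\<lparr>carrier := N\<rparr> \<cong> A \<and> G\<lparr>carrier := K\<rparr> \<cong> B)"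

end

theory Submission
  imports Defs "HOL-Combinatorics.Permutations" "HOL-Number_Theory.Cong"
begin

text \<open>
  The vertices are mapped to \<open>\<int>\<^sub>r\<close> in such a way that every element of \<open>G\<close> permutes the fibres by a
  symmetry of the cycle \<open>C\<^sub>r\<close>.  By arc-transitivity this gives a surjection of \<open>G\<close> onto the dihedral group,
  and by arc-regularity its kernel \<open>N\<close> acts regularly on the \<open>p\<^sup>s\<^sup>+\<^sup>1\<close> arcs above one arc of \<open>C\<^sub>r\<close>.
  The \<open>p\<close>-group \<open>N\<close> acts faithfully on a union of invariant sets of size \<open>p\<close>; since \<open>p\<^sup>2\<close> does not divide
  \<open>p!\<close>, it induces a group of order at most \<open>p\<close> on each of them and hence is elementary abelian.
  The extension splits because \<open>p\<close> is coprime to \<open>2r\<close>.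

  For \<open>s \<ge> 1\<close> the map to \<open>\<int>\<^sub>r\<close> is the index of a vertex: counting common neighbours shows that
  automorphisms respect the partition of a neighbourhood into in- and out-neighbours.  This fails only for
  \<open>(r, s) = (4, 1)\<close>, where the graph is \<open>K\<^sub>2\<^sub>p\<^sub>,\<^sub>2\<^sub>p\<close>.  There the blocks are recovered from the group itself,
  using the subgroups of order \<open>p\<close> of the vertex stabilisers.
\<close>

section \<open>Elementary abelian groups and permutation groups of prime degree\<close>

text \<open>Regularity fixes the order of the kernel \<open>N\<close> before anything is known about
  its structure, but a group of order \<open>p ^ (s + 1)\<close> need be neither abelian nor of
  exponent \<open>p\<close>. Both properties come from sets with exactly \<open>p\<close> elements,
  and finding these sets is the part that depends on the graph. They are bundles of parallel edges
  in the multicycle and residue classes modulo \<open>r\<close> in the long cycle. For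
  \<open>s \<ge> 1\<close> the fibre over an index has \<open>p ^ s\<close> vertices, in general too
  many, and the points are instead the classes of vertices with given index and given first entry.

  Exponent \<open>p\<close> also makes the splitting explicit: raising to the power \<open>p\<close>
  kills the kernel and, as \<open>p\<close> is odd and prime to \<open>r\<close>, still allows the
  generators of the dihedral group to be recovered.

  The obstacle is that the index of a vertex need not be respected. For \<open>r = 4\<close>,
  \<open>s = 1\<close> opposite fibres have the same neighbours, so every permutation of the
  \<open>2 * p\<close> vertices of one side extends to an automorphism. No invariant of the graph
  singles out the fibres, and the map to the cycle must depend on the group.\<close>

lemma group_Zp_power:
  assumes "p > 0"
  shows "group (Zp_power p k)"
proof (rule groupI)
  fix xs ys zs assume c: "xs \<in> carrier (Zp_power p k)" "ys \<in> carrier (Zp_power p k)" "zs \<in> carrier (Zp_power p k)"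
  show "xs \<otimes>\<^bsub>Zp_power p k\<^esub> ys \<in> carrier (Zp_power p k)"
    using c assms by (auto simp: Zp_power_def set_zip)
  show "xs \<otimes>\<^bsub>Zp_power p k\<^esub> ys \<otimes>\<^bsub>Zp_power p k\<^esub> zs = xs \<otimes>\<^bsub>Zp_power p k\<^esub> (ys \<otimes>\<^bsub>Zp_power p k\<^esub> zs)"
    using c by (auto simp: Zp_power_def list_eq_iff_nth_eq mod_simps add.assoc)
next
  show "\<one>\<^bsub>Zp_power p k\<^esub> \<in> carrier (Zp_power p k)" using assms by (auto simp: Zp_power_def)
next
  fix xs assume c: "xs \<in> carrier (Zp_power p k)"
  hence *: "\<forall>i<k. xs ! i < p" by (fastforce simp: Zp_power_def dest: nth_mem)
  show "\<one>\<^bsub>Zp_power p k\<^esub> \<otimes>\<^bsub>Zp_power p k\<^esub> xs = xs"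
    using c * by (auto simp: Zp_power_def list_eq_iff_nth_eq)
  have "map (\<lambda>a. (p - a) mod p) xs \<otimes>\<^bsub>Zp_power p k\<^esub> xs = \<one>\<^bsub>Zp_power p k\<^esub>"
    using c * by (auto simp: Zp_power_def list_eq_iff_nth_eq mod_simps)
  moreover have "map (\<lambda>a. (p - a) mod p) xs \<in> carrier (Zp_power p k)"
    using c assms by (auto simp: Zp_power_def)
  ultimately show "\<exists>y\<in>carrier (Zp_power p k). y \<otimes>\<^bsub>Zp_power p k\<^esub> xs = \<one>\<^bsub>Zp_power p k\<^esub>" by blast
qed

lemma card_Zp_power: "card (carrier (Zp_power p k)) = p ^ k"
  using card_lists_length_eq[of "{..<p}" k] by (simp add: Zp_power_def conj_commute)

lemma (in group) pow_mod_exponent: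
  fixes p n :: nat
  assumes "x \<in> carrier G" "x [^] p = \<one>"
  shows "x [^] (n mod p) = x [^] n"
proof -
  have "x [^] n = x [^] (p * (n div p) + n mod p)" by simp
  also have "\<dots> = (x [^] p) [^] (n div p) \<otimes> x [^] (n mod p)"
    using assms(1) by (simp only: nat_pow_mult nat_pow_pow)
  finally show ?thesis using assms by simp
qed

text \<open>An inverse \<open>b\<close> of \<open>a\<close> modulo \<open>p\<close> turns
  \<open>x [^] a\<close> back into \<open>x\<close>. The contrapositive provides the independence
  needed when a basis is extended: a subgroup that misses \<open>x\<close> contains no power of
  \<open>x\<close> with exponent prime to \<open>p\<close>.\<close>

lemma (in group) subgroup_mem_of_pow_mem:
  fixes p a :: nat
  assumes "subgroup S G" "x \<in> carrier G" "x [^] p = \<one>" "x [^] a \<in> S" "coprime a p"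
  shows "x \<in> S"
proof -
  obtain b where b: "[a * b = Suc 0] (mod p)"
    using cong_solve_coprime_nat[OF assms(5)] by auto
  have "(x [^] a) [^] b \<in> S"
    using assms(1,4) using subgroup_int_pow_closed[of S _ "int b"] by (simp add: int_pow_int)
  also have "(x [^] a) [^] b = x [^] (a * b)" using assms(2) by (simp add: nat_pow_pow)
  also have "\<dots> = x [^] (Suc 0)"
    using b pow_mod_exponent[OF assms(2,3)] unfolding cong_def by metis
  finally show ?thesis using assms(2) by simp
qed

text \<open>Basis extension in the language of groups: as long as \<open>k < n\<close>, the image of
  size \<open>p ^ k\<close> is a proper subgroup, so some \<open>x\<close> lies outside it, and the
  exponent of \<open>x\<close> becomes a new first coordinate.\<close>

lemma (in comm_group) Zp_power_embeds:
  assumes "Factorial_Ring.prime p" and fin: "finite (carrier G)" and card: "card (carrier G) = p ^ n"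
    and expo: "\<And>x. x \<in> carrier G \<Longrightarrow> x [^] p = \<one>" and "k \<le> n"
  shows "\<exists>\<psi> \<in> hom (Zp_power p k) G. inj_on \<psi> (carrier (Zp_power p k))"
  using \<open>k \<le> n\<close>
proof (induction k)
  case 0
  have "(\<lambda>_. \<one>) \<in> hom (Zp_power p 0) G" by (auto simp: hom_def)
  moreover have "inj_on (\<lambda>_. \<one>) (carrier (Zp_power p 0))" by (auto simp: inj_on_def Zp_power_def)
  ultimately show ?case by blast
next
  case (Suc k)
  have p: "p > 1" using assms(1) prime_gt_1_nat by blast
  from Suc obtain \<psi> where \<psi>: "\<psi> \<in> hom (Zp_power p k) G" "inj_on \<psi> (carrier (Zp_power p k))" by auto
  interpret Z: group "Zp_power p k" using p by (intro group_Zp_power) simp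
  interpret gh: group_hom "Zp_power p k" G \<psi> using \<psi>(1) by unfold_locales
  let ?I = "\<psi> ` carrier (Zp_power p k)"
  have sub: "subgroup ?I G" by (rule gh.img_is_subgroup)
  have "card ?I = p ^ k" using card_image[OF \<psi>(2)] card_Zp_power by simp
  moreover have "p ^ k < p ^ n" using Suc.prems p by simp
  ultimately have "?I \<noteq> carrier G" using card by auto
  moreover have "?I \<subseteq> carrier G" using sub subgroup.subset by blast
  ultimately obtain x where x: "x \<in> carrier G" "x \<notin> ?I" by blast
  define \<psi>' where "\<psi>' = (\<lambda>xs. x [^] (hd xs :: nat) \<otimes> \<psi> (tl xs))"
  have cons: "\<exists>a xs. ys = a # xs \<and> a < p \<and> xs \<in> carrier (Zp_power p k)"
    if "ys \<in> carrier (Zp_power p (Suc k))" for ys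
    using that by (cases ys) (auto simp: Zp_power_def)
  have mult: "(a # xs) \<otimes>\<^bsub>Zp_power p (Suc k)\<^esub> (b # ys) = ((a + b) mod p) # (xs \<otimes>\<^bsub>Zp_power p k\<^esub> ys)" for a b xs ys
    by (simp add: Zp_power_def)
  have "\<psi>' \<in> hom (Zp_power p (Suc k)) G"
  proof (rule homI)
    fix u v assume u: "u \<in> carrier (Zp_power p (Suc k))" "v \<in> carrier (Zp_power p (Suc k))"
    then obtain a xs b ys where eq: "u = a # xs" "v = b # ys" 
      and xs: "xs \<in> carrier (Zp_power p k)" and ys: "ys \<in> carrier (Zp_power p k)"
      using cons[OF u(1)] cons[OF u(2)] by blast
    have "\<psi>' (u \<otimes>\<^bsub>Zp_power p (Suc k)\<^esub> v) = x [^] (a + b) \<otimes> (\<psi> xs \<otimes> \<psi> ys)"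
      unfolding eq mult \<psi>'_def using x expo xs ys by (simp add: pow_mod_exponent)
    also have "x [^] (a + b) = x [^] a \<otimes> x [^] b" using x by (simp add: nat_pow_mult)
    finally show "\<psi>' (u \<otimes>\<^bsub>Zp_power p (Suc k)\<^esub> v) = \<psi>' u \<otimes> \<psi>' v"
      unfolding eq \<psi>'_def using x gh.hom_closed[OF xs] gh.hom_closed[OF ys] by (simp add: m_ac)
    show "\<psi>' u \<in> carrier G" unfolding eq \<psi>'_def using x xs by simp
  qed
  moreover have "inj_on \<psi>' (carrier (Zp_power p (Suc k)))"
  proof -
    \<comment> \<open>One inequality is enough, since it is applied in both directions. If
      \<open>b < a\<close>, cancelling \<open>x [^] b\<close> puts \<open>x [^] (a - b)\<close> into
      the image of \<open>\<psi>\<close>, although \<open>0 < a - b < p\<close>.\<close>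
    have key: "a \<le> b"
      if "a < p" "b < p" "xs \<in> carrier (Zp_power p k)" "ys \<in> carrier (Zp_power p k)"
        "x [^] a \<otimes> \<psi> xs = x [^] b \<otimes> \<psi> ys" for a b xs ys
    proof (rule ccontr)
      assume "\<not> a \<le> b"
      hence ab: "a = b + (a - b)" "0 < a - b" "a - b < p" using that by auto
      have c: "\<psi> xs \<in> carrier G" "\<psi> ys \<in> carrier G" using that by auto
      have "x [^] b \<otimes> (x [^] (a - b) \<otimes> \<psi> xs) = x [^] b \<otimes> \<psi> ys"
        using that(5) ab(1) x c by (metis m_assoc nat_pow_closed nat_pow_mult)
      hence "x [^] (a - b) \<otimes> \<psi> xs = \<psi> ys" using x c by simp
      hence "x [^] (a - b) = \<psi> ys \<otimes> inv (\<psi> xs)" using x c by (metis inv_solve_right' nat_pow_closed)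
      also have "\<dots> \<in> ?I" using sub that c
        by (meson imageI subgroup.m_closed subgroup.m_inv_closed)
      finally have "x [^] (a - b) \<in> ?I" .
      moreover have "coprime (a - b) p"
        using ab assms(1) by (metis coprime_commute nat_dvd_not_less prime_imp_coprime_nat)
      ultimately show False using subgroup_mem_of_pow_mem[OF sub x(1) expo[OF x(1)]] x by blast
    qed
    show ?thesis
    proof (rule inj_onI)
      fix u v assume u: "u \<in> carrier (Zp_power p (Suc k))" "v \<in> carrier (Zp_power p (Suc k))" "\<psi>' u = \<psi>' v"
      then obtain a xs b ys where eq: "u = a # xs" "v = b # ys" and ab: "a < p" "b < p"
        and xs: "xs \<in> carrier (Zp_power p k)" and ys: "ys \<in> carrier (Zp_power p k)"
        using cons[OF u(1)] cons[OF u(2)] by blast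
      have e: "x [^] a \<otimes> \<psi> xs = x [^] b \<otimes> \<psi> ys" using u(3) by (simp add: \<psi>'_def eq)
      have "a = b" using key[OF ab xs ys e] key[OF ab(2,1) ys xs e[symmetric]] by simp
      moreover have "\<psi> xs = \<psi> ys" using e \<open>a = b\<close> x gh.hom_closed[OF xs] gh.hom_closed[OF ys] by simp
      ultimately show "u = v" using \<psi>(2) xs ys by (simp add: eq inj_on_def)
    qed
  qed
  ultimately show ?case by blast
qed

lemma (in comm_group) elementary_abelian_iso_Zp_power:
  assumes "Factorial_Ring.prime p" and fin: "finite (carrier G)" and card: "card (carrier G) = p ^ n"
    and expo: "\<And>x. x \<in> carrier G \<Longrightarrow> x [^] p = \<one>"
  shows "G \<cong> Zp_power p n"
proof -
  obtain \<psi> where \<psi>: "\<psi> \<in> hom (Zp_power p n) G" "inj_on \<psi> (carrier (Zp_power p n))"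
    using Zp_power_embeds[OF assms] by blast
  have "\<psi> ` carrier (Zp_power p n) \<subseteq> carrier G" using \<psi>(1) by (auto simp: hom_def)
  moreover have "card (\<psi> ` carrier (Zp_power p n)) = card (carrier G)"
    using card_image[OF \<psi>(2)] card_Zp_power card by simp
  ultimately have "\<psi> ` carrier (Zp_power p n) = carrier G" using fin card_subset_eq by blast
  hence "\<psi> \<in> iso (Zp_power p n) G" using \<psi> by (simp add: iso_def bij_betw_def)
  moreover have "p > 0" using assms(1) prime_gt_0_nat by blast
  ultimately show ?thesis using group.iso_sym[OF group_Zp_power] unfolding is_iso_def by blast
qed

section \<open>Groups acting on a set of p points\<close>

lemma order_BijGroup:
  assumes "finite S"
  shows "finite (carrier (BijGroup S))" "order (BijGroup S) = fact (card S)"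
proof -
  \<comment> \<open>Elements of \<open>Bij S\<close> are \<open>undefined\<close> outside
    \<open>S\<close>, whereas functions that permute \<open>S\<close> are the identity there.
    Changing this convention is a bijection and carries over the count of permutations.\<close>
  have "bij_betw (\<lambda>f. \<lambda>x \<in> S. f x) {f. f permutes S} (Bij S)"
  proof (rule bij_betw_byWitness[where f' = "\<lambda>f x. if x \<in> S then f x else x"])
    show "\<forall>f\<in>{f. f permutes S}. (\<lambda>x. if x \<in> S then restrict f S x else x) = f"
      by (auto simp: permutes_def fun_eq_iff)
    show "\<forall>f\<in>Bij S. restrict (\<lambda>x. if x \<in> S then f x else x) S = f"
      by (auto simp: Bij_def extensional_def fun_eq_iff)
    show "(\<lambda>f. restrict f S) ` {f. f permutes S} \<subseteq> Bij S"
      using permutes_imp_bij by (auto simp: Bij_def)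
    show "(\<lambda>f x. if x \<in> S then f x else x) ` Bij S \<subseteq> {f. f permutes S}"
    proof clarify
      fix f assume "f \<in> Bij S"
      hence "bij_betw (\<lambda>x. if x \<in> S then f x else x) S S"
        by (subst bij_betw_cong[of S _ f]) (auto simp: Bij_def)
      thus "(\<lambda>x. if x \<in> S then f x else x) permutes S"
        by (rule bij_imp_permutes) auto
    qed
  qed
  from bij_betw_same_card[OF this] bij_betw_finite[OF this]
  show "finite (carrier (BijGroup S))" "order (BijGroup S) = fact (card S)"
    using assms finite_permutations card_permutations[OF refl assms]
    by (auto simp: BijGroup_def order_def)
qed

lemma (in group) prime_order_imp_comm:
  assumes "Factorial_Ring.prime (order G)" "x \<in> carrier G" "y \<in> carrier G"
  shows "x \<otimes> y = y \<otimes> x"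
proof (cases "x = \<one>")
  case True thus ?thesis using assms by simp
next
  case False
  have sub: "subgroup (generate G {x}) G" using assms by (simp add: generate_is_subgroup)
  have fin: "finite (carrier G)"
    using prime_gt_0_nat[OF assms(1)] order_gt_0_iff_finite by simp
  have "card (generate G {x}) dvd order G"
    unfolding lagrange[OF sub, symmetric] by simp
  moreover have "card (generate G {x}) \<noteq> 1"
  proof
    assume "card (generate G {x}) = 1"
    then obtain z where "generate G {x} = {z}" by (auto simp: card_1_singleton_iff)
    moreover have "x \<in> generate G {x}" by (simp add: generate.incl)
    moreover have "\<one> \<in> generate G {x}" by (simp add: generate.one)
    ultimately show False using False by auto
  qed
  ultimately have "card (generate G {x}) = order G"
    using assms(1) by (metis prime_nat_iff)
  hence "generate G {x} = carrier G"
    using fin sub subgroup.subset by (metis card_subset_eq order_def)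
  then obtain k :: int where "y = x [^] k" using assms generate_pow[of x] by auto
  thus ?thesis using assms by (metis int_pow_mult add.commute int_pow_1)
qed

lemma (in group_hom) card_image_hom_dvd_order: "card (h ` carrier G) dvd order G"
proof -
  interpret I: group "H\<lparr>carrier := h ` carrier G\<rparr>"
    using img_is_subgroup H.subgroup_imp_group by blast
  interpret I: group_hom G "H\<lparr>carrier := h ` carrier G\<rparr>" h
    by unfold_locales (auto simp: hom_def)
  have "bij_betw (\<lambda>C. the_elem (h ` C)) (carrier (G Mod kernel G (H\<lparr>carrier := h ` carrier G\<rparr>) h)) (h ` carrier G)"
    using I.FactGroup_iso_set by (simp add: iso_def)
  hence "card (rcosets\<^bsub>G\<^esub> kernel G (H\<lparr>carrier := h ` carrier G\<rparr>) h) = card (h ` carrier G)"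
    using bij_betw_same_card by (fastforce simp: FactGroup_def)
  thus ?thesis using G.lagrange[OF I.subgroup_kernel] by (metis dvd_triv_left)
qed

lemma not_prime_square_dvd_fact:
  fixes p :: nat
  assumes "Factorial_Ring.prime p"
  shows "\<not> p ^ 2 dvd fact p"
proof
  assume "p ^ 2 dvd fact p"
  moreover have "fact p = p * fact (p - 1)" using assms prime_gt_0_nat by (simp add: fact_reduce)
  ultimately have "p dvd fact (p - 1)" using assms prime_gt_0_nat by (simp add: power2_eq_square)
  hence "p \<le> p - 1" using prime_dvd_fact_iff[OF assms] by blast
  thus False using prime_gt_0_nat[OF assms] by linarith
qed

text \<open>The image of \<open>h\<close> has an order that is a power of \<open>p\<close> and
  divides \<open>fact p\<close>, hence is 1 or \<open>p\<close>. The conclusions are equations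
  between values of \<open>h\<close>, so that a jointly faithful family of such actions transfers
  them to the group itself.\<close>

lemma (in group) p_group_action_on_p_points:
  assumes p: "Factorial_Ring.prime p" and ord: "order G = p ^ n"
    and h: "h \<in> hom G (BijGroup Y)" and Y: "card Y = p"
    and xy: "x \<in> carrier G" "y \<in> carrier G"
  shows "h (x \<otimes> y) = h (y \<otimes> x)" "h (x [^] p) = h \<one>"
proof -
  interpret B: group "BijGroup Y" by (rule group_BijGroup)
  interpret gh: group_hom G "BijGroup Y" h using h by unfold_locales
  let ?I = "BijGroup Y\<lparr>carrier := h ` carrier G\<rparr>"
  interpret I: group ?I using gh.img_is_subgroup B.subgroup_imp_group by blast
  have "finite Y" using Y p prime_gt_0_nat card_ge_0_finite by blast
  have "card (h ` carrier G) dvd p ^ n" using gh.card_image_hom_dvd_order ord by simp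
  then obtain k where k: "card (h ` carrier G) = p ^ k"
    using p by (metis divides_primepow_nat)
  have "card (h ` carrier G) dvd order (BijGroup Y)"
    using B.lagrange[OF gh.img_is_subgroup] by (metis dvd_triv_right)
  hence "p ^ k dvd fact p" using k order_BijGroup[OF \<open>finite Y\<close>] Y by simp
  hence "\<not> 2 \<le> k" using not_prime_square_dvd_fact[OF p] by (meson dvd_trans le_imp_power_dvd)
  hence "k = 0 \<or> k = 1" by linarith
  hence "order ?I = 1 \<or> order ?I = p" using k by (auto simp: order_def)
  hence *: "(\<forall>u\<in>carrier ?I. \<forall>v\<in>carrier ?I. u \<otimes>\<^bsub>?I\<^esub> v = v \<otimes>\<^bsub>?I\<^esub> u) \<and> (\<forall>u\<in>carrier ?I. u [^]\<^bsub>?I\<^esub> p = \<one>\<^bsub>?I\<^esub>)"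
  proof
    assume 1: "order ?I = 1"
    hence "carrier ?I = {\<one>\<^bsub>?I\<^esub>}" using I.order_one_triv_iff by blast
    thus ?thesis using I.nat_pow_one by (simp del: partial_object.simps)
  next
    assume "order ?I = p"
    thus ?thesis using I.prime_order_imp_comm p I.pow_order_eq_1[of _] by simp
  qed
  show "h (x \<otimes> y) = h (y \<otimes> x)" using * xy by simp
  have "h x [^]\<^bsub>?I\<^esub> p = \<one>\<^bsub>?I\<^esub>" using * xy by simp
  hence "h x [^]\<^bsub>BijGroup Y\<^esub> p = \<one>\<^bsub>BijGroup Y\<^esub>" by (simp add: nat_pow_def)
  thus "h (x [^] p) = h \<one>" using xy by (simp add: gh.hom_nat_pow)
qed

section \<open>Dihedral quotients\<close>

lemma group_dihedral_group:
  assumes "r > 0"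
  shows "group (dihedral_group r)"
proof (rule groupI)
  fix x y z :: "nat \<times> nat"
  assume c: "x \<in> carrier (dihedral_group r)" "y \<in> carrier (dihedral_group r)" "z \<in> carrier (dihedral_group r)"
  show "x \<otimes>\<^bsub>dihedral_group r\<^esub> y \<in> carrier (dihedral_group r)"
    using c assms by (auto simp: dihedral_group_def)
  obtain i a j b k d where eq: "x = (i, a)" "y = (j, b)" "z = (k, d)" by (metis surj_pair)
  have ab: "a = 0 \<or> a = 1" "b = 0 \<or> b = 1" and r: "i < r" "j < r" "k < r"
    using c by (auto simp: eq dihedral_group_def)
  \<comment> \<open>For \<open>j < r\<close> the subtraction in \<open>i + r - j\<close> is not
    truncated, so over the integers the first component is \<open>i + j\<close> or
    \<open>i - j\<close> modulo \<open>r\<close>, and associativity becomes a matter of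
    signs.\<close>
  have fm: "int (fst ((i, a) \<otimes>\<^bsub>dihedral_group r\<^esub> (j, b))) = (int i + (if a = 0 then int j else - int j)) mod int r"
    if "j < r" for i j a b
  proof (cases "a = 0")
    case True thus ?thesis by (simp add: dihedral_group_def of_nat_mod)
  next
    case False
    have "int ((i + r - j) mod r) = (int i + int r - int j) mod int r"
      using that by (simp add: of_nat_mod of_nat_diff)
    also have "\<dots> = (int i - int j + int r) mod int r" by (simp add: algebra_simps)
    finally show ?thesis using False by (simp add: dihedral_group_def)
  qed
  define f where "f = fst ((i, a) \<otimes>\<^bsub>dihedral_group r\<^esub> (j, b))"
  define g where "g = fst ((j, b) \<otimes>\<^bsub>dihedral_group r\<^esub> (k, d))"
  have pair: "(i, a) \<otimes>\<^bsub>dihedral_group r\<^esub> (j, b) = (f, (a + b) mod 2)"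
    "(j, b) \<otimes>\<^bsub>dihedral_group r\<^esub> (k, d) = (g, (b + d) mod 2)" and "g < r"
    using assms by (auto simp: f_def g_def dihedral_group_def)
  have "int f = (int i + (if a = 0 then int j else - int j)) mod int r"
    "int g = (int j + (if b = 0 then int k else - int k)) mod int r"
    using fm r by (auto simp: f_def g_def)
  hence "fst (x \<otimes>\<^bsub>dihedral_group r\<^esub> y \<otimes>\<^bsub>dihedral_group r\<^esub> z)
      = fst (x \<otimes>\<^bsub>dihedral_group r\<^esub> (y \<otimes>\<^bsub>dihedral_group r\<^esub> z))"
    unfolding of_nat_eq_iff[where 'a = int, symmetric] eq pair fm[OF r(3)] fm[OF \<open>g < r\<close>] using ab
    by (elim disjE; simp add: mod_simps; simp add: algebra_simps)
  moreover have "snd (x \<otimes>\<^bsub>dihedral_group r\<^esub> y \<otimes>\<^bsub>dihedral_group r\<^esub> z)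
      = snd (x \<otimes>\<^bsub>dihedral_group r\<^esub> (y \<otimes>\<^bsub>dihedral_group r\<^esub> z))"
    by (simp add: eq dihedral_group_def mod_simps add.assoc)
  ultimately show "x \<otimes>\<^bsub>dihedral_group r\<^esub> y \<otimes>\<^bsub>dihedral_group r\<^esub> z = x \<otimes>\<^bsub>dihedral_group r\<^esub> (y \<otimes>\<^bsub>dihedral_group r\<^esub> z)"
    by (rule prod_eqI)
next
  show "\<one>\<^bsub>dihedral_group r\<^esub> \<in> carrier (dihedral_group r)" using assms by (simp add: dihedral_group_def)
next
  fix x assume c: "x \<in> carrier (dihedral_group r)"
  show "\<one>\<^bsub>dihedral_group r\<^esub> \<otimes>\<^bsub>dihedral_group r\<^esub> x = x"
    using c by (auto simp: dihedral_group_def)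
  obtain i a where eq: "x = (i, a)" by (metis surj_pair)
  have "((if a = 0 then (r - i) mod r else i), a) \<otimes>\<^bsub>dihedral_group r\<^esub> x = \<one>\<^bsub>dihedral_group r\<^esub>"
    using c by (auto simp: eq dihedral_group_def mod_simps less_2_cases_iff)
  moreover have "((if a = 0 then (r - i) mod r else i), a) \<in> carrier (dihedral_group r)"
    using c by (auto simp: eq dihedral_group_def)
  ultimately show "\<exists>y\<in>carrier (dihedral_group r). y \<otimes>\<^bsub>dihedral_group r\<^esub> x = \<one>\<^bsub>dihedral_group r\<^esub>"
    by blast
qed

section \<open>Splitting of extensions by a dihedral group\<close>

lemma is_semidirect_product_of_section:
  assumes gh: "group_hom G D \<phi>" and \<psi>: "\<psi> \<in> hom D G"
    and sec: "\<And>d. d \<in> carrier D \<Longrightarrow> \<phi> (\<psi> d) = d"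
    and iso: "G\<lparr>carrier := kernel G D \<phi>\<rparr> \<cong> A"
  shows "is_semidirect_product_of G A D"
proof -
  interpret group_hom G D \<phi> by fact
  interpret s: group_hom D G \<psi> using \<psi> by unfold_locales
  let ?N = "kernel G D \<phi>" and ?K = "\<psi> ` carrier D"
  have K: "subgroup ?K G" by (rule s.img_is_subgroup)
  have N: "?N \<lhd> G" by (rule normal_kernel)
  have "?N \<inter> ?K = {\<one>\<^bsub>G\<^esub>}"
    by (auto simp: kernel_def sec intro!: image_eqI[where x = "\<one>\<^bsub>D\<^esub>"])
  moreover have "?N <#>\<^bsub>G\<^esub> ?K = carrier G"
  proof
    show "?N <#>\<^bsub>G\<^esub> ?K \<subseteq> carrier G" by (auto simp: set_mult_def kernel_def)
    show "carrier G \<subseteq> ?N <#>\<^bsub>G\<^esub> ?K"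
    proof
      fix g assume g: "g \<in> carrier G"
      let ?k = "\<psi> (\<phi> g)"
      have k: "?k \<in> ?K" "?k \<in> carrier G" using g by auto
      have "g \<otimes>\<^bsub>G\<^esub> inv\<^bsub>G\<^esub> ?k \<in> ?N" using g k by (simp add: kernel_def sec)
      moreover have "g = (g \<otimes>\<^bsub>G\<^esub> inv\<^bsub>G\<^esub> ?k) \<otimes>\<^bsub>G\<^esub> ?k" using g k by (simp add: G.m_assoc)
      ultimately show "g \<in> ?N <#>\<^bsub>G\<^esub> ?K" using k unfolding set_mult_def by blast
    qed
  qed
  moreover have "G\<lparr>carrier := ?K\<rparr> \<cong> D"
  proof -
    have "inj_on \<psi> (carrier D)" by (metis inj_onI sec)
    hence "\<psi> \<in> iso D (G\<lparr>carrier := ?K\<rparr>)" by (auto simp: iso_def hom_def bij_betw_def)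
    thus ?thesis using H.iso_sym unfolding is_iso_def by blast
  qed
  ultimately show ?thesis using N K iso unfolding is_semidirect_product_of_def by blast
qed

lemma (in group) conj_involution_pow:
  fixes n :: nat
  assumes "x \<in> carrier G" "z \<in> carrier G" "x \<otimes> x = \<one>" "x \<otimes> z \<otimes> x = inv z"
  shows "x \<otimes> z [^] n \<otimes> x = inv (z [^] n)"
proof -
  have "x \<otimes> z [^] n \<otimes> x = (x \<otimes> z \<otimes> x) [^] n"
  proof (induction n)
    case 0 thus ?case using assms by simp
  next
    case (Suc n)
    have "x \<otimes> z [^] Suc n \<otimes> x = (x \<otimes> z [^] n) \<otimes> (x \<otimes> x) \<otimes> (z \<otimes> x)"
      using assms(1,2) by (simp add: assms(3) m_assoc)
    also have "\<dots> = (x \<otimes> z [^] n \<otimes> x) \<otimes> (x \<otimes> z \<otimes> x)" using assms(1,2) by (simp add: m_assoc)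
    finally show ?case by (simp add: Suc)
  qed
  thus ?thesis using assms by (simp add: nat_pow_inv)
qed

text \<open>These are the defining relations of the dihedral group. Since that group is given by a
  multiplication table and not by a presentation, the table is checked directly.\<close>

lemma (in group) dihedral_hom:
  fixes r :: nat
  assumes r: "r > 0" and w: "w \<in> carrier G" "w [^] r = \<one>" and x: "x \<in> carrier G" "x \<otimes> x = \<one>"
    and inv: "x \<otimes> w \<otimes> x = inv w"
  shows "(\<lambda>(i, a). w [^] (i :: nat) \<otimes> x [^] (a :: nat)) \<in> hom (dihedral_group r) G" (is "?\<psi> \<in> _")
proof (rule homI)
  fix u v assume c: "u \<in> carrier (dihedral_group r)" "v \<in> carrier (dihedral_group r)"
  obtain i a j b where eq: "u = (i, a)" "v = (j, b)" by (metis surj_pair)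
  have ab: "a = 0 \<or> a = 1" "b < 2" "i < r" "j < r" using c by (auto simp: eq dihedral_group_def)
  show "?\<psi> u \<in> carrier G" using w x by (simp add: eq)
  have x2: "x [^] (2 :: nat) = \<one>" using x by (simp add: numeral_2_eq_2)
  have "x [^] ((a + b) mod 2) = x [^] (a + b)" by (rule pow_mod_exponent[OF x(1) x2])
  also have "\<dots> = x [^] a \<otimes> x [^] b" using x by (simp add: nat_pow_mult)
  finally have xs: "x [^] ((a + b) mod 2) = x [^] a \<otimes> x [^] b" .
  \<comment> \<open>Moving \<open>x\<close> past \<open>w [^] j\<close> inverts the latter. The
    exponent \<open>i + r - j\<close> of the table stands for \<open>i - j\<close>, which is
    legitimate because \<open>w [^] r\<close> is trivial.\<close>
  have swap: "w [^] (if a = 0 then i + j else i + r - j) \<otimes> x [^] a = w [^] i \<otimes> x [^] a \<otimes> w [^] j"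
  proof (cases "a = 0")
    case True thus ?thesis using w by (simp add: nat_pow_mult)
  next
    case False
    hence a: "a = 1" using ab by simp
    have "w [^] (i + r - j) \<otimes> w [^] j = w [^] (i + r)" using w ab by (simp add: nat_pow_mult)
    also have "\<dots> = w [^] i" using w by (simp flip: nat_pow_mult)
    finally have "w [^] (i + r - j) = w [^] i \<otimes> inv (w [^] j)" using w by (metis inv_solve_right nat_pow_closed)
    also have "\<dots> = w [^] i \<otimes> (x \<otimes> w [^] j \<otimes> x)" using conj_involution_pow[OF x(1) w(1) x(2) inv] by simp
    finally have "w [^] (i + r - j) \<otimes> x = w [^] i \<otimes> x \<otimes> w [^] j \<otimes> (x \<otimes> x)" using w x(1) by (simp add: m_assoc)
    thus ?thesis using a w x by simp
  qed
  have "?\<psi> (u \<otimes>\<^bsub>dihedral_group r\<^esub> v) = w [^] (if a = 0 then i + j else i + r - j) \<otimes> x [^] ((a + b) mod 2)"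
    using pow_mod_exponent[OF w] by (simp add: eq dihedral_group_def)
  also have "\<dots> = w [^] i \<otimes> x [^] a \<otimes> w [^] j \<otimes> x [^] b"
    unfolding xs using w x swap by (metis m_assoc nat_pow_closed)
  finally show "?\<psi> (u \<otimes>\<^bsub>dihedral_group r\<^esub> v) = ?\<psi> u \<otimes> ?\<psi> v" using w x by (simp add: eq m_assoc)
qed

text \<open>Lifts of two generating reflections become involutions after raising to the \<open>p\<close>-th power; the
  power of their product with an exponent divisible by \<open>p\<close> and congruent to 1 modulo \<open>r\<close> then has order \<open>r\<close>.\<close>

lemma dihedral_quotient_splits:
  assumes gh: "group_hom G (dihedral_group r) \<phi>" and onto: "\<phi> ` carrier G = carrier (dihedral_group r)"
    and r: "r > 1" and p: "Factorial_Ring.prime p" "odd p" "\<not> p dvd r"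
    and expo: "\<And>x. x \<in> kernel G (dihedral_group r) \<phi> \<Longrightarrow> x [^]\<^bsub>G\<^esub> p = \<one>\<^bsub>G\<^esub>"
  shows "\<exists>\<psi> \<in> hom (dihedral_group r) G. \<forall>d \<in> carrier (dihedral_group r). \<phi> (\<psi> d) = d"
proof -
  interpret group_hom G "dihedral_group r" \<phi> by fact
  let ?D = "dihedral_group r"
  have one: "\<one>\<^bsub>?D\<^esub> = (0, 0)" by (simp add: dihedral_group_def)
  have refl: "\<exists>x \<in> carrier G. x \<otimes>\<^bsub>G\<^esub> x = \<one>\<^bsub>G\<^esub> \<and> \<phi> x = (i, 1)" if "i < r" for i
  proof -
    have "(i, 1) \<in> carrier ?D" using that by (simp add: dihedral_group_def)
    then obtain x0 where x0: "x0 \<in> carrier G" "\<phi> x0 = (i, 1)" using onto by (metis imageE)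
    have sq: "(i, 1) \<otimes>\<^bsub>?D\<^esub> (i, 1) = \<one>\<^bsub>?D\<^esub>" using that by (simp add: dihedral_group_def)
    have "x0 \<otimes>\<^bsub>G\<^esub> x0 \<in> kernel G ?D \<phi>" using x0 sq by (simp add: kernel_def)
    hence "(x0 \<otimes>\<^bsub>G\<^esub> x0) [^]\<^bsub>G\<^esub> p = \<one>\<^bsub>G\<^esub>" by (rule expo)
    hence 1: "x0 [^]\<^bsub>G\<^esub> p \<otimes>\<^bsub>G\<^esub> x0 [^]\<^bsub>G\<^esub> p = \<one>\<^bsub>G\<^esub>"
      using x0 by (simp add: G.pow_mult_distrib)
    \<comment> \<open>The image does not change under the power \<open>p\<close>: this exponent is
      odd and the square of \<open>x0\<close> lies in the kernel of \<open>\<phi>\<close>, so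
      exactly one factor \<open>x0\<close> survives.\<close>
    obtain q where q: "p = Suc (2 * q)" using p(2) by (metis oddE add.commute plus_1_eq_Suc)
    have "x0 [^]\<^bsub>G\<^esub> p = (x0 [^]\<^bsub>G\<^esub> (2::nat)) [^]\<^bsub>G\<^esub> q \<otimes>\<^bsub>G\<^esub> x0"
      using x0 by (simp add: q G.nat_pow_pow)
    also have "\<phi> \<dots> = (\<phi> (x0 [^]\<^bsub>G\<^esub> (2::nat))) [^]\<^bsub>?D\<^esub> q \<otimes>\<^bsub>?D\<^esub> (i, 1)"
      using x0 by (simp add: hom_nat_pow)
    also have "\<phi> (x0 [^]\<^bsub>G\<^esub> (2::nat)) = \<one>\<^bsub>?D\<^esub>"
      using x0 sq by (simp add: numeral_2_eq_2)
    also have "\<one>\<^bsub>?D\<^esub> [^]\<^bsub>?D\<^esub> q \<otimes>\<^bsub>?D\<^esub> (i, 1) = (i, 1)"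
      using \<open>(i, 1) \<in> carrier ?D\<close> by simp
    finally have "\<phi> (x0 [^]\<^bsub>G\<^esub> p) = (i, 1)" .
    with 1 show ?thesis using x0 by (intro bexI[of _ "x0 [^]\<^bsub>G\<^esub> p"]) simp_all
  qed
  obtain x where x: "x \<in> carrier G" "x \<otimes>\<^bsub>G\<^esub> x = \<one>\<^bsub>G\<^esub>" "\<phi> x = (0, 1)" using refl[of 0] r by auto
  obtain y where y: "y \<in> carrier G" "y \<otimes>\<^bsub>G\<^esub> y = \<one>\<^bsub>G\<^esub>" "\<phi> y = (1, 1)" using refl[of 1] r by auto
  define z where "z = y \<otimes>\<^bsub>G\<^esub> x"
  have z: "z \<in> carrier G" "\<phi> z = (1, 0)" using x y r by (auto simp: z_def dihedral_group_def mod_Suc)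
  have invs: "inv\<^bsub>G\<^esub> x = x" "inv\<^bsub>G\<^esub> y = y" using x y by (auto intro: G.inv_equality)
  have "x \<otimes>\<^bsub>G\<^esub> z \<otimes>\<^bsub>G\<^esub> x = x \<otimes>\<^bsub>G\<^esub> y \<otimes>\<^bsub>G\<^esub> (x \<otimes>\<^bsub>G\<^esub> x)"
    using x(1) y(1) by (simp add: z_def G.m_assoc)
  also have "\<dots> = inv\<^bsub>G\<^esub> z" using x y by (simp add: z_def G.inv_mult_group invs)
  finally have xzx: "x \<otimes>\<^bsub>G\<^esub> z \<otimes>\<^bsub>G\<^esub> x = inv\<^bsub>G\<^esub> z" .
  have "coprime p r" using p by (simp add: prime_imp_coprime)
  then obtain l where l: "[p * l = Suc 0] (mod r)" using cong_solve_coprime_nat by blast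
  have \<phi>z: "\<phi> (z [^]\<^bsub>G\<^esub> n) = (n mod r, 0)" for n :: nat
  proof (induction n)
    case 0 thus ?case using r by (simp add: one)
  next
    case (Suc n) thus ?case using z r by (simp add: dihedral_group_def mod_simps)
  qed
  define w where "w = z [^]\<^bsub>G\<^esub> (p * l)"
  have w: "w \<in> carrier G" using z by (simp add: w_def)
  have "w [^]\<^bsub>G\<^esub> r = ((z [^]\<^bsub>G\<^esub> r) [^]\<^bsub>G\<^esub> p) [^]\<^bsub>G\<^esub> l"
    using z by (simp add: w_def G.nat_pow_pow mult_ac)
  also have "(z [^]\<^bsub>G\<^esub> r) [^]\<^bsub>G\<^esub> p = \<one>\<^bsub>G\<^esub>"
    by (rule expo) (use z \<phi>z[of r] in \<open>simp add: kernel_def one\<close>)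
  finally have wr: "w [^]\<^bsub>G\<^esub> r = \<one>\<^bsub>G\<^esub>" by simp
  have \<psi>: "(\<lambda>(i, a). w [^]\<^bsub>G\<^esub> (i :: nat) \<otimes>\<^bsub>G\<^esub> x [^]\<^bsub>G\<^esub> (a :: nat)) \<in> hom ?D G" (is "?\<psi> \<in> _")
    using r w wr x xzx G.conj_involution_pow[OF x(1) z(1) x(2) xzx, of "p * l"]
    by (intro G.dihedral_hom) (auto simp: w_def)
  moreover have "\<phi> (?\<psi> d) = d" if d: "d \<in> carrier ?D" for d
  proof -
    obtain i a where eq: "d = (i, a)" and i: "i < r" and a: "a = 0 \<or> a = 1"
      using d by (auto simp: dihedral_group_def less_2_cases_iff)
    have "w [^]\<^bsub>G\<^esub> i = z [^]\<^bsub>G\<^esub> (p * l * i)" using z by (simp add: w_def G.nat_pow_pow)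
    hence "\<phi> (w [^]\<^bsub>G\<^esub> i) = ((p * l * i) mod r, 0)" using \<phi>z by simp
    also have "(p * l * i) mod r = i" using l i by (metis cong_def cong_scalar_right mod_less mult.left_neutral One_nat_def)
    finally have "\<phi> (w [^]\<^bsub>G\<^esub> i) = (i, 0)" .
    thus ?thesis using a w x i by (auto simp: eq one) (auto simp: dihedral_group_def)
  qed
  ultimately show ?thesis by blast
qed

text \<open>Joint faithfulness embeds the kernel into a product of groups of order 1 or
  \<open>p\<close>. It is stated for pairs of elements so that it applies directly to
  \<open>x y\<close> against \<open>y x\<close>, and to the \<open>p\<close>-th power of
  \<open>x\<close> against the identity.\<close>

lemma is_semidirect_product_of_Zp_power_dihedral:
  fixes \<alpha> :: "'i \<Rightarrow> 'g \<Rightarrow> 'x \<Rightarrow> 'x" and G :: "('g, 'm) monoid_scheme" and Y :: "'i \<Rightarrow> 'x set"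
  assumes G: "group G" and \<phi>: "\<phi> \<in> hom G (dihedral_group r)"
    and onto: "\<phi> ` carrier G = carrier (dihedral_group r)"
    and r: "r > 1" and p: "Factorial_Ring.prime p" "odd p" "\<not> p dvd r"
    and card: "card (kernel G (dihedral_group r) \<phi>) = p ^ n"
    and Y: "\<And>i. i \<in> I \<Longrightarrow> card (Y i) = p"
    and \<alpha>: "\<And>i. i \<in> I \<Longrightarrow> \<alpha> i \<in> hom (G\<lparr>carrier := kernel G (dihedral_group r) \<phi>\<rparr>) (BijGroup (Y i))"
    and faithful: "\<And>g h. g \<in> kernel G (dihedral_group r) \<phi> \<Longrightarrow> h \<in> kernel G (dihedral_group r) \<phi> \<Longrightarrow>
        (\<And>i. i \<in> I \<Longrightarrow> \<alpha> i g = \<alpha> i h) \<Longrightarrow> g = h"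
  shows "is_semidirect_product_of G (Zp_power p n) (dihedral_group r)"
proof -
  interpret G: group G by fact
  interpret D: group "dihedral_group r" using r by (intro group_dihedral_group) simp
  interpret group_hom G "dihedral_group r" \<phi> using \<phi> by unfold_locales
  let ?K = "kernel G (dihedral_group r) \<phi>"
  define N where "N = G\<lparr>carrier := ?K\<rparr>"
  note \<alpha> = \<alpha>[folded N_def]
  interpret N: group "N" unfolding N_def by (rule G.subgroup_imp_group[OF subgroup_kernel])
  have carrier: "carrier N = ?K" by (simp add: N_def)
  have order: "order N = p ^ n" using card by (simp add: order_def carrier)
  have comm: "x \<otimes>\<^bsub>N\<^esub> y = y \<otimes>\<^bsub>N\<^esub> x" if "x \<in> carrier N" "y \<in> carrier N" for x y
    using that N.p_group_action_on_p_points(1)[OF p(1) order \<alpha> Y that] carrier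
    by (intro faithful) (metis N.m_closed)+
  have expo: "x [^]\<^bsub>N\<^esub> p = \<one>\<^bsub>N\<^esub>" if "x \<in> carrier N" for x
    using that N.p_group_action_on_p_points(2)[OF p(1) order \<alpha> Y that that] carrier
    by (intro faithful) (metis N.nat_pow_closed N.one_closed)+
  interpret N: comm_group "N" by (rule N.group_comm_groupI) (rule comm)
  have "finite (carrier N)" using card p(1) carrier
    by (metis card_ge_0_finite prime_gt_0_nat zero_less_power)
  hence "N \<cong> Zp_power p n"
    using N.elementary_abelian_iso_Zp_power[OF p(1)] card carrier expo by metis
  moreover obtain \<psi> where \<psi>: "\<psi> \<in> hom (dihedral_group r) G"
      "\<And>d. d \<in> carrier (dihedral_group r) \<Longrightarrow> \<phi> (\<psi> d) = d"
    using dihedral_quotient_splits[OF group_hom_axioms onto r p] expo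
    by (auto simp: N_def nat_pow_def)
  ultimately show ?thesis
    using is_semidirect_product_of_section[OF group_hom_axioms \<psi>] by (simp add: N_def)
qed

section \<open>Arc-regular groups over a cycle\<close>

text \<open>The action on residues modulo \<open>r\<close>: \<open>(c, 0)\<close> is the rotation
  \<open>i \<mapsto> c + i\<close> and \<open>(c, 1)\<close> the reflection
  \<open>i \<mapsto> c - i\<close>. Adding \<open>r\<close> prevents truncation for
  \<open>i < r\<close>.\<close>

definition dihedral_act :: "nat \<Rightarrow> nat \<times> nat \<Rightarrow> nat \<Rightarrow> nat" where
  "dihedral_act r d i = (if snd d = 0 then fst d + i else fst d + r - i) mod r"

lemma dihedral_mult_conv_act:
  "d \<otimes>\<^bsub>dihedral_group r\<^esub> d' = (dihedral_act r d (fst d'), (snd d + snd d') mod 2)"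
  by (auto simp: dihedral_group_def dihedral_act_def split: prod.splits)

text \<open>The first component of a product is the action of the left factor on the first component
  of the right one. The action law is therefore associativity with third factor
  \<open>(i, 0)\<close>.\<close>

lemma dihedral_act_mult:
  assumes "d \<in> carrier (dihedral_group r)" "d' \<in> carrier (dihedral_group r)" "i < r"
  shows "dihedral_act r (d \<otimes>\<^bsub>dihedral_group r\<^esub> d') i = dihedral_act r d (dihedral_act r d' i)"
proof -
  interpret group "dihedral_group r" using assms(3) by (intro group_dihedral_group) simp
  have "(i, 0) \<in> carrier (dihedral_group r)" using assms by (simp add: dihedral_group_def)
  from arg_cong[OF m_assoc[OF assms(1,2) this], of fst] show ?thesis
    by (simp add: dihedral_mult_conv_act)
qed

lemma dihedral_act_0: "d \<in> carrier (dihedral_group r) \<Longrightarrow> dihedral_act r d 0 = fst d"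
  by (auto simp: dihedral_act_def dihedral_group_def)

text \<open>The image of 0 is the first component \<open>c\<close> of \<open>d\<close>, and the
  image of 1 is \<open>c + 1\<close> or \<open>c - 1\<close> according to the second component.
  These two differ because 2 is not 0 modulo \<open>r\<close>.\<close>

lemma dihedral_act_inj:
  assumes "r \<ge> 3" "d \<in> carrier (dihedral_group r)" "d' \<in> carrier (dihedral_group r)"
    and "dihedral_act r d 0 = dihedral_act r d' 0" "dihedral_act r d 1 = dihedral_act r d' 1"
  shows "d = d'"
proof -
  obtain c a where d: "d = (c, a)" "c < r" "a < 2" using assms(2) by (auto simp: dihedral_group_def)
  obtain c' a' where d': "d' = (c', a')" "c' < r" "a' < 2" using assms(3) by (auto simp: dihedral_group_def)
  have "c = c'" using assms(2,3,4) dihedral_act_0 d d' by force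
  have ne: "(c + 1) mod r \<noteq> (c + r - 1) mod r"
  proof
    assume "(c + 1) mod r = (c + r - 1) mod r"
    hence "[c + 1 = c + r - 1] (mod r)" by (simp add: cong_def)
    hence "[(c + 1) + 1 = (c + r - 1) + 1] (mod r)" by (rule cong_add) simp
    moreover have "(c + r - 1) + 1 = c + r" using assms(1) by simp
    ultimately have "[c + 2 = c + 0] (mod r)" by (simp add: cong_def)
    hence "[2 = 0] (mod r)" by (rule cong_add_lcancel_nat[THEN iffD1])
    thus False using assms(1) by (simp add: cong_def)
  qed
  have "a = a'"
    using assms(5) ne d(3) d'(3) \<open>c = c'\<close> by (auto simp: dihedral_act_def d d' less_2_cases_iff)
  with \<open>c = c'\<close> show ?thesis by (simp add: d d')
qed

lemma dihedral_act_one: "i < r \<Longrightarrow> dihedral_act r \<one>\<^bsub>dihedral_group r\<^esub> i = i"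
  by (simp add: dihedral_act_def dihedral_group_def)

text \<open>A local-to-global argument. \<open>R\<close> is a step forward along the cycle, and
  \<open>same\<close> says that at each single vertex \<open>f\<close> either keeps or swaps the
  forward and backward neighbours. Both ends of an edge see the same choice, so connectedness makes
  it uniform, and \<open>f\<close> covers a rotation or a reflection.\<close>

lemma orientation_respecting_map:
  fixes R :: "'v \<Rightarrow> 'v \<Rightarrow> bool" and \<pi> :: "'v \<Rightarrow> nat"
  defines "adj \<equiv> \<lambda>u w. R u w \<or> R w u"
  assumes r: "r \<ge> 3"
    and R: "\<And>u w. R u w \<Longrightarrow> u \<in> V \<and> w \<in> V \<and> \<pi> w = (\<pi> u + 1) mod r"
    and \<pi>: "\<And>v. v \<in> V \<Longrightarrow> \<pi> v < r"
    and f: "\<And>v. v \<in> V \<Longrightarrow> f v \<in> V"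
    and conn: "\<And>u w. u \<in> V \<Longrightarrow> w \<in> V \<Longrightarrow> adj\<^sup>*\<^sup>* u w"
    and adj_f: "\<And>u w. adj u w \<Longrightarrow> adj (f u) (f w)"
    and same: "\<And>v w w'. adj v w \<Longrightarrow> adj v w' \<Longrightarrow>
        (R v w \<longleftrightarrow> R v w') \<longleftrightarrow> (R (f v) (f w) \<longleftrightarrow> R (f v) (f w'))"
  shows "\<exists>d \<in> carrier (dihedral_group r). \<forall>v \<in> V. \<pi> (f v) = dihedral_act r d (\<pi> v)"
proof -
  have asym: "\<not> R w u" if "R u w" for u w
  proof
    assume "R w u"
    have "\<pi> w = (\<pi> u + 1) mod r" "\<pi> u = (\<pi> w + 1) mod r" using R[OF that] R[OF \<open>R w u\<close>] by auto
    hence "\<pi> u = ((\<pi> u + 1) mod r + 1) mod r" by metis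
    hence "\<pi> u = (\<pi> u + 2) mod r" by (simp add: mod_simps)
    hence "[\<pi> u + 0 = \<pi> u + 2] (mod r)" using \<pi> R[OF that] by (simp add: cong_def)
    hence "[0 = 2] (mod r)" by (rule cong_add_lcancel_nat[THEN iffD1])
    thus False using r by (simp add: cong_def)
  qed
  \<comment> \<open>\<open>\<epsilon> u w\<close> records whether \<open>f\<close> keeps the
    direction of the edge. By \<open>sym\<close> it does not matter from which end the edge is read,
    by \<open>loc\<close> which edge at a vertex is taken; so the value spreads along paths.\<close>
  define \<epsilon> where "\<epsilon> = (\<lambda>u w. R u w \<longleftrightarrow> R (f u) (f w))"
  have sym: "\<epsilon> u w = \<epsilon> w u" if "adj u w" for u w
    using that adj_f[OF that] asym unfolding \<epsilon>_def adj_def by blast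
  have loc: "\<epsilon> v w = \<epsilon> v w'" if "adj v w" "adj v w'" for v w w'
    using same[OF that] unfolding \<epsilon>_def by blast
  have adj_sym: "adj u w \<Longrightarrow> adj w u" for u w unfolding adj_def by blast
  have glob: "\<epsilon> u w = \<epsilon> u' w'" if "adj u w" "adj u' w'" for u w u' w'
  proof -
    have "u \<in> V" "u' \<in> V" using that R unfolding adj_def by blast+
    from conn[OF this] have "\<forall>w'. adj u' w' \<longrightarrow> \<epsilon> u w = \<epsilon> u' w'"
    proof (induction rule: rtranclp_induct)
      case base thus ?case using loc that by blast
    next
      case (step y z) thus ?case using loc sym adj_sym by blast
    qed
    thus ?thesis using that by blast
  qed
  have D: "(c, a) \<in> carrier (dihedral_group r) \<longleftrightarrow> c < r \<and> a < 2" for c a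
    by (simp add: dihedral_group_def)
  show ?thesis
  proof (cases "V = {}")
    case True thus ?thesis using D[of 0 0] r by auto
  next
    case False
    then obtain v0 where v0: "v0 \<in> V" by blast
    have "(\<forall>u w. R u w \<longrightarrow> R (f u) (f w)) \<or> (\<forall>u w. R u w \<longrightarrow> R (f w) (f u))"
      using glob adj_f unfolding \<epsilon>_def adj_def by blast
    thus ?thesis
    proof
      assume pos: "\<forall>u w. R u w \<longrightarrow> R (f u) (f w)"
      \<comment> \<open>If all directions are kept, the difference of \<open>\<pi> (f v)\<close> and
        \<open>\<pi> v\<close> is constant modulo \<open>r\<close>; this is its value at
        \<open>v0\<close>.\<close>
      define c where "c = (\<pi> (f v0) + r - \<pi> v0) mod r"
      have "[\<pi> (f v) = c + \<pi> v] (mod r)" if "v \<in> V" for v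
        using conn[OF v0 that]
      proof (induction rule: rtranclp_induct)
        case base
        have "\<pi> (f v0) + r - \<pi> v0 + \<pi> v0 = \<pi> (f v0) + r" using \<pi>[OF v0] by simp
        thus ?case by (simp add: c_def cong_def mod_simps)
      next
        case (step y z)
        have key: "[\<pi> (f u) = c + \<pi> u] (mod r) \<longleftrightarrow> [\<pi> (f w) = c + \<pi> w] (mod r)" if "R u w" for u w
        proof -
          have "[\<pi> w = \<pi> u + 1] (mod r)" "[\<pi> (f w) = \<pi> (f u) + 1] (mod r)"
            using R[OF that] R[of "f u" "f w"] pos that by (auto simp: cong_def)
          thus ?thesis by (smt (verit) add.assoc cong_add_lcancel_nat cong_add_rcancel_nat cong_sym cong_trans)
        qed
        show ?case using step key unfolding adj_def by blast
      qed
      from this[unfolded cong_def] have "\<pi> (f v) = dihedral_act r (c, 0) (\<pi> v)" if "v \<in> V" for v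
        using that \<pi>[OF f[OF that]] by (metis dihedral_act_def fst_conv mod_less snd_conv)
      moreover have "(c, 0) \<in> carrier (dihedral_group r)" using r by (simp add: D c_def)
      ultimately show ?thesis by blast
    next
      assume neg: "\<forall>u w. R u w \<longrightarrow> R (f w) (f u)"
      \<comment> \<open>If all directions are reversed, it is the sum that stays constant.\<close>
      define c where "c = (\<pi> (f v0) + \<pi> v0) mod r"
      have main: "[\<pi> (f v) + \<pi> v = c] (mod r)" if "v \<in> V" for v
        using conn[OF v0 that]
      proof (induction rule: rtranclp_induct)
        case base thus ?case by (simp add: c_def cong_def mod_simps)
      next
        case (step y z)
        have key: "[\<pi> (f u) + \<pi> u = \<pi> (f w) + \<pi> w] (mod r)" if "R u w" for u w
        proof -
          have 1: "[\<pi> w = \<pi> u + 1] (mod r)" "[\<pi> (f u) = \<pi> (f w) + 1] (mod r)"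
            using R[OF that] R[of "f w" "f u"] neg that by (auto simp: cong_def)
          have "[\<pi> (f u) + \<pi> u = \<pi> (f w) + 1 + \<pi> u] (mod r)" using 1(2) by (rule cong_add) simp
          moreover have "[\<pi> (f w) + \<pi> w = \<pi> (f w) + (\<pi> u + 1)] (mod r)" using 1(1) by (intro cong_add) simp
          ultimately show ?thesis by (simp add: add_ac cong_def)
        qed
        show ?case using step key unfolding adj_def by (metis cong_sym cong_trans)
      qed
      have "\<pi> (f v) = dihedral_act r (c, 1) (\<pi> v)" if "v \<in> V" for v
      proof -
        have "[\<pi> (f v) + \<pi> v = (c + r - \<pi> v) + \<pi> v] (mod r)"
          using main[OF that] \<pi>[OF that] by (simp add: cong_def)
        hence "[\<pi> (f v) = c + r - \<pi> v] (mod r)" by (rule cong_add_rcancel_nat[THEN iffD1])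
        thus ?thesis using \<pi>[OF f[OF that]] by (simp add: dihedral_act_def cong_def)
      qed
      moreover have "(c, 1) \<in> carrier (dihedral_group r)" using r by (simp add: D c_def)
      ultimately show ?thesis by blast
    qed
  qed
qed

section \<open>Automorphism groups of multigraphs\<close>

lemma aut_group_simps:
  "carrier (aut_group \<Gamma>) = {g. is_graph_aut \<Gamma> g}"
  "g \<otimes>\<^bsub>aut_group \<Gamma>\<^esub> h = (compose (gverts \<Gamma>) (fst g) (fst h), compose (gedges \<Gamma>) (snd g) (snd h))"
  "\<one>\<^bsub>aut_group \<Gamma>\<^esub> = ((\<lambda>x \<in> gverts \<Gamma>. x), (\<lambda>e \<in> gedges \<Gamma>. e))"
  by (simp_all add: aut_group_def)

lemma is_graph_aut_alt:
  "is_graph_aut \<Gamma> g \<longleftrightarrow> fst g \<in> Bij (gverts \<Gamma>) \<and> snd g \<in> Bij (gedges \<Gamma>) \<and>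
     (\<forall>e \<in> gedges \<Gamma>. fst (snd g e) = fst g ` fst e)"
  by (auto simp: is_graph_aut_def Bij_def)

text \<open>Vertex maps are extensional, so composites and the identity of the group are
  \<open>undefined\<close> outside the vertex set. By \<open>wf\<close> incidence is tested only at
  vertices, where they have the intended values.\<close>

lemma group_aut_group:
  assumes wf: "\<And>e. e \<in> gedges \<Gamma> \<Longrightarrow> fst e \<subseteq> gverts \<Gamma>"
  shows "group (aut_group \<Gamma>)"
proof (rule groupI)
  fix g h k assume c: "g \<in> carrier (aut_group \<Gamma>)" "h \<in> carrier (aut_group \<Gamma>)" "k \<in> carrier (aut_group \<Gamma>)"
  have "fst (compose (gedges \<Gamma>) (snd g) (snd h) e) = compose (gverts \<Gamma>) (fst g) (fst h) ` fst e"
    if e: "e \<in> gedges \<Gamma>" for e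
  proof -
    have "snd h e \<in> gedges \<Gamma>"
      using c(2) e Bij_imp_funcset by (fastforce simp: aut_group_simps is_graph_aut_alt)
    hence "fst (compose (gedges \<Gamma>) (snd g) (snd h) e) = fst g ` fst h ` fst e"
      using c e by (simp add: aut_group_simps is_graph_aut_alt compose_def)
    also have "\<dots> = compose (gverts \<Gamma>) (fst g) (fst h) ` fst e"
      using wf[OF e] by (force simp: compose_def)
    finally show ?thesis .
  qed
  thus "g \<otimes>\<^bsub>aut_group \<Gamma>\<^esub> h \<in> carrier (aut_group \<Gamma>)"
    using c by (simp add: aut_group_simps is_graph_aut_alt compose_Bij)
  show "g \<otimes>\<^bsub>aut_group \<Gamma>\<^esub> h \<otimes>\<^bsub>aut_group \<Gamma>\<^esub> k = g \<otimes>\<^bsub>aut_group \<Gamma>\<^esub> (h \<otimes>\<^bsub>aut_group \<Gamma>\<^esub> k)"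
    using c by (simp add: aut_group_simps is_graph_aut_alt compose_assoc[symmetric] Bij_imp_funcset)
next
  show "\<one>\<^bsub>aut_group \<Gamma>\<^esub> \<in> carrier (aut_group \<Gamma>)"
    using wf by (force simp: aut_group_simps is_graph_aut_alt id_Bij)
next
  fix g assume c: "g \<in> carrier (aut_group \<Gamma>)"
  have b: "fst g \<in> Bij (gverts \<Gamma>)" "snd g \<in> Bij (gedges \<Gamma>)" and
    inc: "\<And>e. e \<in> gedges \<Gamma> \<Longrightarrow> fst (snd g e) = fst g ` fst e"
    using c by (auto simp: aut_group_simps is_graph_aut_alt)
  show "\<one>\<^bsub>aut_group \<Gamma>\<^esub> \<otimes>\<^bsub>aut_group \<Gamma>\<^esub> g = g"
    using b by (simp add: aut_group_simps Id_compose Bij_imp_funcset Bij_imp_extensional)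
  define h where "h = (restrict (inv_into (gverts \<Gamma>) (fst g)) (gverts \<Gamma>), restrict (inv_into (gedges \<Gamma>) (snd g)) (gedges \<Gamma>))"
  have "fst (snd h e) = fst h ` fst e" if e: "e \<in> gedges \<Gamma>" for e
  proof -
    have img: "snd g ` gedges \<Gamma> = gedges \<Gamma>" using b by (auto simp: Bij_def bij_betw_def)
    then obtain e' where e': "e' \<in> gedges \<Gamma>" "snd g e' = e" using e by (metis imageE)
    have inj: "inj_on (snd g) (gedges \<Gamma>)" "inj_on (fst g) (gverts \<Gamma>)" using b by (auto simp: Bij_def bij_betw_def)
    have "snd h e = e'" using e e' inj by (auto simp: h_def)
    moreover have "fst e = fst g ` fst e'" using inc[OF e'(1)] e' by simp
    moreover have "fst h (fst g v) = v" if "v \<in> gverts \<Gamma>" for v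
    proof -
      have "fst g v \<in> gverts \<Gamma>" using b that by (meson Bij_imp_funcset funcset_mem)
      thus ?thesis using that inj by (simp add: h_def)
    qed
    ultimately show ?thesis using wf[OF e'(1)] by (force simp: image_image)
  qed
  hence "h \<in> carrier (aut_group \<Gamma>)"
    using restrict_inv_into_Bij[OF b(1)] restrict_inv_into_Bij[OF b(2)]
    by (simp add: aut_group_simps is_graph_aut_alt h_def)
  moreover have "h \<otimes>\<^bsub>aut_group \<Gamma>\<^esub> g = \<one>\<^bsub>aut_group \<Gamma>\<^esub>"
    using Bij_compose_restrict_eq[OF b(1)] Bij_compose_restrict_eq[OF b(2)] by (simp add: aut_group_simps h_def)
  ultimately show "\<exists>y\<in>carrier (aut_group \<Gamma>). y \<otimes>\<^bsub>aut_group \<Gamma>\<^esub> g = \<one>\<^bsub>aut_group \<Gamma>\<^esub>" by blast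
qed

section \<open>Arc-regular groups and their projection to a cycle\<close>

locale arc_regular_group =
  fixes \<Gamma> :: "'v mgraph" and H
  assumes edge_subset: "\<And>e. e \<in> gedges \<Gamma> \<Longrightarrow> fst e \<subseteq> gverts \<Gamma>"
    and subgroup_H: "subgroup H (aut_group \<Gamma>)"
    and regular: "arc_regular \<Gamma> H"
begin

abbreviation G where "G \<equiv> (aut_group \<Gamma>)\<lparr>carrier := H\<rparr>"

sublocale G: group G
  using group.subgroup_imp_group[OF group_aut_group[OF edge_subset] subgroup_H] .

lemma H_aut: "g \<in> H \<Longrightarrow> is_graph_aut \<Gamma> g"
  using subgroup.subset[OF subgroup_H] by (auto simp: aut_group_simps)

lemma bij_verts: "g \<in> H \<Longrightarrow> bij_betw (fst g) (gverts \<Gamma>) (gverts \<Gamma>)"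
  and bij_edges: "g \<in> H \<Longrightarrow> bij_betw (snd g) (gedges \<Gamma>) (gedges \<Gamma>)"
  and ends: "g \<in> H \<Longrightarrow> e \<in> gedges \<Gamma> \<Longrightarrow> fst (snd g e) = fst g ` fst e"
  using H_aut by (auto simp: is_graph_aut_def)

lemma vert_closed: "g \<in> H \<Longrightarrow> v \<in> gverts \<Gamma> \<Longrightarrow> fst g v \<in> gverts \<Gamma>"
  and edge_closed: "g \<in> H \<Longrightarrow> e \<in> gedges \<Gamma> \<Longrightarrow> snd g e \<in> gedges \<Gamma>"
  using bij_verts bij_edges bij_betwE by blast+

lemma mult_verts: "v \<in> gverts \<Gamma> \<Longrightarrow> fst (g \<otimes>\<^bsub>G\<^esub> h) v = fst g (fst h v)"
  and mult_edges: "e \<in> gedges \<Gamma> \<Longrightarrow> snd (g \<otimes>\<^bsub>G\<^esub> h) e = snd g (snd h e)"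
  and one_verts: "v \<in> gverts \<Gamma> \<Longrightarrow> fst \<one>\<^bsub>G\<^esub> v = v"
  and one_edges: "e \<in> gedges \<Gamma> \<Longrightarrow> snd \<one>\<^bsub>G\<^esub> e = e"
  by (simp_all add: aut_group_simps compose_def)

lemma H_eqI:
  assumes "g \<in> H" "h \<in> H" "\<And>v. v \<in> gverts \<Gamma> \<Longrightarrow> fst g v = fst h v" "\<And>e. e \<in> gedges \<Gamma> \<Longrightarrow> snd g e = snd h e"
  shows "g = h"
  using assms H_aut[of g] H_aut[of h] by (auto simp: is_graph_aut_def intro!: prod_eqI extensionalityI)

lemma inv_verts: "g \<in> H \<Longrightarrow> v \<in> gverts \<Gamma> \<Longrightarrow> fst (inv\<^bsub>G\<^esub> g) (fst g v) = v"
  and inv_verts': "g \<in> H \<Longrightarrow> v \<in> gverts \<Gamma> \<Longrightarrow> fst g (fst (inv\<^bsub>G\<^esub> g) v) = v"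
  using mult_verts[of v "inv\<^bsub>G\<^esub> g" g] mult_verts[of v g "inv\<^bsub>G\<^esub> g"] one_verts[of v]
    G.l_inv[of g] G.r_inv[of g] by auto

lemma inv_closed: "g \<in> H \<Longrightarrow> inv\<^bsub>G\<^esub> g \<in> H"
  using G.inv_closed by simp

text \<open>The common criterion for all graphs considered. The number in \<open>card\<close> is
  that of the arcs above the arc from 0 to 1 of the cycle; regularity turns it into the order of
  \<open>N\<close>. The action \<open>\<beta>\<close> is left abstract because the \<open>p\<close>
  points may be edges, vertices or sets of vertices.\<close>

lemma semidirect_product_over_cycle:
  fixes \<pi> :: "'v \<Rightarrow> nat" and \<beta> :: "'i \<Rightarrow> _ \<Rightarrow> 'x \<Rightarrow> 'x" and Y :: "'i \<Rightarrow> 'x set"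
  defines "N \<equiv> {g \<in> H. \<forall>v \<in> gverts \<Gamma>. \<pi> (fst g v) = \<pi> v}"
  assumes r: "r \<ge> 3" and p: "Factorial_Ring.prime p" "odd p" "\<not> p dvd r"
    and \<pi>: "\<And>v. v \<in> gverts \<Gamma> \<Longrightarrow> \<pi> v < r"
    and edge: "\<And>i. i < r \<Longrightarrow> \<exists>e \<in> gedges \<Gamma>. \<exists>u w. fst e = {u, w} \<and> \<pi> u = i \<and> \<pi> w = (i + 1) mod r"
    and dih: "\<And>g. g \<in> H \<Longrightarrow> \<exists>d \<in> carrier (dihedral_group r). \<forall>v \<in> gverts \<Gamma>. \<pi> (fst g v) = dihedral_act r d (\<pi> v)"
    and card: "card {a \<in> arcs \<Gamma>. \<pi> ` fst (fst a) = {0, 1} \<and> \<pi> (snd a) = 0} = p ^ n"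
    and Y: "\<And>i. i \<in> I \<Longrightarrow> card (Y i) = p"
    and \<beta>: "\<And>i g. i \<in> I \<Longrightarrow> g \<in> N \<Longrightarrow> bij_betw (\<beta> i g) (Y i) (Y i)"
    and \<beta>_mult: "\<And>i g h y. i \<in> I \<Longrightarrow> g \<in> N \<Longrightarrow> h \<in> N \<Longrightarrow> y \<in> Y i \<Longrightarrow> \<beta> i (g \<otimes>\<^bsub>G\<^esub> h) y = \<beta> i g (\<beta> i h y)"
    and faithful: "\<And>g. g \<in> N \<Longrightarrow> (\<And>i y. i \<in> I \<Longrightarrow> y \<in> Y i \<Longrightarrow> \<beta> i g y = y) \<Longrightarrow> g = \<one>\<^bsub>G\<^esub>"
  shows "is_semidirect_product_of G (Zp_power p n) (dihedral_group r)"
proof -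
  let ?D = "dihedral_group r"
  interpret D: group ?D using r by (intro group_dihedral_group) simp
  obtain e0 u0 w0 where e0: "e0 \<in> gedges \<Gamma>" "fst e0 = {u0, w0}" "\<pi> u0 = 0" "\<pi> w0 = 1"
    using edge[of 0] r by auto
  have uw: "u0 \<in> gverts \<Gamma>" "w0 \<in> gverts \<Gamma>" using edge_subset[OF e0(1)] e0(2) by auto
  have a0: "(e0, u0) \<in> arcs \<Gamma>" using e0 by (simp add: arcs_def)
  define P where "P = (\<lambda>(g :: ('v \<Rightarrow> 'v) \<times> ('v set \<times> nat \<Rightarrow> 'v set \<times> nat)) d. d \<in> carrier ?D \<and> (\<forall>v \<in> gverts \<Gamma>. \<pi> (fst g v) = dihedral_act r d (\<pi> v)))"
  have uniq: "d = d'" if "P g d" "d' \<in> carrier ?D" "\<pi> (fst g u0) = dihedral_act r d' 0" "\<pi> (fst g w0) = dihedral_act r d' 1" for g d d'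
    using that uw e0 by (intro dihedral_act_inj[OF r]) (auto simp: P_def)
  \<comment> \<open>The choice is harmless: \<open>u0\<close> and \<open>w0\<close> lie above 0 and
    1, and by \<open>dihedral_act_inj\<close> the images of these two residues determine the
    element.\<close>
  define \<phi> where "\<phi> = (\<lambda>g. SOME d. P g d)"
  have \<phi>: "P g (\<phi> g)" if "g \<in> H" for g
    using dih[OF that] unfolding \<phi>_def by (intro someI_ex[of "P g"]) (auto simp: P_def)
  have \<phi>_eqI: "\<phi> g = d" if "g \<in> H" "d \<in> carrier ?D" "\<pi> (fst g u0) = dihedral_act r d 0" "\<pi> (fst g w0) = dihedral_act r d 1" for g d
    using uniq[OF \<phi>[OF that(1)]] that by blast
  have hom: "\<phi> \<in> hom G ?D"
  proof (rule homI)
    fix g h assume "g \<in> carrier G" "h \<in> carrier G"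
    hence gh: "g \<in> H" "h \<in> H" "g \<otimes>\<^bsub>G\<^esub> h \<in> H" using G.m_closed[of g h] by auto
    have c: "\<phi> g \<in> carrier ?D" "\<phi> h \<in> carrier ?D" using \<phi> gh by (auto simp: P_def)
    show "\<phi> g \<in> carrier ?D" by fact
    have *: "\<pi> (fst (g \<otimes>\<^bsub>G\<^esub> h) v) = dihedral_act r (\<phi> g \<otimes>\<^bsub>?D\<^esub> \<phi> h) (\<pi> v)" if v: "v \<in> gverts \<Gamma>" for v
      unfolding dihedral_act_mult[OF c \<pi>[OF v]] mult_verts[OF v]
      using \<phi>[OF gh(1)] \<phi>[OF gh(2)] v vert_closed[OF gh(2) v] by (simp add: P_def)
    show "\<phi> (g \<otimes>\<^bsub>G\<^esub> h) = \<phi> g \<otimes>\<^bsub>?D\<^esub> \<phi> h"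
      using *[OF uw(1)] *[OF uw(2)] e0 c by (intro \<phi>_eqI[OF gh(3)]) simp_all
  qed
  have ker: "kernel G ?D \<phi> = N"
  proof (intro equalityI subsetI)
    fix g assume "g \<in> kernel G ?D \<phi>"
    hence g: "g \<in> H" "\<phi> g = \<one>\<^bsub>?D\<^esub>" by (auto simp: kernel_def)
    thus "g \<in> N" using \<phi>[OF g(1)] dihedral_act_one \<pi> by (simp add: N_def P_def)
  next
    fix g assume g: "g \<in> N"
    hence "\<phi> g = \<one>\<^bsub>?D\<^esub>" using r uw e0 dihedral_act_one by (intro \<phi>_eqI) (auto simp: N_def)
    thus "g \<in> kernel G ?D \<phi>" using g by (simp add: kernel_def N_def)
  qed
  have move: "\<exists>g \<in> H. \<pi> (fst g u0) = \<pi> u \<and> \<pi> (fst g w0) = \<pi> w \<and> arc_act g (e0, u0) = (e, u)"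
    if "e \<in> gedges \<Gamma>" "fst e = {u, w}" "\<pi> u \<noteq> \<pi> w" for e u w
  proof -
    have "(e, u) \<in> arcs \<Gamma>" using that by (simp add: arcs_def)
    then obtain g where g: "g \<in> H" "arc_act g (e0, u0) = (e, u)"
      using regular[unfolded arc_regular_def, rule_format, OF a0] by blast
    hence "fst g u0 = u" "snd g e0 = e" by (auto simp: arc_act_def)
    moreover from this have "{fst g u0, fst g w0} = {u, w}" using ends[OF g(1) e0(1)] e0(2) that by simp
    ultimately have "fst g w0 = w" using that(3) by (auto simp: doubleton_eq_iff)
    thus ?thesis using g \<open>fst g u0 = u\<close> by blast
  qed
  have onto: "\<phi> ` carrier G = carrier ?D"
  proof (intro equalityI subsetI)
    fix d assume "d \<in> \<phi> ` carrier G" thus "d \<in> carrier ?D" using \<phi> by (auto simp: P_def)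
  next
    fix d assume d: "d \<in> carrier ?D"
    obtain c a where ca: "d = (c, a)" "c < r" "a = 0 \<or> a = 1"
      using d by (auto simp: dihedral_group_def less_2_cases_iff)
    have ne: "(i + 1) mod r \<noteq> i" if "i < r" for i using r that by (auto simp: mod_Suc)
    have "\<exists>g \<in> H. \<pi> (fst g u0) = c \<and> \<pi> (fst g w0) = dihedral_act r d 1"
    proof (cases "a = 0")
      case True
      obtain e u w where e: "e \<in> gedges \<Gamma>" "fst e = {u, w}" "\<pi> u = c" "\<pi> w = (c + 1) mod r"
        using edge[OF ca(2)] by blast
      have "\<pi> u \<noteq> \<pi> w" using e ne[OF ca(2)] by simp
      from move[OF e(1,2) this] show ?thesis using e True ca(1) by (auto simp: dihedral_act_def)
    next
      case False
      \<comment> \<open>The reflection \<open>(c, 1)\<close> sends 0 to \<open>c\<close> and 1 to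
        \<open>c - 1\<close>. So an edge above \<open>c - 1\<close> and \<open>c\<close> is taken
        and traversed backwards.\<close>
      define i where "i = (c + r - 1) mod r"
      have "i < r" using r by (simp add: i_def)
      have ic: "(i + 1) mod r = c" using ca(2) r by (simp add: i_def mod_simps)
      obtain e u w where e: "e \<in> gedges \<Gamma>" "fst e = {u, w}" "\<pi> u = i" "\<pi> w = (i + 1) mod r"
        using edge[OF \<open>i < r\<close>] by blast
      have "\<pi> w \<noteq> \<pi> u" "fst e = {w, u}" using e ne[OF \<open>i < r\<close>] by auto
      from move[OF e(1) this(2,1)] show ?thesis using e False ca(1) ic by (auto simp: dihedral_act_def i_def)
    qed
    then obtain g where g: "g \<in> H" "\<pi> (fst g u0) = c" "\<pi> (fst g w0) = dihedral_act r d 1" by blast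
    hence "\<phi> g = d" using dihedral_act_0[OF d] ca by (intro \<phi>_eqI d) auto
    thus "d \<in> \<phi> ` carrier G" using g by auto
  qed
  \<comment> \<open>The orbit map of the reference arc is injective by regularity. It is onto
    because an element that carries this arc to an arc above the same arc of the cycle fixes the
    residues 0 and 1, hence acts trivially on the cycle.\<close>
  have "bij_betw (\<lambda>g. arc_act g (e0, u0)) N {a \<in> arcs \<Gamma>. \<pi> ` fst (fst a) = {0, 1} \<and> \<pi> (snd a) = 0}" (is "bij_betw _ _ ?A")
  proof (rule bij_betw_imageI)
    have closed: "arc_act g (e0, u0) \<in> arcs \<Gamma>" if "g \<in> H" for g
      using that e0 edge_closed ends by (auto simp: arcs_def arc_act_def)
    show "inj_on (\<lambda>g. arc_act g (e0, u0)) N"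
      using regular a0 closed unfolding arc_regular_def inj_on_def N_def by blast
    show "(\<lambda>g. arc_act g (e0, u0)) ` N = ?A"
    proof (intro equalityI subsetI)
      fix a assume "a \<in> (\<lambda>g. arc_act g (e0, u0)) ` N"
      then obtain g where g: "g \<in> N" "a = arc_act g (e0, u0)" by blast
      hence "g \<in> H" "\<pi> (fst g u0) = 0" "\<pi> (fst g w0) = 1" using uw e0 by (auto simp: N_def)
      thus "a \<in> ?A" using closed[of g] ends[of g e0] e0 by (auto simp: g(2) arc_act_def)
    next
      fix a assume a: "a \<in> ?A"
      obtain e u where eu: "a = (e, u)" by (metis surj_pair)
      obtain g where g: "g \<in> H" "arc_act g (e0, u0) = a"
        using regular[unfolded arc_regular_def, rule_format, OF a0, of a] a by auto
      hence 1: "fst g u0 = u" "snd g e0 = e" by (auto simp: arc_act_def eu)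
      hence "\<pi> ` {fst g u0, fst g w0} = {0, 1}" using ends[OF g(1) e0(1)] e0(2) a eu by auto
      moreover have "\<pi> (fst g u0) = 0" using 1 a eu by simp
      ultimately have "\<pi> (fst g w0) = 1" by (auto simp: doubleton_eq_iff)
      hence "\<phi> g = \<one>\<^bsub>?D\<^esub>" using \<open>\<pi> (fst g u0) = 0\<close> r dihedral_act_one g by (intro \<phi>_eqI) auto
      hence "g \<in> N" using g ker by (auto simp: kernel_def)
      thus "a \<in> (\<lambda>g. arc_act g (e0, u0)) ` N" using g by auto
    qed
  qed
  hence cardN: "card N = p ^ n" using card bij_betw_same_card by fastforce
  have NH: "N \<subseteq> H" by (auto simp: N_def)
  interpret group_hom G ?D \<phi> using hom by unfold_locales
  have Nsub: "subgroup N G" using subgroup_kernel ker by simp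
  define \<alpha> where "\<alpha> = (\<lambda>i g. \<lambda>y \<in> Y i. \<beta> i g y)"
  have Bij: "\<alpha> i g \<in> Bij (Y i)" if "i \<in> I" "g \<in> N" for i g
    using \<beta>[OF that] by (auto simp: \<alpha>_def Bij_def cong: bij_betw_cong)
  have \<alpha>: "\<alpha> i \<in> hom (G\<lparr>carrier := N\<rparr>) (BijGroup (Y i))" if i: "i \<in> I" for i
  proof (rule homI)
    fix g h assume gh: "g \<in> carrier (G\<lparr>carrier := N\<rparr>)" "h \<in> carrier (G\<lparr>carrier := N\<rparr>)"
    thus "\<alpha> i g \<in> carrier (BijGroup (Y i))" using Bij[OF i] by (simp add: BijGroup_def)
    have "\<alpha> i (g \<otimes>\<^bsub>G\<^esub> h) = compose (Y i) (\<alpha> i g) (\<alpha> i h)"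
    proof
      fix y
      have gh: "g \<in> N" "h \<in> N" using gh by simp_all
      show "\<alpha> i (g \<otimes>\<^bsub>G\<^esub> h) y = compose (Y i) (\<alpha> i g) (\<alpha> i h) y"
        using \<beta>_mult[OF i gh, of y] bij_betwE[OF \<beta>[OF i gh(2)]] by (cases "y \<in> Y i") (simp_all add: \<alpha>_def compose_def)
    qed
    thus "\<alpha> i (g \<otimes>\<^bsub>G\<lparr>carrier := N\<rparr>\<^esub> h) = \<alpha> i g \<otimes>\<^bsub>BijGroup (Y i)\<^esub> \<alpha> i h"
      using gh Bij[OF i] by (simp add: BijGroup_def)
  qed
  have "g = h" if g: "g \<in> N" and h: "h \<in> N" and eq: "\<And>i. i \<in> I \<Longrightarrow> \<alpha> i g = \<alpha> i h" for g h
  proof -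
    have c: "g \<in> carrier G" "h \<in> carrier G" using g h NH by auto
    have hi: "inv\<^bsub>G\<^esub> h \<in> N" using Nsub h by (rule subgroup.m_inv_closed)
    have "inv\<^bsub>G\<^esub> h \<otimes>\<^bsub>G\<^esub> g = \<one>\<^bsub>G\<^esub>"
    proof (rule faithful)
      show "inv\<^bsub>G\<^esub> h \<otimes>\<^bsub>G\<^esub> g \<in> N" using Nsub hi g by (rule subgroup.m_closed)
      fix i y assume i: "i \<in> I" and y: "y \<in> Y i"
      have \<beta>gh: "\<beta> i g y = \<beta> i h y" using fun_cong[OF eq[OF i], of y] y by (simp add: \<alpha>_def)
      have "\<beta> i (inv\<^bsub>G\<^esub> h \<otimes>\<^bsub>G\<^esub> g) y = \<beta> i (inv\<^bsub>G\<^esub> h \<otimes>\<^bsub>G\<^esub> h) y"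
        unfolding \<beta>_mult[OF i hi g y] \<beta>_mult[OF i hi h y] \<beta>gh ..
      also have "inv\<^bsub>G\<^esub> h \<otimes>\<^bsub>G\<^esub> h = \<one>\<^bsub>G\<^esub>" using c by (rule_tac G.l_inv)
      finally have e: "\<beta> i (inv\<^bsub>G\<^esub> h \<otimes>\<^bsub>G\<^esub> g) y = \<beta> i \<one>\<^bsub>G\<^esub> y" .
      have 1: "\<one>\<^bsub>G\<^esub> \<in> N" using Nsub by (rule subgroup.one_closed)
      \<comment> \<open>\<open>\<beta>\<close> is only assumed to be multiplicative, so the identity
        acts as an idempotent map; injectivity then makes it the identity map.\<close>
      have "\<beta> i \<one>\<^bsub>G\<^esub> (\<beta> i \<one>\<^bsub>G\<^esub> y) = \<beta> i \<one>\<^bsub>G\<^esub> y"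
        using \<beta>_mult[OF i 1 1 y] by (simp only: G.r_one[OF G.one_closed])
      hence "\<beta> i \<one>\<^bsub>G\<^esub> y = y"
        using \<beta>[OF i 1] y bij_betwE[OF \<beta>[OF i 1]] by (meson bij_betw_def inj_onD)
      thus "\<beta> i (inv\<^bsub>G\<^esub> h \<otimes>\<^bsub>G\<^esub> g) y = y" using e by simp
    qed
    thus "g = h" using c by (metis G.inv_equality G.inv_inv G.inv_closed G.r_inv G.l_cancel G.l_inv)
  qed
  thus ?thesis
    using r p cardN Y \<alpha> ker
    by (intro is_semidirect_product_of_Zp_power_dihedral[OF G.group_axioms hom onto, of p n I Y \<alpha>]) auto
qed

end

section \<open>The multicycle and the cycle\<close>

lemma bij_betw_endo:
  "finite A \<Longrightarrow> inj_on f A \<Longrightarrow> f ` A \<subseteq> A \<Longrightarrow> bij_betw f A A"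
  by (simp add: bij_betw_def endo_inj_surj)

lemma rtranclp_connected:
  assumes "symp R" "\<And>v. v \<in> V \<Longrightarrow> R\<^sup>*\<^sup>* v0 v" "u \<in> V" "w \<in> V"
  shows "R\<^sup>*\<^sup>* u w"
proof -
  have "symp R\<^sup>*\<^sup>*" using assms(1) by (rule symp_rtranclp)
  hence "R\<^sup>*\<^sup>* u v0" using assms(2)[OF assms(3)] by (rule sympD)
  thus ?thesis using assms(2)[OF assms(4)] by (rule rtranclp_trans)
qed

text \<open>Used with \<open>n = r\<close> for the multicycle and with \<open>n = p * r\<close> for
  the long cycle; \<open>r dvd n\<close> makes reduction modulo \<open>r\<close> compatible with the
  wrap-around. Each vertex has a single neighbour on either side, so two neighbours on the same side
  are equal, and injectivity of \<open>f\<close> yields the local condition of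
  \<open>orientation_respecting_map\<close>.\<close>

lemma cycle_map_dihedral:
  fixes n r :: nat
  defines "V \<equiv> {(j, [] :: nat list) | j. j < n}"
  defines "nx \<equiv> \<lambda>v :: nat \<times> nat list. ((fst v + 1) mod n, [] :: nat list)"
  assumes r: "r \<ge> 3" and n: "n > 0" "r dvd n"
    and f: "\<And>v. v \<in> V \<Longrightarrow> f v \<in> V" and inj: "inj_on f V"
    and edge: "\<And>v. v \<in> V \<Longrightarrow> \<exists>w \<in> V. f ` {v, nx v} = {w, nx w}"
  shows "\<exists>d \<in> carrier (dihedral_group r). \<forall>v \<in> V. fst (f v) mod r = dihedral_act r d (fst v mod r)"
proof -
  define R where "R = (\<lambda>u w. u \<in> V \<and> w = nx u)"
  have nxV: "nx v \<in> V" for v using n by (simp add: V_def nx_def)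
  have nx_inj: "u = u'" if u: "u \<in> V" "u' \<in> V" "nx u = nx u'" for u u'
  proof -
    obtain i j where ij: "u = (i, [])" "u' = (j, [])" "i < n" "j < n" using u by (auto simp: V_def)
    have "[i + 1 = j + 1] (mod n)" using u ij by (simp add: nx_def cong_def)
    hence "[i = j] (mod n)" by (rule cong_add_rcancel_nat[THEN iffD1])
    thus ?thesis using ij by (simp add: cong_def)
  qed
  have uniq: "w = w'" if "R v w \<or> R w v" "R v w' \<or> R w' v" "R v w \<longleftrightarrow> R v w'" for v w w'
    using that nx_inj unfolding R_def by blast
  have n3: "n \<ge> 3" using r n by (meson dvd_imp_le le_trans)
  have asym: "\<not> R w u" if "R u w" for u w
  proof
    assume "R w u"
    hence "u = nx (nx u)" "u \<in> V" using that by (auto simp: R_def)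
    then obtain i where i: "i < n" "i = (i + 2) mod n" by (auto simp: V_def nx_def mod_simps)
    hence "[i + 0 = i + 2] (mod n)" by (simp add: cong_def)
    hence "[0 = 2] (mod n)" by (rule cong_add_lcancel_nat[THEN iffD1])
    thus False using n3 by (simp add: cong_def)
  qed
  have adj_f: "R (f u) (f w) \<or> R (f w) (f u)" if "R u w \<or> R w u" for u w
  proof -
    have "\<exists>x \<in> V. {f u, f w} = {x, nx x}"
      using that edge[of u] edge[of w] by (auto simp: R_def insert_commute)
    thus ?thesis by (auto simp: R_def doubleton_eq_iff)
  qed
  show ?thesis
  proof (rule orientation_respecting_map[where R = R and \<pi> = "\<lambda>v. fst v mod r"])
    show "r \<ge> 3" by fact
    show "u \<in> V \<and> w \<in> V \<and> fst w mod r = (fst u mod r + 1) mod r" if "R u w" for u w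
      using that nxV n by (auto simp: R_def nx_def mod_mod_cancel mod_simps)
    show "fst v mod r < r" for v :: "nat \<times> nat list" using r by simp
    show "f v \<in> V" if "v \<in> V" for v using f that .
    show "(\<lambda>u w. R u w \<or> R w u)\<^sup>*\<^sup>* u w" if "u \<in> V" "w \<in> V" for u w
    proof (rule rtranclp_connected[OF _ _ that])
      show "symp (\<lambda>u w. R u w \<or> R w u)" by (auto simp: symp_def)
      have "j < n \<Longrightarrow> (\<lambda>u w. R u w \<or> R w u)\<^sup>*\<^sup>* (0, []) (j, [])" for j
      proof (induction j)
        case 0 thus ?case by simp
      next
        case (Suc j)
        have "R (j, []) (Suc j, [])" using Suc.prems by (simp add: R_def V_def nx_def)
        thus ?case using Suc by (simp add: rtranclp.rtrancl_into_rtrancl)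
      qed
      thus "(\<lambda>u w. R u w \<or> R w u)\<^sup>*\<^sup>* (0, []) v" if "v \<in> V" for v using that by (auto simp: V_def)
    qed
    show "R (f u) (f w) \<or> R (f w) (f u)" if "R u w \<or> R w u" for u w using adj_f that .
    show "(R v w \<longleftrightarrow> R v w') \<longleftrightarrow> (R (f v) (f w) \<longleftrightarrow> R (f v) (f w'))"
      if a: "R v w \<or> R w v" "R v w' \<or> R w' v" for v w w'
    proof -
      have V: "w \<in> V" "w' \<in> V" using a nxV unfolding R_def by metis+
      have "(R v w \<longleftrightarrow> R v w') \<longleftrightarrow> w = w'" using uniq[OF a] by auto
      also have "\<dots> \<longleftrightarrow> f w = f w'" using inj V by (auto simp: inj_on_def)
      also have "\<dots> \<longleftrightarrow> (R (f v) (f w) \<longleftrightarrow> R (f v) (f w'))" using uniq[OF adj_f[OF a(1)] adj_f[OF a(2)]] by auto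
      finally show ?thesis .
    qed
  qed
qed

lemma (in arc_regular_group) simple_edge_image:
  assumes "\<And>e. e \<in> gedges \<Gamma> \<Longrightarrow> snd e = 0" "g \<in> H" "e \<in> gedges \<Gamma>"
  shows "snd g e = (fst g ` fst e, 0)"
  using assms ends edge_closed by (metis prod.collapse)

lemma (in arc_regular_group) simple_eq_one:
  assumes simple: "\<And>e. e \<in> gedges \<Gamma> \<Longrightarrow> snd e = 0" and "g \<in> H" and "\<And>v. v \<in> gverts \<Gamma> \<Longrightarrow> fst g v = v"
  shows "g = \<one>\<^bsub>G\<^esub>"
proof (rule H_eqI)
  show "g \<in> H" "\<one>\<^bsub>G\<^esub> \<in> H" using assms G.one_closed by auto
  show "fst g v = fst \<one>\<^bsub>G\<^esub> v" if "v \<in> gverts \<Gamma>" for v using assms(3)[OF that] one_verts[OF that] by simp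
  fix e assume e: "e \<in> gedges \<Gamma>"
  have "fst g ` fst e = fst e" using edge_subset[OF e] assms(3) by force
  hence "snd g e = e" using simple_edge_image[OF simple \<open>g \<in> H\<close> e] simple[OF e] by (metis prod.collapse)
  thus "snd g e = snd \<one>\<^bsub>G\<^esub> e" using one_edges[OF e] by simp
qed

text \<open>An element that acts trivially on the cycle fixes every vertex and can only permute
  parallel edges, so the \<open>p\<close> points are the edges of one bundle.\<close>

lemma multicycle_semidirect_product:
  assumes r: "r \<ge> 3" and p: "Factorial_Ring.prime p" "odd p" "\<not> p dvd r"
    and H: "subgroup H (aut_group (multicycle p r))" "arc_regular (multicycle p r) H"
  shows "is_semidirect_product_of ((aut_group (multicycle p r))\<lparr>carrier := H\<rparr>) (Zp_power p 1) (dihedral_group r)"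
proof -
  define \<Gamma> where "\<Gamma> = multicycle p r"
  define S where "S = (\<lambda>i. {(i, [] :: nat list), ((i + 1) mod r, [])})"
  have V: "gverts \<Gamma> = {(i, []) | i. i < r}" by (simp add: \<Gamma>_def multicycle_def gverts_def)
  have E: "gedges \<Gamma> = {(S i, k) | i k. i < r \<and> k < p}" by (simp add: \<Gamma>_def multicycle_def gedges_def S_def)
  interpret arc_regular_group \<Gamma> H
    by (rule arc_regular_group.intro) (use H r in \<open>auto simp: E V S_def \<Gamma>_def[symmetric]\<close>)
  have p0: "p > 0" using p prime_gt_0_nat by blast
  define Y where "Y = (\<lambda>i. (\<lambda>k. (S i, k)) ` {..<p})"
  have "is_semidirect_product_of G (Zp_power p 1) (dihedral_group r)"
  proof (rule semidirect_product_over_cycle[where \<pi> = fst and I = "{..<r}" and Y = Y and \<beta> = "\<lambda>_. snd"])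
    show "fst v < r" if "v \<in> gverts \<Gamma>" for v using that by (auto simp: V)
    show "\<exists>e\<in>gedges \<Gamma>. \<exists>u w. fst e = {u, w} \<and> fst u = i \<and> fst w = (i + 1) mod r" if "i < r" for i
      using that p0 unfolding E by (intro bexI[of _ "(S i, 0)"] exI[of _ "(i, [])"] exI[of _ "((i + 1) mod r, [])"]) (auto simp: S_def)
    show "\<exists>d\<in>carrier (dihedral_group r). \<forall>v\<in>gverts \<Gamma>. fst (fst g v) = dihedral_act r d (fst v)" if g: "g \<in> H" for g
    proof -
      have "\<exists>d\<in>carrier (dihedral_group r). \<forall>v\<in>gverts \<Gamma>. fst (fst g v) mod r = dihedral_act r d (fst v mod r)"
        unfolding V
      proof (rule cycle_map_dihedral[OF r])
        show "0 < r" "r dvd r" using r by auto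
        show "fst g v \<in> {(j, []) |j. j < r}" if "v \<in> {(j, []) |j. j < r}" for v
          using vert_closed[OF g] that by (simp add: V)
        show "inj_on (fst g) {(j, []) |j. j < r}" using bij_verts[OF g] by (simp add: V bij_betw_def)
        fix v :: "nat \<times> nat list" assume "v \<in> {(j, []) |j. j < r}"
        then obtain j where j: "v = (j, [])" "j < r" by auto
        have e: "(S j, 0) \<in> gedges \<Gamma>" using j p0 by (auto simp: E)
        have "fst (snd g (S j, 0)) = fst g ` S j" using ends[OF g e] by simp
        moreover obtain i k where "snd g (S j, 0) = (S i, k)" "i < r" using edge_closed[OF g e] by (auto simp: E)
        ultimately have "fst g ` {v, ((fst v + 1) mod r, [])} = {(i, []), ((fst (i, [] :: nat list) + 1) mod r, [])}"
          by (simp add: S_def j)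
        thus "\<exists>w\<in>{(j, []) |j. j < r}. fst g ` {v, ((fst v + 1) mod r, [])} = {w, ((fst w + 1) mod r, [])}"
          using \<open>i < r\<close> by blast
      qed
      thus ?thesis using vert_closed[OF g] by (auto simp: V) (metis fst_conv mod_less)
    qed
    have "{a \<in> arcs \<Gamma>. fst ` fst (fst a) = {0, 1} \<and> fst (snd a) = 0} = (\<lambda>k. ((S 0, k), (0, []))) ` {..<p}" (is "?A = ?B")
    proof (intro equalityI subsetI)
      fix a assume "a \<in> ?A"
      then obtain i k u where a: "a = ((S i, k), u)" "u \<in> S i" "i < r" "k < p" "fst ` S i = {0, 1}" "fst u = 0"
        by (auto simp: arcs_def E)
      \<comment> \<open>The pair 0, 1 might also be traversed from 1 to 0, but then 2 would be 0
        modulo \<open>r\<close>.\<close>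
      have "i = 0"
      proof (rule ccontr)
        assume "i \<noteq> 0"
        hence "i = 1" "(i + 1) mod r = 0" using a(5) by (auto simp: S_def doubleton_eq_iff)
        thus False using r by simp
      qed
      moreover from this have "u = (0, [])" using a(2,6) r by (auto simp: S_def)
      ultimately show "a \<in> ?B" using a(1,4) by auto
    next
      fix a assume "a \<in> ?B"
      thus "a \<in> ?A"
      proof -
        have "fst ` S 0 = {0, 1}" "(0, []) \<in> S 0" "0 < r" using r by (auto simp: S_def)
        moreover obtain k where k: "k < p" "a = ((S 0, k), (0, []))" using \<open>a \<in> ?B\<close> by auto
        moreover have "(S 0, k) \<in> gedges \<Gamma>" unfolding E using k(1) \<open>0 < r\<close> by blast
        ultimately show ?thesis by (simp add: arcs_def)
      qed
    qed
    thus "card {a \<in> arcs \<Gamma>. fst ` fst (fst a) = {0, 1} \<and> fst (snd a) = 0} = p ^ 1"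
      by (simp add: card_image inj_on_def)
    show "card (Y i) = p" for i by (simp add: Y_def card_image inj_on_def)
    have fixv: "fst g v = v" if "g \<in> H" "\<forall>v\<in>gverts \<Gamma>. fst (fst g v) = fst v" "v \<in> gverts \<Gamma>" for g v
      using that vert_closed[of g v] by (fastforce simp: V)
    show "bij_betw (snd g) (Y i) (Y i)" if i: "i \<in> {..<r}" and g: "g \<in> {g \<in> H. \<forall>v\<in>gverts \<Gamma>. fst (fst g v) = fst v}" for i g
    proof (rule bij_betw_endo)
      show "finite (Y i)" by (simp add: Y_def)
      have YE: "Y i \<subseteq> gedges \<Gamma>" using i by (auto simp: Y_def E)
      have gH: "g \<in> H" using g by simp
      show "inj_on (snd g) (Y i)" using bij_edges[OF gH] YE by (meson bij_betw_def inj_on_subset)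
      show "snd g ` Y i \<subseteq> Y i"
      proof
        fix e' assume "e' \<in> snd g ` Y i"
        then obtain e where e: "e \<in> Y i" "e' = snd g e" by blast
        hence eE: "e \<in> gedges \<Gamma>" and "fst e = S i" using YE by (auto simp: Y_def)
        have "fst g v = v" if "v \<in> fst e" for v
          using edge_subset[OF eE] that fixv[OF gH] g by blast
        hence "fst g ` fst e = fst e" by simp
        hence "fst e' = S i" using ends[OF gH eE] e \<open>fst e = S i\<close> by simp
        moreover have "e' \<in> gedges \<Gamma>" using edge_closed[OF gH eE] e by simp
        ultimately show "e' \<in> Y i" by (auto simp: E Y_def)
      qed
    qed
    show "snd (g \<otimes>\<^bsub>G\<^esub> h) e = snd g (snd h e)" if "i \<in> {..<r}" "e \<in> Y i" for i g h e
      using that by (intro mult_edges) (auto simp: Y_def E)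
    show "g = \<one>\<^bsub>G\<^esub>" if g: "g \<in> {g \<in> H. \<forall>v\<in>gverts \<Gamma>. fst (fst g v) = fst v}"
      and fixed: "\<And>i e. i \<in> {..<r} \<Longrightarrow> e \<in> Y i \<Longrightarrow> snd g e = e" for g
    proof (rule H_eqI)
      show "g \<in> H" "\<one>\<^bsub>G\<^esub> \<in> H" using g G.one_closed by auto
      show "fst g v = fst \<one>\<^bsub>G\<^esub> v" if "v \<in> gverts \<Gamma>" for v using fixv g that one_verts by simp
      show "snd g e = snd \<one>\<^bsub>G\<^esub> e" if e: "e \<in> gedges \<Gamma>" for e
      proof -
        obtain i where "i < r" "e \<in> Y i" using e by (auto simp: E Y_def)
        thus ?thesis using fixed one_edges e by simp
      qed
    qed
  qed (use r p in auto)
  thus ?thesis by (simp add: \<Gamma>_def)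
qed

text \<open>Reduction modulo \<open>r\<close> wraps the long cycle \<open>p\<close> times around the
  short one, and the \<open>p\<close> points are the vertices of one residue class. An arc above the
  arc from 0 to 1 is determined by its initial vertex, which gives \<open>p\<close> such
  arcs.\<close>

lemma cycle_graph_semidirect_product:
  assumes r: "r \<ge> 3" and p: "Factorial_Ring.prime p" "odd p" "\<not> p dvd r"
    and H: "subgroup H (aut_group (cycle_graph (p * r)))" "arc_regular (cycle_graph (p * r)) H"
  shows "is_semidirect_product_of ((aut_group (cycle_graph (p * r)))\<lparr>carrier := H\<rparr>) (Zp_power p 1) (dihedral_group r)"
proof -
  define n where "n = p * r"
  define \<Gamma> where "\<Gamma> = cycle_graph n"
  define S where "S = (\<lambda>i. {(i, [] :: nat list), ((i + 1) mod n, [])})"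
  have V: "gverts \<Gamma> = {(i, []) | i. i < n}" by (simp add: \<Gamma>_def cycle_graph_def gverts_def)
  have E: "gedges \<Gamma> = {(S i, 0) | i. i < n}" by (simp add: \<Gamma>_def cycle_graph_def gedges_def S_def)
  have p0: "p > 0" using p prime_gt_0_nat by blast
  have n0: "n > 0" "r dvd n" using p0 r by (auto simp: n_def)
  interpret arc_regular_group \<Gamma> H
    by (rule arc_regular_group.intro) (use H n0 in \<open>auto simp: E V S_def \<Gamma>_def[symmetric] n_def[symmetric]\<close>)
  have simple: "snd e = 0" if "e \<in> gedges \<Gamma>" for e using that by (auto simp: E)
  define Y where "Y = (\<lambda>i. {v \<in> gverts \<Gamma>. fst v mod r = i})"
  have Y: "Y i = (\<lambda>k. (i + r * k, [])) ` {..<p}" if "i < r" for i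
  proof (intro equalityI subsetI)
    fix v assume "v \<in> Y i"
    then obtain j where j: "v = (j, [])" "j < p * r" "j mod r = i" by (auto simp: Y_def V n_def)
    hence "j = i + r * (j div r)" "j div r < p" using r by (auto simp: less_mult_imp_div_less)
    thus "v \<in> (\<lambda>k. (i + r * k, [])) ` {..<p}" using j by blast
  next
    fix v :: "nat \<times> nat list" assume "v \<in> (\<lambda>k. (i + r * k, [])) ` {..<p}"
    then obtain k where k: "k < p" "v = (i + r * k, [])" by auto
    have "i + r * k < r * Suc k" using that by simp
    also have "\<dots> \<le> r * p" using k by (intro mult_le_mono) auto
    finally show "v \<in> Y i" using k that by (simp add: Y_def V n_def mult.commute)
  qed
  have cardY: "card (Y i) = p" if "i < r" for i
    unfolding Y[OF that] using r by (subst card_image) (auto simp: inj_on_def)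
  have "is_semidirect_product_of G (Zp_power p 1) (dihedral_group r)"
  proof (rule semidirect_product_over_cycle[where \<pi> = "\<lambda>v. fst v mod r" and I = "{..<r}" and Y = Y and \<beta> = "\<lambda>_. fst"])
    show "fst v mod r < r" for v :: "nat \<times> nat list" using r by auto
    show "\<exists>e\<in>gedges \<Gamma>. \<exists>u w. fst e = {u, w} \<and> fst u mod r = i \<and> fst w mod r = (i + 1) mod r" if "i < r" for i
    proof -
      have "i < n" using that n0 by (metis dvd_imp_le less_le_trans)
      thus ?thesis using that n0 unfolding E
        by (intro bexI[of _ "(S i, 0)"] exI[of _ "(i, [])"] exI[of _ "((i + 1) mod n, [])"]) (auto simp: S_def mod_mod_cancel)
    qed
    show "\<exists>d\<in>carrier (dihedral_group r). \<forall>v\<in>gverts \<Gamma>. fst (fst g v) mod r = dihedral_act r d (fst v mod r)" if g: "g \<in> H" for g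
      unfolding V
    proof (rule cycle_map_dihedral[OF r n0])
      show "fst g v \<in> {(j, []) |j. j < n}" if "v \<in> {(j, []) |j. j < n}" for v
        using vert_closed[OF g] that by (simp add: V)
      show "inj_on (fst g) {(j, []) |j. j < n}" using bij_verts[OF g] by (simp add: V bij_betw_def)
      fix v :: "nat \<times> nat list" assume "v \<in> {(j, []) |j. j < n}"
      then obtain j where j: "v = (j, [])" "j < n" by auto
      have e: "(S j, 0) \<in> gedges \<Gamma>" using j by (auto simp: E)
      have "fst (snd g (S j, 0)) = fst g ` S j" using ends[OF g e] by simp
      moreover obtain i k where "snd g (S j, 0) = (S i, k)" "i < n" using edge_closed[OF g e] by (auto simp: E)
      ultimately have "fst g ` {v, ((fst v + 1) mod n, [])} = {(i, []), ((fst (i, [] :: nat list) + 1) mod n, [])}"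
        by (simp add: S_def j)
      thus "\<exists>w\<in>{(j, []) |j. j < n}. fst g ` {v, ((fst v + 1) mod n, [])} = {w, ((fst w + 1) mod n, [])}"
        using \<open>i < n\<close> by blast
    qed
    have "{a \<in> arcs \<Gamma>. (\<lambda>v. fst v mod r) ` fst (fst a) = {0, 1} \<and> fst (snd a) mod r = 0} = (\<lambda>v. ((S (fst v), 0), v)) ` Y 0" (is "?A = ?B")
    proof (intro equalityI subsetI)
      fix a assume "a \<in> ?A"
      then obtain i u where a: "a = ((S i, 0), u)" "u \<in> S i" "i < n" "(\<lambda>v. fst v mod r) ` S i = {0, 1}" "fst u mod r = 0"
        by (auto simp: arcs_def E)
      have m: "(i + 1) mod n mod r = (i mod r + 1) mod r" using n0 by (simp add: mod_mod_cancel mod_simps)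
      have "i mod r = 0"
      proof (rule ccontr)
        assume "i mod r \<noteq> 0"
        hence "i mod r = 1" "(i + 1) mod n mod r = 0" using a(4) by (auto simp: S_def doubleton_eq_iff)
        thus False using r m by simp
      qed
      hence "u = (i, [])" using a(2,5) m r by (auto simp: S_def)
      thus "a \<in> ?B"
        using a(1,3) \<open>i mod r = 0\<close> by (intro image_eqI[of _ _ "(i, [])"]) (auto simp: Y_def V)
    next
      fix a assume "a \<in> ?B"
      then obtain i where i: "i < n" "i mod r = 0" "a = ((S i, 0), (i, []))" by (auto simp: Y_def V)
      have "(i + 1) mod n mod r = (i mod r + 1) mod r" using n0 by (simp add: mod_mod_cancel mod_simps)
      hence "(i + 1) mod n mod r = 1" using i r by simp
      thus "a \<in> ?A"
        using i by (auto simp: arcs_def E S_def)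
    qed
    thus "card {a \<in> arcs \<Gamma>. (\<lambda>v. fst v mod r) ` fst (fst a) = {0, 1} \<and> fst (snd a) mod r = 0} = p ^ 1"
      using cardY[of 0] r by (simp add: card_image inj_on_def)
    show "card (Y i) = p" if "i \<in> {..<r}" for i using that cardY by simp
    show "bij_betw (fst g) (Y i) (Y i)" if i: "i \<in> {..<r}"
      and g: "g \<in> {g \<in> H. \<forall>v\<in>gverts \<Gamma>. fst (fst g v) mod r = fst v mod r}" for i g
    proof (rule bij_betw_endo)
      show "finite (Y i)" using i Y by simp
      show "inj_on (fst g) (Y i)" using bij_verts[of g] g by (auto simp: Y_def bij_betw_def intro: inj_on_subset)
      show "fst g ` Y i \<subseteq> Y i" using g vert_closed[of g] by (auto simp: Y_def)
    qed
    show "fst (g \<otimes>\<^bsub>G\<^esub> h) v = fst g (fst h v)" if "v \<in> Y i" for i g h v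
      using that by (intro mult_verts) (auto simp: Y_def)
    show "g = \<one>\<^bsub>G\<^esub>" if g: "g \<in> {g \<in> H. \<forall>v\<in>gverts \<Gamma>. fst (fst g v) mod r = fst v mod r}"
      and fixed: "\<And>i v. i \<in> {..<r} \<Longrightarrow> v \<in> Y i \<Longrightarrow> fst g v = v" for g
    proof (rule simple_eq_one[OF simple])
      show "g \<in> H" using g by simp
      show "fst g v = v" if "v \<in> gverts \<Gamma>" for v using fixed[of "fst v mod r" v] that r by (simp add: Y_def)
    qed
  qed (use r p in auto)
  thus ?thesis by (simp add: \<Gamma>_def n_def)
qed

section \<open>Praeger--Xu graphs\<close>

text \<open>A vertex is a window of length \<open>s\<close> with a position modulo \<open>r\<close>.
  A step moves the window by one entry, so consecutive windows overlap in \<open>s - 1\<close>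
  entries; for \<open>s = 1\<close> the condition on the lists is void. The direction is not part of
  the graph, and automorphisms have to be shown to respect it up to a global reversal.\<close>

definition PX_step :: "nat \<Rightarrow> nat \<Rightarrow> nat \<Rightarrow> nat \<times> nat list \<Rightarrow> nat \<times> nat list \<Rightarrow> bool" where
  "PX_step p r s u w \<longleftrightarrow> u \<in> PX_verts p r s \<and> w \<in> PX_verts p r s \<and>
     fst w = (fst u + 1) mod r \<and> tl (snd u) = butlast (snd w)"

lemma PX_step_take_drop:
  assumes "i < r" "length zs = s + 1" "set zs \<subseteq> {..<p}" "s \<ge> 1"
  shows "PX_step p r s (i, take s zs) ((i + 1) mod r, drop 1 zs)"
proof -
  have "tl (take s zs) = butlast (drop 1 zs)"
    using assms by (simp add: butlast_conv_take tl_take drop_Suc)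
  moreover have "set (take s zs) \<subseteq> {..<p}" "set (drop 1 zs) \<subseteq> {..<p}"
    using assms(3) set_take_subset[of s zs] set_drop_subset[of 1 zs] by auto
  ultimately show ?thesis using assms by (simp add: PX_step_def PX_verts_def)
qed

lemma PX_stepE:
  assumes "PX_step p r s u w" "s \<ge> 1"
  obtains i zs where "i < r" "length zs = s + 1" "set zs \<subseteq> {..<p}" "u = (i, take s zs)" "w = ((i + 1) mod r, drop 1 zs)"
proof -
  obtain i x xs j ys where u: "u = (i, x # xs)" and w: "w = (j, ys)"
    using assms by (cases u, cases w, cases "snd u") (auto simp: PX_step_def PX_verts_def)
  have *: "i < r" "j = (i + 1) mod r" "xs = butlast ys" "length ys = s" "set ys \<subseteq> {..<p}" "x < p"
    using assms by (auto simp: PX_step_def PX_verts_def u w)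
  have "take s (x # ys) = x # xs" using * assms(2) by (cases s) (auto simp: butlast_conv_take)
  thus ?thesis using * that[of i "x # ys"] by (simp add: u w)
qed

lemma gverts_PX: "gverts (PX_graph p r s) = PX_verts p r s"
  by (simp add: PX_graph_def gverts_def)

lemma gedges_PX:
  assumes "s \<ge> 1"
  shows "gedges (PX_graph p r s) = {({u, w}, 0) | u w. PX_step p r s u w}"
proof (intro equalityI subsetI)
  fix e assume "e \<in> gedges (PX_graph p r s)"
  then obtain i zs where "e = ({(i, take s zs), ((i + 1) mod r, drop 1 zs)}, 0)" "i < r" "length zs = s + 1" "set zs \<subseteq> {..<p}"
    unfolding PX_graph_def gedges_def by auto
  thus "e \<in> {({u, w}, 0) | u w. PX_step p r s u w}" using PX_step_take_drop assms by blast
next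
  fix e assume "e \<in> {({u, w}, 0 :: nat) | u w. PX_step p r s u w}"
  then obtain u w where e: "e = ({u, w}, 0)" "PX_step p r s u w" by blast
  obtain i zs where "i < r" "length zs = s + 1" "set zs \<subseteq> {..<p}" "u = (i, take s zs)" "w = ((i + 1) mod r, drop 1 zs)"
    using PX_stepE[OF e(2) assms] .
  thus "e \<in> gedges (PX_graph p r s)" unfolding e(1) PX_graph_def gedges_def snd_conv mem_Collect_eq
    by (intro exI[of _ i] exI[of _ zs]) simp
qed

lemma PX_step_asym:
  assumes "PX_step p r s u w" "r \<ge> 3"
  shows "fst u \<noteq> (fst w + 1) mod r"
proof
  assume "fst u = (fst w + 1) mod r"
  moreover have "fst w = (fst u + 1) mod r" "fst u < r" using assms by (auto simp: PX_step_def PX_verts_def)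
  ultimately have "fst u = ((fst u + 1) mod r + 1) mod r" by metis
  hence "fst u = (fst u + 2) mod r" by (simp add: mod_simps)
  hence "[fst u + 0 = fst u + 2] (mod r)" using \<open>fst u < r\<close> by (simp add: cong_def)
  hence "[0 = 2] (mod r)" by (rule cong_add_lcancel_nat[THEN iffD1])
  thus False using assms(2) by (simp add: cong_def)
qed

text \<open>The windows of a word of length \<open>s + n\<close> at successive positions form the
  walk. Walks are thus produced by writing down words.\<close>

lemma PX_walk:
  assumes "i < r" "length zs = s + n" "set zs \<subseteq> {..<p}" "s \<ge> 1"
  shows "(PX_step p r s ^^ n) (i, take s zs) ((i + n) mod r, drop n zs)"
  using assms(2,3)
proof (induction n arbitrary: zs)
  case 0 thus ?case using assms(1) by simp
next
  case (Suc n)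
  have sub: "set (take (s + n) zs) \<subseteq> {..<p}" "set (drop n zs) \<subseteq> {..<p}"
    using Suc.prems set_take_subset[of "s + n" zs] set_drop_subset[of n zs] by auto
  have "(PX_step p r s ^^ n) (i, take s (take (s + n) zs)) ((i + n) mod r, drop n (take (s + n) zs))"
    using Suc.prems sub by (intro Suc.IH) simp_all
  hence 1: "(PX_step p r s ^^ n) (i, take s zs) ((i + n) mod r, take s (drop n zs))"
    by (simp add: min_def drop_take)
  have "PX_step p r s ((i + n) mod r, take s (drop n zs)) (((i + n) mod r + 1) mod r, drop 1 (drop n zs))"
    using Suc.prems sub assms by (intro PX_step_take_drop) auto
  hence 2: "PX_step p r s ((i + n) mod r, take s (drop n zs)) ((i + Suc n) mod r, drop (Suc n) zs)"
    by (simp add: mod_simps)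
  show ?case unfolding relpowp.simps using 1 2 by (rule relcomppI)
qed

text \<open>Each step drops one entry at the front, so after \<open>n\<close> steps the last
  \<open>s - n\<close> entries of the start open the final window. For \<open>n < s\<close>, entry
  \<open>n\<close> of a vertex is therefore the first entry of every vertex \<open>n\<close> steps
  ahead, a description that survives orientation-preserving automorphisms.\<close>

lemma PX_walk_overlap:
  assumes "(PX_step p r s ^^ n) u w" "n \<le> s" "u \<in> PX_verts p r s"
  shows "drop n (snd u) = take (s - n) (snd w) \<and> w \<in> PX_verts p r s"
  using assms(1,2)
proof (induction n arbitrary: w)
  case 0 thus ?case using assms(3) by (auto simp: PX_verts_def)
next
  case (Suc n)
  then obtain x where x: "(PX_step p r s ^^ n) u x" "PX_step p r s x w" by auto
  have "drop n (snd u) = take (s - n) (snd x)" using Suc x by simp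
  hence "tl (drop n (snd u)) = take (s - n - 1) (tl (snd x))" by (simp add: tl_take)
  moreover have "tl (drop n (snd u)) = drop (Suc n) (snd u)" by (metis drop_Suc tl_drop)
  moreover have "tl (snd x) = take (s - 1) (snd w)" "w \<in> PX_verts p r s"
    using x(2) by (auto simp: PX_step_def PX_verts_def butlast_conv_take)
  ultimately show ?case using Suc.prems by (simp add: min_def)
qed

lemma PX_connected:
  assumes "r \<ge> 1" "p \<ge> 1" "s \<ge> 1" "u \<in> PX_verts p r s" "w \<in> PX_verts p r s"
  shows "(\<lambda>u w. PX_step p r s u w \<or> PX_step p r s w u)\<^sup>*\<^sup>* u w"
proof (rule rtranclp_connected[OF _ _ assms(4,5)])
  let ?A = "\<lambda>u w. PX_step p r s u w \<or> PX_step p r s w u"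
  show "symp ?A" by (auto simp: symp_def)
  show "?A\<^sup>*\<^sup>* (0, replicate s 0) v" if v: "v \<in> PX_verts p r s" for v
  proof -
    obtain j ys where jys: "v = (j, ys)" "j < r" "length ys = s" "set ys \<subseteq> {..<p}"
      using v by (auto simp: PX_verts_def)
    \<comment> \<open>At least \<open>s\<close> steps are needed to replace the whole initial
      window, and their number must be \<open>j\<close> modulo \<open>r\<close>.\<close>
    define n where "n = r * s + j"
    have "s \<le> n" using assms(1) by (simp add: n_def trans_le_add1)
    define zs where "zs = replicate n 0 @ ys"
    have "(PX_step p r s ^^ n) (0, take s zs) ((0 + n) mod r, drop n zs)"
      using assms jys by (intro PX_walk) (auto simp: zs_def)
    moreover have "take s zs = replicate s 0" using \<open>s \<le> n\<close> by (simp add: zs_def min_def)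
    moreover have "drop n zs = ys" by (simp add: zs_def)
    moreover have "n mod r = j" using jys by (simp add: n_def)
    ultimately have "(PX_step p r s)\<^sup>*\<^sup>* (0, replicate s 0) v"
      by (simp add: relpowp_imp_rtranclp jys)
    thus ?thesis by (rule rtranclp_mono[THEN predicate2D, rotated]) auto
  qed
qed

text \<open>An edge is a starting index with a word of length \<open>s + 1\<close>. Since
  \<open>r \<ge> 3\<close>, the index set 0, 1 forces the starting index 0, and the arc leaves from
  the vertex there, so only the word is free.\<close>

lemma card_PX_arcs_over:
  assumes "r \<ge> 3" "s \<ge> 1"
  shows "card {a \<in> arcs (PX_graph p r s). fst ` fst (fst a) = {0, 1} \<and> fst (snd a) = 0} = p ^ (s + 1)" (is "card ?A = _")
proof -
  define f where "f = (\<lambda>zs :: nat list. (({(0 :: nat, take s zs), (1, drop 1 zs)}, 0 :: nat), (0 :: nat, take s zs)))"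
  let ?Z = "{zs. set zs \<subseteq> {..<p} \<and> length zs = s + 1}"
  have inj: "inj_on f ?Z"
  proof (rule inj_onI)
    fix zs zs' assume z: "zs \<in> ?Z" "zs' \<in> ?Z" "f zs = f zs'"
    hence "take s zs = take s zs'" "drop 1 zs = drop 1 zs'" by (auto simp: f_def doubleton_eq_iff)
    moreover have "take 1 zs = take 1 (take s zs)" "take 1 zs' = take 1 (take s zs')"
      using assms(2) by (simp_all add: min_def)
    ultimately show "zs = zs'" by (metis append_take_drop_id)
  qed
  have "f ` ?Z = ?A"
  proof (intro equalityI subsetI)
    fix a assume "a \<in> f ` ?Z"
    then obtain zs where zs: "a = f zs" "set zs \<subseteq> {..<p}" "length zs = s + 1" by blast
    have "PX_step p r s (0, take s zs) ((0 + 1) mod r, drop 1 zs)"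
      using zs assms by (intro PX_step_take_drop) auto
    moreover have "(0 + 1) mod r = 1" using assms by simp
    ultimately have "({(0, take s zs), (1, drop 1 zs)}, 0) \<in> gedges (PX_graph p r s)"
      unfolding gedges_PX[OF assms(2)] by auto
    thus "a \<in> ?A" by (simp add: zs(1) f_def arcs_def)
  next
    fix a assume a: "a \<in> ?A"
    then obtain u w x where e: "a = (({u, w}, 0), x)" "PX_step p r s u w" "x \<in> {u, w}" 
        "{fst u, fst w} = {0, 1}" "fst x = 0"
      unfolding arcs_def gedges_PX[OF assms(2)] by auto
    obtain i zs where zs: "i < r" "length zs = s + 1" "set zs \<subseteq> {..<p}" "u = (i, take s zs)" "w = ((i + 1) mod r, drop 1 zs)"
      using PX_stepE[OF e(2) assms(2)] .
    have "i = 0"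
    proof (rule ccontr)
      assume "i \<noteq> 0"
      hence "i = 1" "(i + 1) mod r = 0" using e(4) zs by (auto simp: doubleton_eq_iff)
      thus False using assms by simp
    qed
    moreover have "(0 + 1) mod r = 1" using assms by simp
    ultimately have "a = f zs" using e(1,3,5) zs(4,5) by (auto simp: f_def)
    thus "a \<in> f ` ?Z" using zs by blast
  qed
  hence "card ?A = card ?Z" using card_image[OF inj] by simp
  thus ?thesis using card_lists_length_eq[of "{..<p}" "s + 1"] by simp
qed

section \<open>Common neighbours and the two sides of a neighbourhood\<close>

definition PX_common :: "nat \<Rightarrow> nat \<Rightarrow> nat \<Rightarrow> nat \<times> nat list \<Rightarrow> nat \<times> nat list \<Rightarrow> (nat \<times> nat list) set" where
  "PX_common p r s u w = {x. (PX_step p r s x u \<or> PX_step p r s u x) \<and> (PX_step p r s x w \<or> PX_step p r s w x)}"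

lemma finite_PX_verts: "finite (PX_verts p r s)"
proof -
  have "PX_verts p r s = {..<r} \<times> {xs. set xs \<subseteq> {..<p} \<and> length xs = s}" by (auto simp: PX_verts_def)
  thus ?thesis using finite_lists_length_eq[of "{..<p}" s] by simp
qed

lemma finite_PX_common: "finite (PX_common p r s u w)"
  by (rule finite_subset[OF _ finite_PX_verts[of p r s]]) (auto simp: PX_common_def PX_step_def)

lemma PX_common_commute: "PX_common p r s u w = PX_common p r s w u"
  by (auto simp: PX_common_def)

lemma card_PX_predecessors:
  assumes "PX_step p r s v w" "s \<ge> 1"
  shows "card {x. PX_step p r s x w} = p"
proof -
  have v: "length (snd v) = s" "set (snd v) \<subseteq> {..<p}" "fst v < r" "tl (snd v) = butlast (snd w)" "w \<in> PX_verts p r s" "fst w = (fst v + 1) mod r"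
    using assms by (auto simp: PX_step_def PX_verts_def)
  have "{x. PX_step p r s x w} = (\<lambda>a. (fst v, a # tl (snd v))) ` {..<p}"
  proof (intro equalityI subsetI)
    fix x assume "x \<in> {x. PX_step p r s x w}"
    hence x: "PX_step p r s x w" by simp
    obtain i a xs where eq: "x = (i, a # xs)"
      using x assms(2) by (cases x, cases "snd x") (auto simp: PX_step_def PX_verts_def)
    have 1: "i < r" "fst w = (i + 1) mod r" "xs = butlast (snd w)" "a < p" using x by (auto simp: PX_step_def PX_verts_def eq)
    have "[i + 1 = fst v + 1] (mod r)" using 1 v by (simp add: cong_def)
    hence "[i = fst v] (mod r)" by (rule cong_add_rcancel_nat[THEN iffD1])
    hence "i = fst v" using 1 v by (simp add: cong_def)
    thus "x \<in> (\<lambda>a. (fst v, a # tl (snd v))) ` {..<p}" using 1 v eq by simp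
  next
    fix x assume "x \<in> (\<lambda>a. (fst v, a # tl (snd v))) ` {..<p}"
    moreover have "set (tl (snd v)) \<subseteq> {..<p}" using v(2) by (cases "snd v") auto
    ultimately show "x \<in> {x. PX_step p r s x w}" using v assms(2) by (auto simp: PX_step_def PX_verts_def)
  qed
  thus ?thesis by (simp add: card_image inj_on_def)
qed

lemma card_PX_successors:
  assumes "PX_step p r s v w" "s \<ge> 1"
  shows "card {x. PX_step p r s v x} = p"
proof -
  have w: "length (snd w) = s" "set (snd w) \<subseteq> {..<p}" "fst w < r" "tl (snd v) = butlast (snd w)" "v \<in> PX_verts p r s" "fst w = (fst v + 1) mod r"
    using assms by (auto simp: PX_step_def PX_verts_def)
  have "{x. PX_step p r s v x} = (\<lambda>a. (fst w, butlast (snd w) @ [a])) ` {..<p}"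
  proof (intro equalityI subsetI)
    fix x assume "x \<in> {x. PX_step p r s v x}"
    hence x: "PX_step p r s v x" by simp
    obtain i xs a where eq: "x = (i, xs @ [a])"
      using x assms(2) by (cases x, cases "snd x" rule: rev_cases) (auto simp: PX_step_def PX_verts_def)
    have 1: "i = fst w" "xs = butlast (snd w)" "a < p" using x w by (auto simp: PX_step_def PX_verts_def eq)
    thus "x \<in> (\<lambda>a. (fst w, butlast (snd w) @ [a])) ` {..<p}" using eq by simp
  next
    fix x assume "x \<in> (\<lambda>a. (fst w, butlast (snd w) @ [a])) ` {..<p}"
    moreover have "set (butlast (snd w)) \<subseteq> {..<p}" using w(2) by (meson in_set_butlastD subset_iff)
    ultimately show "x \<in> {x. PX_step p r s v x}" using w assms(2) by (auto simp: PX_step_def PX_verts_def)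
  qed
  thus ?thesis by (simp add: card_image inj_on_def)
qed

lemma list_eq_if_tl_butlast_eq:
  assumes "length xs = length ys" "length xs \<ge> 2" "tl xs = tl ys" "butlast xs = butlast ys"
  shows "xs = ys"
proof -
  obtain x xs' where xs: "xs = x # xs'" "xs' \<noteq> []" using assms(2) by (cases xs) (auto simp: Suc_le_eq)
  obtain y ys' where ys: "ys = y # ys'" "ys' \<noteq> []" using assms(1,2) by (cases ys) (auto simp: Suc_le_eq)
  show ?thesis using assms(3,4) xs ys by simp
qed

text \<open>Two successors of \<open>v\<close> have the same \<open>butlast\<close> and hence the
  same \<open>p\<close> predecessors; dually for two predecessors. For \<open>s = 1\<close> windows
  do not overlap, so vertices of equal index share all \<open>2 * p\<close> neighbours. The
  thresholds are the bounds of \<open>card_PX_common_opposite_sides\<close>; for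
  \<open>s \<ge> 2\<close> it is \<open>p \<ge> 3\<close> that lifts the count above them.\<close>

lemma card_PX_common_same_side:
  assumes "p \<ge> 3" "r \<ge> 3" "s \<ge> 1"
    and "PX_step p r s v w \<and> PX_step p r s v w' \<or> PX_step p r s w v \<and> PX_step p r s w' v"
  shows "(if s = 1 then p else 2) < card (PX_common p r s w w')"
proof -
  have P: "{x. PX_step p r s x w} \<union> (if s = 1 then {x. PX_step p r s w x} else {}) \<subseteq> PX_common p r s w w'"
    if "PX_step p r s v w" "PX_step p r s v w'"
  proof -
    have "PX_step p r s x w'" if "PX_step p r s x w" for x
      using that \<open>PX_step p r s v w\<close> \<open>PX_step p r s v w'\<close> by (simp add: PX_step_def)
    moreover have "PX_step p r s w' x" if "PX_step p r s w x" "s = 1" for x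
    proof -
      have "tl (snd w') = []" "butlast (snd x) = []"
        using that \<open>PX_step p r s v w'\<close> by (auto simp: PX_step_def PX_verts_def length_Suc_conv)
      thus ?thesis using that \<open>PX_step p r s v w\<close> \<open>PX_step p r s v w'\<close> by (simp add: PX_step_def)
    qed
    ultimately show ?thesis by (auto simp: PX_common_def)
  qed
  have Q: "{x. PX_step p r s w x} \<union> (if s = 1 then {x. PX_step p r s x w} else {}) \<subseteq> PX_common p r s w w'"
    if "PX_step p r s w v" "PX_step p r s w' v"
  proof -
    have idx: "fst w = fst w'"
    proof -
      have "[fst w + 1 = fst w' + 1] (mod r)" using that by (simp add: PX_step_def cong_def)
      hence "[fst w = fst w'] (mod r)" by (rule cong_add_rcancel_nat[THEN iffD1])
      moreover have "fst w < r" "fst w' < r" using that by (auto simp: PX_step_def PX_verts_def)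
      ultimately show ?thesis by (simp add: cong_def)
    qed
    have "PX_step p r s w' x" if "PX_step p r s w x" for x
      using that \<open>PX_step p r s w v\<close> \<open>PX_step p r s w' v\<close> idx by (simp add: PX_step_def)
    moreover have "PX_step p r s x w'" if "PX_step p r s x w" "s = 1" for x
    proof -
      have "butlast (snd w') = []" "tl (snd x) = []"
        using that \<open>PX_step p r s w' v\<close> by (auto simp: PX_step_def PX_verts_def length_Suc_conv)
      thus ?thesis using that \<open>PX_step p r s w v\<close> \<open>PX_step p r s w' v\<close> idx by (simp add: PX_step_def)
    qed
    ultimately show ?thesis by (auto simp: PX_common_def)
  qed
  let ?I = "{x. PX_step p r s x w}" and ?O = "{x. PX_step p r s w x}"
  have fin: "finite ?I" "finite ?O"
    by (auto intro!: finite_subset[OF _ finite_PX_verts[of p r s]] simp: PX_step_def)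
  have wV: "w \<in> PX_verts p r s" using assms(4) by (auto simp: PX_step_def)
  obtain i xs where w: "w = (i, xs)" "i < r" "length xs = s" "set xs \<subseteq> {..<p}" using wV by (auto simp: PX_verts_def)
  have "PX_step p r s (i, take s (xs @ [0])) ((i + 1) mod r, drop 1 (xs @ [0]))"
    using w assms by (intro PX_step_take_drop) auto
  hence O: "card ?O = p" using w assms(3) by (intro card_PX_successors) auto
  \<comment> \<open>The index before \<open>i\<close>, with \<open>r - 1\<close> added in place of a
    subtraction.\<close>
  define j where "j = (i + (r - 1)) mod r"
  have "PX_step p r s (j, take s (0 # xs)) ((j + 1) mod r, drop 1 (0 # xs))"
    using w assms by (intro PX_step_take_drop) (auto simp: j_def)
  moreover have "(j + 1) mod r = i" using w assms(2) by (simp add: j_def mod_simps)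
  ultimately have I: "card ?I = p" using w assms(3) by (intro card_PX_predecessors) auto
  have "?I \<inter> ?O = {}" using PX_step_asym[OF _ assms(2)] by (fastforce simp: PX_step_def)
  hence IO: "card (?I \<union> ?O) = p + p" using card_Un_disjoint[OF fin] I O by simp
  have mono: "card S \<le> card (PX_common p r s w w')" if "S \<subseteq> PX_common p r s w w'" for S
    using that finite_PX_common by (rule card_mono[rotated])
  show ?thesis using assms(4)
  proof
    assume "PX_step p r s v w \<and> PX_step p r s v w'"
    hence "card (?I \<union> (if s = 1 then ?O else {})) \<le> card (PX_common p r s w w')" using P mono by blast
    thus ?thesis using assms(1) I IO by (cases "s = 1") auto
  next
    assume "PX_step p r s w v \<and> PX_step p r s w' v"
    hence "card (?O \<union> (if s = 1 then ?I else {})) \<le> card (PX_common p r s w w')" using Q mono by blast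
    thus ?thesis using assms(1) O IO by (cases "s = 1") (auto simp: Un_commute)
  qed
qed

text \<open>The vertices \<open>w\<close> and \<open>w'\<close> have indices \<open>i\<close> and
  \<open>i + 2\<close>. A common neighbour has index \<open>i + 1\<close> or, if the cycle closes up
  with \<open>r = 4\<close>, index \<open>i - 1\<close>. For \<open>s \<ge> 2\<close> both
  \<open>tl\<close> and \<open>butlast\<close> of its window are prescribed, so each position admits
  at most one. For \<open>s = 1\<close> only the position \<open>i + 1\<close> remains, with at most
  \<open>p\<close> vertices.\<close>

lemma card_PX_common_opposite_sides:
  assumes "r \<ge> 3" "s \<ge> 1" "\<not> (r = 4 \<and> s = 1)"
    and w: "PX_step p r s w v" and w': "PX_step p r s v w'"
  shows "card (PX_common p r s w w') \<le> (if s = 1 then p else 2)"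
proof -
  define i where "i = fst w"
  have i: "i < r" using w by (auto simp: i_def PX_step_def PX_verts_def)
  have idx: "fst v = (i + 1) mod r" "fst w' = (i + 2) mod r"
    using w w' by (auto simp: i_def PX_step_def mod_simps)
  have nc: "\<not> [k = 0] (mod r)" if "0 < k" "k < 3" for k using that assms(1) by (auto simp: cong_def)
  have A: "PX_step p r s w x \<and> PX_step p r s x w' \<or> PX_step p r s x w \<and> PX_step p r s w' x \<and> r = 4" if "x \<in> PX_common p r s w w'" for x
  proof -
    have "\<not> (PX_step p r s w x \<and> PX_step p r s w' x)"
    proof
      assume "PX_step p r s w x \<and> PX_step p r s w' x"
      hence "(i + 1) mod r = ((i + 2) mod r + 1) mod r" using idx by (simp add: PX_step_def i_def)
      hence "[(i + 1) + 2 = (i + 1) + 0] (mod r)" by (simp add: cong_def mod_simps)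
      hence "[2 = 0] (mod r)" by (rule cong_add_lcancel_nat[THEN iffD1])
      thus False using nc[of 2] by simp
    qed
    moreover have "\<not> (PX_step p r s x w \<and> PX_step p r s x w')"
    proof
      assume "PX_step p r s x w \<and> PX_step p r s x w'"
      hence "fst w' = fst w" by (simp add: PX_step_def)
      hence "i = (i + 2) mod r" using idx by (simp add: i_def)
      hence "[i + 2 = i + 0] (mod r)" using i by (simp add: cong_def)
      hence "[2 = 0] (mod r)" by (rule cong_add_lcancel_nat[THEN iffD1])
      thus False using nc[of 2] by simp
    qed
    moreover have "r = 4" if "PX_step p r s x w" "PX_step p r s w' x"
    proof -
      have "i = (((i + 2) mod r + 1) mod r + 1) mod r" using that idx by (simp add: PX_step_def i_def)
      hence "i = (i + 4) mod r" by (simp add: mod_simps eval_nat_numeral)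
      hence "[i + 4 = i + 0] (mod r)" using i by (simp add: cong_def)
      hence "[4 = 0] (mod r)" by (rule cong_add_lcancel_nat[THEN iffD1])
      hence "r dvd 4" by (simp add: cong_0_iff)
      hence "r \<le> 4" by (rule dvd_imp_le) simp
      hence "r = 3 \<or> r = 4" using assms(1) by linarith
      thus ?thesis using \<open>r dvd 4\<close> by auto
    qed
    ultimately show ?thesis using that unfolding PX_common_def by blast
  qed
  show ?thesis
  proof (cases "s = 1")
    case True
    have "PX_common p r s w w' \<subseteq> {x. PX_step p r s w x}" using A True assms(3) by blast
    moreover have "finite {x. PX_step p r s w x}"
      by (auto intro!: finite_subset[OF _ finite_PX_verts[of p r s]] simp: PX_step_def)
    ultimately show ?thesis using card_PX_successors[OF w assms(2)] True by (metis card_mono)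
  next
    case False
    hence s2: "s \<ge> 2" using assms(2) by simp
    have eqI: "x = y" if "x \<in> PX_verts p r s" "y \<in> PX_verts p r s" "fst x = fst y"
        "tl (snd x) = tl (snd y)" "butlast (snd x) = butlast (snd y)" for x y
    proof (rule prod_eqI)
      have "length (snd x) = s" "length (snd y) = s" using that(1,2) by (auto simp: PX_verts_def)
      thus "snd x = snd y" using that(4,5) s2 by (simp add: list_eq_if_tl_butlast_eq)
    qed fact
    have 1: "x = y" if "PX_step p r s w x \<and> PX_step p r s x w'" "PX_step p r s w y \<and> PX_step p r s y w'" for x y
      by (rule eqI) (use that in \<open>simp_all add: PX_step_def\<close>)
    have 2: "x = y" if "PX_step p r s x w \<and> PX_step p r s w' x" "PX_step p r s y w \<and> PX_step p r s w' y" for x y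
      by (rule eqI) (use that in \<open>simp_all add: PX_step_def\<close>)
    have "\<exists>a. {x. PX_step p r s w x \<and> PX_step p r s x w'} \<subseteq> {a}" using 1 by blast
    moreover have "\<exists>b. {x. PX_step p r s x w \<and> PX_step p r s w' x} \<subseteq> {b}" using 2 by blast
    ultimately obtain a b where "PX_common p r s w w' \<subseteq> {a, b}" using A by blast
    hence "card (PX_common p r s w w') \<le> card {a, b}" by (intro card_mono) auto
    also have "\<dots> \<le> 2" by (simp add: card_insert_if)
    finally show ?thesis using False by simp
  qed
qed

section \<open>Arc-regular groups of Praeger-Xu graphs\<close>

lemma arc_regular_group_PX:
  assumes "s \<ge> 1" "subgroup H (aut_group (PX_graph p r s))" "arc_regular (PX_graph p r s) H"
  shows "arc_regular_group (PX_graph p r s) H"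
proof (rule arc_regular_group.intro)
  show "fst e \<subseteq> gverts (PX_graph p r s)" if "e \<in> gedges (PX_graph p r s)" for e
    using that assms(1) by (auto simp: gedges_PX gverts_PX PX_step_def)
qed fact+

locale arc_regular_PX = arc_regular_group "PX_graph p r s" H for p r s H +
  assumes s_ge_1: "s \<ge> 1"
begin

abbreviation adj where "adj u w \<equiv> PX_step p r s u w \<or> PX_step p r s w u"

lemma adj_iff_edge: "adj u w \<longleftrightarrow> ({u, w}, 0) \<in> gedges (PX_graph p r s)"
  unfolding gedges_PX[OF s_ge_1] mem_Collect_eq prod.inject doubleton_eq_iff by blast

lemma adj_verts: "adj u w \<Longrightarrow> u \<in> gverts (PX_graph p r s) \<and> w \<in> gverts (PX_graph p r s)"
  by (auto simp: gverts_PX PX_step_def)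

lemma simple: "e \<in> gedges (PX_graph p r s) \<Longrightarrow> snd e = 0"
  by (auto simp: gedges_PX[OF s_ge_1])

lemma adj_image:
  assumes "g \<in> H" "adj u w"
  shows "adj (fst g u) (fst g w)"
proof -
  have e: "({u, w}, 0) \<in> gedges (PX_graph p r s)" using assms(2) by (simp only: adj_iff_edge)
  have "snd g ({u, w}, 0) = (fst g ` {u, w}, 0)" using simple_edge_image[OF simple assms(1) e] by simp
  hence "({fst g u, fst g w}, 0) \<in> gedges (PX_graph p r s)" using edge_closed[OF assms(1) e] by simp
  thus ?thesis by (simp only: adj_iff_edge)
qed

text \<open>Adjacency is preserved, so common neighbours are mapped injectively to common
  neighbours; the inverse element gives the opposite inequality.\<close>

lemma PX_common_image:
  assumes g: "g \<in> H" and u: "u \<in> gverts (PX_graph p r s)" and w: "w \<in> gverts (PX_graph p r s)"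
  shows "card (PX_common p r s (fst g u) (fst g w)) = card (PX_common p r s u w)"
proof -
  let ?V = "gverts (PX_graph p r s)"
  have sub: "PX_common p r s u w \<subseteq> ?V" for u w using adj_verts unfolding PX_common_def by blast
  have le: "card (PX_common p r s u w) \<le> card (PX_common p r s (fst g u) (fst g w))"
    if g: "g \<in> H" for g u w
  proof (rule card_inj_on_le[of "fst g"])
    show "inj_on (fst g) (PX_common p r s u w)"
      using bij_verts[OF g] sub[of u w] by (meson bij_betw_def inj_on_subset)
    show "fst g ` PX_common p r s u w \<subseteq> PX_common p r s (fst g u) (fst g w)"
      using adj_image[OF g] unfolding PX_common_def by blast
    show "finite (PX_common p r s (fst g u) (fst g w))" by (rule finite_PX_common)
  qed
  show ?thesis
    using le[OF g, of u w] le[OF inv_closed[OF g], of "fst g u" "fst g w"] inv_verts[OF g u] inv_verts[OF g w] by simp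
qed

text \<open>Whether two neighbours of a vertex lie on the same side is decided by the number of
  their common neighbours, which is invariant under automorphisms.\<close>

lemma dihedral_on_index:
  assumes "p \<ge> 3" "r \<ge> 3" "\<not> (r = 4 \<and> s = 1)" and g: "g \<in> H"
  shows "\<exists>d \<in> carrier (dihedral_group r). \<forall>v \<in> PX_verts p r s. fst (fst g v) = dihedral_act r d (fst v)"
proof (rule orientation_respecting_map[where R = "PX_step p r s"])
  show "r \<ge> 3" by fact
  show "u \<in> PX_verts p r s \<and> w \<in> PX_verts p r s \<and> fst w = (fst u + 1) mod r" if "PX_step p r s u w" for u w
    using that by (simp add: PX_step_def)
  show "fst v < r" if "v \<in> PX_verts p r s" for v using that by (auto simp: PX_verts_def)
  show "fst g v \<in> PX_verts p r s" if "v \<in> PX_verts p r s" for v using vert_closed[OF g] that by (simp add: gverts_PX)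
  show "adj\<^sup>*\<^sup>* u w" if "u \<in> PX_verts p r s" "w \<in> PX_verts p r s" for u w
    using assms s_ge_1 that by (intro PX_connected) auto
  show "adj (fst g u) (fst g w)" if "adj u w" for u w using adj_image[OF g that] .
  let ?t = "if s = 1 then p else 2"
  have crit: "(PX_step p r s v w \<longleftrightarrow> PX_step p r s v w') \<longleftrightarrow> ?t < card (PX_common p r s w w')"
    if "adj v w" "adj v w'" for v w w'
  proof -
    have asym: "\<not> (PX_step p r s u x \<and> PX_step p r s x u)" for u x
    proof
      assume a: "PX_step p r s u x \<and> PX_step p r s x u"
      hence "fst u = (fst x + 1) mod r" unfolding PX_step_def by blast
      thus False using PX_step_asym[of p r s u x] a assms(2) by blast
    qed
    have same: "?t < card (PX_common p r s w w')" if "PX_step p r s v w \<and> PX_step p r s v w' \<or> PX_step p r s w v \<and> PX_step p r s w' v"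
      by (rule card_PX_common_same_side[OF assms(1,2) s_ge_1 that])
    have opp: "\<not> ?t < card (PX_common p r s w w')" if "PX_step p r s w v \<and> PX_step p r s v w' \<or> PX_step p r s w' v \<and> PX_step p r s v w"
      using that card_PX_common_opposite_sides[OF assms(2) s_ge_1 assms(3), of p w v w']
        card_PX_common_opposite_sides[OF assms(2) s_ge_1 assms(3), of p w' v w] PX_common_commute[of p r s w w'] by auto
    show ?thesis using that same opp asym[of v w] asym[of v w'] by argo
  qed
  show "(PX_step p r s v w \<longleftrightarrow> PX_step p r s v w') \<longleftrightarrow>
      (PX_step p r s (fst g v) (fst g w) \<longleftrightarrow> PX_step p r s (fst g v) (fst g w'))"
    if "adj v w" "adj v w'" for v w w'
    using crit[OF that] crit[OF adj_image[OF g that(1)] adj_image[OF g that(2)]]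
      PX_common_image[OF g, of w w'] adj_verts[OF that(1)] adj_verts[OF that(2)] by simp
qed

end

text \<open>The \<open>p\<close> points above an index are the classes \<open>S i a\<close> of
  vertices with first entry \<open>a\<close>. Elements of \<open>N\<close> preserve directed walks,
  and walks detect entries by \<open>PX_walk_overlap\<close>: this makes the classes invariant, and
  also makes the action on them faithful.\<close>

lemma PX_graph_semidirect_product:
  assumes r: "r \<ge> 3" and p: "Factorial_Ring.prime p" "odd p" "\<not> p dvd r"
    and s: "s \<ge> 1" "\<not> (r = 4 \<and> s = 1)"
    and H: "subgroup H (aut_group (PX_graph p r s))" "arc_regular (PX_graph p r s) H"
  shows "is_semidirect_product_of ((aut_group (PX_graph p r s))\<lparr>carrier := H\<rparr>) (Zp_power p (s + 1)) (dihedral_group r)"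
proof -
  interpret arc_regular_PX p r s H
    using arc_regular_group_PX[OF s(1) H] s(1) by (simp add: arc_regular_PX_def arc_regular_PX_axioms_def)
  have p3: "p \<ge> 3" using p prime_ge_2_nat[of p] by (cases "p = 2") auto
  let ?V = "PX_verts p r s"
  define N where "N = {g \<in> H. \<forall>v \<in> ?V. fst (fst g v) = fst v}"
  have NH: "g \<in> H" if "g \<in> N" for g using that by (simp add: N_def)
  have closed: "fst g v \<in> ?V" if "g \<in> N" "v \<in> ?V" for g v
    using that vert_closed[OF NH] by (simp add: gverts_PX)
  have inv_N: "inv\<^bsub>G\<^esub> g \<in> N" if g: "g \<in> N" for g
  proof -
    have "fst (fst (inv\<^bsub>G\<^esub> g) v) = fst v" if v: "v \<in> ?V" for v
    proof -
      have "fst (inv\<^bsub>G\<^esub> g) v \<in> ?V" using vert_closed[OF inv_closed[OF NH[OF g]]] v by (simp add: gverts_PX)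
      hence "fst (fst g (fst (inv\<^bsub>G\<^esub> g) v)) = fst (fst (inv\<^bsub>G\<^esub> g) v)" using g by (simp add: N_def)
      thus ?thesis using inv_verts'[OF NH[OF g], of v] v by (simp add: gverts_PX)
    qed
    thus ?thesis using inv_closed[OF NH[OF g]] by (simp add: N_def)
  qed
  \<comment> \<open>The image is again an edge and its ends keep their indices, so for
    \<open>r \<ge> 3\<close> it cannot be directed the other way.\<close>
  have step: "PX_step p r s (fst g u) (fst g w)" if g: "g \<in> N" and uw: "PX_step p r s u w" for g u w
  proof -
    have V: "u \<in> ?V" "w \<in> ?V" using uw by (auto simp: PX_step_def)
    have "\<not> PX_step p r s (fst g w) (fst g u)"
      using PX_step_asym[OF uw r] g V by (auto simp: N_def PX_step_def)
    thus ?thesis using adj_image[OF NH[OF g]] uw by blast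
  qed
  have walk: "(PX_step p r s ^^ n) (fst g u) (fst g w)" if g: "g \<in> N" and "(PX_step p r s ^^ n) u w" for g n u w
    using that(2)
  proof (induction n arbitrary: w)
    case 0 thus ?case by simp
  next
    case (Suc n)
    then obtain x where x: "(PX_step p r s ^^ n) u x" "PX_step p r s x w" by auto
    show ?case unfolding relpowp.simps using Suc.IH[OF x(1)] step[OF g x(2)] by (rule relcomppI)
  qed
  have walk_hd: "hd (snd w) = snd u ! n" if "(PX_step p r s ^^ n) u w" "n < s" "u \<in> ?V" for n u w
  proof -
    have *: "drop n (snd u) = take (s - n) (snd w)" "w \<in> ?V" using PX_walk_overlap[OF that(1) _ that(3)] that(2) by auto
    have "snd u ! n = hd (drop n (snd u))" using that by (auto simp: PX_verts_def hd_drop_conv_nth)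
    also have "\<dots> = hd (snd w)" unfolding * using that(2) by simp
    finally show ?thesis ..
  qed
  define S where "S = (\<lambda>i a. {v \<in> ?V. fst v = i \<and> hd (snd v) = a})"
  have hd_eq: "hd (snd (fst g u)) = hd (snd (fst g w))"
    if g: "g \<in> N" and uw: "u \<in> S i a" "w \<in> S i a" for g u w i a
  proof -
    have i: "i < r" using uw by (auto simp: S_def PX_verts_def)
    \<comment> \<open>This is \<open>i - (s - 1)\<close> modulo \<open>r\<close>; the multiple
      \<open>r * s\<close> avoids truncation. All of \<open>S i a\<close> is reached in
      \<open>s - 1\<close> steps from the one vertex at \<open>k\<close> with list
      \<open>replicate (s - 1) 0 @ [a]\<close>, so the last entry of the image of that vertex is the
      first entry of every image.\<close>
    define k where "k = (i + (r * s - (s - 1))) mod r"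
    have le: "s - 1 \<le> r * s" using mult_le_mono1[of 1 r s] r by linarith
    have "(k + (s - 1)) mod r = (i + (r * s - (s - 1)) + (s - 1)) mod r" by (simp add: k_def mod_simps)
    also have "i + (r * s - (s - 1)) + (s - 1) = i + r * s" using le by simp
    finally have ki: "(k + (s - 1)) mod r = i" using i by simp
    have k: "k < r" using r by (simp add: k_def)
    have w: "(PX_step p r s ^^ (s - 1)) (k, replicate (s - 1) 0 @ [a]) x" if x: "x \<in> S i a" for x
    proof -
      define zs where "zs = replicate (s - 1) 0 @ snd x"
      have x': "length (snd x) = s" "set (snd x) \<subseteq> {..<p}" "fst x = i" "hd (snd x) = a" using x by (auto simp: S_def PX_verts_def)
      have "(PX_step p r s ^^ (s - 1)) (k, take s zs) ((k + (s - 1)) mod r, drop (s - 1) zs)"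
        using x' p3 s(1) k by (intro PX_walk) (auto simp: zs_def)
      moreover have "take s zs = replicate (s - 1) 0 @ [a]"
        using x' s(1) by (cases "snd x") (auto simp: zs_def)
      moreover have "drop (s - 1) zs = snd x" by (simp add: zs_def)
      ultimately show ?thesis using ki x' by (metis prod.collapse)
    qed
    have "a < p" using uw(1) s(1) by (cases "snd u") (auto simp: S_def PX_verts_def)
    hence zV: "(k, replicate (s - 1) 0 @ [a]) \<in> ?V" using k s(1) p3 by (auto simp: PX_verts_def)
    show ?thesis
      using walk_hd[OF walk[OF g w[OF uw(1)]] _ closed[OF g zV]] walk_hd[OF walk[OF g w[OF uw(2)]] _ closed[OF g zV]] s(1) by simp
  qed
  have S_into: "\<exists>b<p. fst g ` S i a \<subseteq> S i b" if g: "g \<in> N" and "i < r" "a < p" for g i a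
  proof -
    have "(i, a # replicate (s - 1) 0) \<in> S i a" (is "?u \<in> _") using that s(1) p3 by (auto simp: S_def PX_verts_def)
    define b where "b = hd (snd (fst g ?u))"
    have V: "fst g ?u \<in> ?V" using closed[OF g] \<open>?u \<in> S i a\<close> by (simp add: S_def)
    hence "b < p" using s(1) by (cases "snd (fst g ?u)") (auto simp: b_def PX_verts_def)
    moreover have "fst g ` S i a \<subseteq> S i b"
    proof
      fix y assume "y \<in> fst g ` S i a"
      then obtain w where w: "w \<in> S i a" "y = fst g w" by blast
      have "w \<in> ?V" "fst w = i" using w by (auto simp: S_def)
      thus "y \<in> S i b" using hd_eq[OF g w(1) \<open>?u \<in> S i a\<close>] closed[OF g] g w(2) by (simp add: S_def b_def N_def)
    qed
    ultimately show ?thesis by blast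
  qed
  have S_ne: "(i, a # replicate (s - 1) 0) \<in> S i a" if "i < r" "a < p" for i a
    using that s(1) p3 by (auto simp: S_def PX_verts_def)
  \<comment> \<open>Inclusions for \<open>g\<close> and for its inverse combine to an equality: the
    representative of \<open>S i a\<close> returns to itself, and first entries tell classes apart,
    so the inverse leads back to the class of \<open>a\<close>.\<close>
  have S_img: "\<exists>b<p. fst g ` S i a = S i b" if g: "g \<in> N" and i: "i < r" and a: "a < p" for g i a
  proof -
    obtain b where b: "b < p" "fst g ` S i a \<subseteq> S i b" using S_into[OF g i a] by blast
    obtain c where c: "c < p" "fst (inv\<^bsub>G\<^esub> g) ` S i b \<subseteq> S i c" using S_into[OF inv_N[OF g] i b(1)] by blast
    have SV: "S i a \<subseteq> gverts (PX_graph p r s)" for a by (auto simp: S_def gverts_PX)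
    let ?u = "(i, a # replicate (s - 1) 0)"
    have u: "?u \<in> S i a" "?u \<in> gverts (PX_graph p r s)" using S_ne[OF i a] SV by blast+
    have "fst g ?u \<in> S i b" using u(1) b(2) by blast
    hence "fst (inv\<^bsub>G\<^esub> g) (fst g ?u) \<in> S i c" using c(2) by blast
    hence "?u \<in> S i c" using inv_verts[OF NH[OF g] u(2)] by simp
    hence "c = a" by (simp add: S_def)
    have "S i b \<subseteq> fst g ` S i a"
    proof
      fix y assume y: "y \<in> S i b"
      hence "fst (inv\<^bsub>G\<^esub> g) y \<in> S i a" using c(2) \<open>c = a\<close> by blast
      moreover have "y = fst g (fst (inv\<^bsub>G\<^esub> g) y)" using inv_verts'[OF NH[OF g], of y] y SV[of b] by auto
      ultimately show "y \<in> fst g ` S i a" by blast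
    qed
    thus ?thesis using b by blast
  qed
  define Y where "Y = (\<lambda>i. S i ` {..<p})"
  have S_inj: "a = b" if "S i a = S i b" "i < r" "a < p" for i a b
  proof -
    have "(i, a # replicate (s - 1) 0) \<in> S i b" using S_ne[OF that(2,3)] that(1) by blast
    thus ?thesis by (simp add: S_def)
  qed
  note N_def' = N_def[folded gverts_PX]
  show ?thesis
  proof (rule semidirect_product_over_cycle[where \<pi> = fst and I = "{..<r}" and Y = Y and \<beta> = "\<lambda>_ g S. fst g ` S", folded N_def'])
    show "fst v < r" if "v \<in> gverts (PX_graph p r s)" for v using that by (auto simp: gverts_PX PX_verts_def)
    show "\<exists>e\<in>gedges (PX_graph p r s). \<exists>u w. fst e = {u, w} \<and> fst u = i \<and> fst w = (i + 1) mod r" if "i < r" for i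
    proof -
      have "PX_step p r s (i, take s (replicate (s + 1) 0)) ((i + 1) mod r, drop 1 (replicate (s + 1) 0))" (is "PX_step _ _ _ ?u ?w")
        using that s(1) p3 by (intro PX_step_take_drop) auto
      hence "({?u, ?w}, 0) \<in> gedges (PX_graph p r s)" unfolding gedges_PX[OF s(1)] by blast
      thus ?thesis by (rule bexI[rotated]) (intro exI[of _ ?u] exI[of _ ?w], simp)
    qed
    show "\<exists>d\<in>carrier (dihedral_group r). \<forall>v\<in>gverts (PX_graph p r s). fst (fst g v) = dihedral_act r d (fst v)" if "g \<in> H" for g
      unfolding gverts_PX by (rule dihedral_on_index[OF p3 r s(2) that])
    show "card {a \<in> arcs (PX_graph p r s). fst ` fst (fst a) = {0, 1} \<and> fst (snd a) = 0} = p ^ (s + 1)"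
      by (rule card_PX_arcs_over[OF r s(1)])
    show "card (Y i) = p" if "i \<in> {..<r}" for i
      unfolding Y_def using that S_inj by (subst card_image) (auto intro!: inj_onI)
    show "bij_betw ((`) (fst g)) (Y i) (Y i)" if i: "i \<in> {..<r}" and g: "g \<in> N" for i g
    proof (rule bij_betw_endo)
      show "finite (Y i)" by (simp add: Y_def)
      have "inj_on (fst g) ?V" using bij_verts[OF NH[OF g]] by (simp add: bij_betw_def gverts_PX)
      hence "inj_on ((`) (fst g)) (Pow ?V)" by (rule inj_on_image_Pow)
      moreover have "Y i \<subseteq> Pow ?V" by (auto simp: Y_def S_def)
      ultimately show "inj_on ((`) (fst g)) (Y i)" by (rule inj_on_subset)
      show "(`) (fst g) ` Y i \<subseteq> Y i"
      proof
        fix T assume "T \<in> (`) (fst g) ` Y i"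
        then obtain a where "a < p" "T = fst g ` S i a" by (auto simp: Y_def)
        thus "T \<in> Y i" using S_img[OF g, of i a] i by (auto simp: Y_def)
      qed
    qed
    show "fst (g \<otimes>\<^bsub>G\<^esub> h) ` T = fst g ` fst h ` T" if "T \<in> Y i" for i g h T
    proof -
      have "T \<subseteq> gverts (PX_graph p r s)" using that by (auto simp: Y_def S_def gverts_PX)
      thus ?thesis unfolding image_image using mult_verts[of _ g h] by (intro image_cong) auto
    qed
    show "g = \<one>\<^bsub>G\<^esub>" if g: "g \<in> N" and fixed: "\<And>i T. i \<in> {..<r} \<Longrightarrow> T \<in> Y i \<Longrightarrow> fst g ` T = T" for g
    proof (rule simple_eq_one[OF simple])
      show "g \<in> H" using NH[OF g] .
      have hd_fix: "hd (snd (fst g v)) = hd (snd v)" if v: "v \<in> ?V" for v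
      proof -
        have "fst v < r" "hd (snd v) < p" using v s(1) by (cases "snd v"; auto simp: PX_verts_def)+
        hence "fst g ` S (fst v) (hd (snd v)) = S (fst v) (hd (snd v))" by (intro fixed[of "fst v"]) (auto simp: Y_def)
        moreover have "v \<in> S (fst v) (hd (snd v))" using v by (simp add: S_def)
        ultimately have "fst g v \<in> S (fst v) (hd (snd v))" by blast
        thus ?thesis by (simp add: S_def)
      qed
      fix v assume "v \<in> gverts (PX_graph p r s)"
      hence v: "v \<in> ?V" by (simp add: gverts_PX)
      have len: "length (snd v) = s" "length (snd (fst g v)) = s" using v closed[OF g v] by (auto simp: PX_verts_def)
      have "snd (fst g v) ! n = snd v ! n" if n: "n < s" for n
      proof -
        \<comment> \<open>Padding permits \<open>n\<close> steps from \<open>v\<close>; the zeros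
          are arbitrary. The walk ends at a vertex whose first entry is entry \<open>n\<close> of
          \<open>v\<close>, and first entries are already known to be fixed.\<close>
        define zs where "zs = snd v @ replicate n 0"
        define u where "u = ((fst v + n) mod r, drop n zs)"
        have "(PX_step p r s ^^ n) (fst v, take s zs) u"
          unfolding u_def using v s(1) p3 by (intro PX_walk) (auto simp: zs_def PX_verts_def)
        moreover have "(fst v, take s zs) = v" using len by (simp add: zs_def)
        ultimately have vu: "(PX_step p r s ^^ n) v u" by simp
        have "u \<in> ?V" using PX_walk_overlap[OF vu _ v] n by simp
        have "snd (fst g v) ! n = hd (snd (fst g u))" using walk_hd[OF walk[OF g vu] n closed[OF g v]] by simp
        also have "\<dots> = hd (snd u)" by (rule hd_fix[OF \<open>u \<in> ?V\<close>])
        also have "\<dots> = snd v ! n" by (rule walk_hd[OF vu n v])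
        finally show ?thesis .
      qed
      hence "snd (fst g v) = snd v" using len by (intro nth_equalityI) auto
      moreover have "fst (fst g v) = fst v" using g v by (simp add: N_def)
      ultimately show "fst g v = v" by (rule prod_eqI[rotated])
    qed
  qed (use r p in auto)
qed

section \<open>The complete bipartite graph\<close>

lemma (in group) conj_eq_one_iff:
  assumes "x \<in> carrier G" "y \<in> carrier G"
  shows "y \<otimes> x \<otimes> inv y = \<one> \<longleftrightarrow> x = \<one>"
proof
  assume "y \<otimes> x \<otimes> inv y = \<one>"
  hence "(y \<otimes> x \<otimes> inv y) \<otimes> y = y" using assms by simp
  hence "y \<otimes> x = y \<otimes> \<one>" using assms by (simp add: m_assoc)
  thus "x = \<one>" using assms by (simp only: l_cancel one_closed)
qed (use assms in simp)

text \<open>A Sylow \<open>p\<close>-subgroup has index 2 and so contains all squares. An element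
  whose \<open>p\<close>-th power is trivial is, as \<open>p\<close> is odd, the inverse of a power
  of its square and lies in it too. Thus the Sylow subgroup is given by an equation, without a
  choice.\<close>

lemma (in group) subgroup_of_order_twice_prime:
  assumes "Factorial_Ring.prime p" "odd p" "order G = 2 * p"
  shows "subgroup {x \<in> carrier G. x [^] p = \<one>} G" "card {x \<in> carrier G. x [^] p = \<one>} = p"
proof -
  have fin: "finite (carrier G)" using assms order_gt_0_iff_finite prime_gt_0_nat by simp
  obtain T where T: "subgroup T G" "card T = p"
    using sylow_thm[OF assms(1) group_axioms, of 1 2] fin assms(3) by auto
  interpret T: group "G\<lparr>carrier := T\<rparr>" using subgroup_imp_group[OF T(1)] .
  have TG: "T \<subseteq> carrier G" using T(1) by (rule subgroup.subset)
  have "{x \<in> carrier G. x [^] p = \<one>} = T"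
  proof (intro equalityI subsetI)
    fix x assume "x \<in> T"
    hence "x [^]\<^bsub>G\<lparr>carrier := T\<rparr>\<^esub> order (G\<lparr>carrier := T\<rparr>) = \<one>\<^bsub>G\<lparr>carrier := T\<rparr>\<^esub>"
      by (intro T.pow_order_eq_1) simp
    hence "x [^] p = \<one>" using T(2) by (simp add: order_def nat_pow_def)
    thus "x \<in> {x \<in> carrier G. x [^] p = \<one>}" using \<open>x \<in> T\<close> TG by auto
  next
    fix x assume "x \<in> {x \<in> carrier G. x [^] p = \<one>}"
    hence x: "x \<in> carrier G" "x [^] p = \<one>" by auto
    show "x \<in> T"
    proof (rule ccontr)
      assume "x \<notin> T"
      let ?C = "(\<lambda>t. x \<otimes> t) ` T"
      have sub: "?C \<subseteq> carrier G" using x TG by auto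
      have "card ?C = p" using T(2) x TG by (subst card_image) (auto simp: inj_on_def subset_iff)
      moreover have "T \<inter> ?C = {}"
      proof (rule ccontr)
        assume "T \<inter> ?C \<noteq> {}"
        then obtain t where t: "t \<in> T" "x \<otimes> t \<in> T" by auto
        hence "(x \<otimes> t) \<otimes> inv t \<in> T" using T(1) by (meson subgroup.m_closed subgroup.m_inv_closed)
        moreover have "(x \<otimes> t) \<otimes> inv t = x" using t x TG by (metis m_assoc r_inv r_one inv_closed subsetD)
        ultimately show False using \<open>x \<notin> T\<close> by simp
      qed
      ultimately have "card (T \<union> ?C) = order G"
        using T(2) assms(3) TG sub fin by (subst card_Un_disjoint) (auto intro: finite_subset)
      hence "T \<union> ?C = carrier G" using fin TG sub by (metis Un_least card_subset_eq order_def)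
      moreover have "x \<otimes> x \<notin> ?C" using x TG \<open>x \<notin> T\<close> by (auto simp: subset_iff)
      ultimately have x2: "x \<otimes> x \<in> T" using x by blast
      obtain q where q: "p = Suc (2 * q)" using assms(2) by (metis oddE add.commute plus_1_eq_Suc)
      have "x [^] p = (x \<otimes> x) [^] q \<otimes> x"
        using x by (simp add: q pow_mult_distrib nat_pow_mult mult_2)
      moreover have pow_T: "(x \<otimes> x) [^] q \<in> T"
        using subgroup_int_pow_closed[OF T(1) x2, of "int q"] by (simp add: int_pow_int)
      ultimately have "x = inv ((x \<otimes> x) [^] q)" using x by (metis inv_equality inv_inv m_closed nat_pow_closed)
      thus False using \<open>x \<notin> T\<close> T(1) pow_T by (metis subgroup.m_inv_closed)
    qed
  qed
  thus "subgroup {x \<in> carrier G. x [^] p = \<one>} G" "card {x \<in> carrier G. x [^] p = \<one>} = p" using T by auto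
qed

text \<open>\<open>C(p, 4, 1)\<close> is the complete bipartite graph between the vertices of even and of odd index.\<close>

locale arc_regular_complete_bipartite = arc_regular_PX p r s H for p r s H +
  assumes p: "Factorial_Ring.prime p" "odd p" and r4: "r = 4" and s1: "s = 1"
begin

abbreviation V where "V \<equiv> PX_verts p r s"

abbreviation act where "act g v \<equiv> fst g v"

definition side :: "nat \<times> nat list \<Rightarrow> (nat \<times> nat list) set" where
  "side v = {u \<in> V. even (fst u) \<longleftrightarrow> even (fst v)}"

lemma p_pos: "p > 0" and p_gt_1: "p > 1"
  using p prime_gt_0_nat prime_gt_1_nat by auto

text \<open>For \<open>s = 1\<close> windows do not overlap and only the indices matter; modulo 4,
  residues of different parity are always consecutive in one of the two orders.\<close>

lemma adj_iff: "adj u w \<longleftrightarrow> u \<in> V \<and> w \<in> V \<and> (even (fst u) \<longleftrightarrow> odd (fst w))"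
proof -
  have l: "tl (snd u) = []" "butlast (snd u) = []" if "u \<in> V" for u
    using that by (auto simp: PX_verts_def length_Suc_conv s1)
  have i: "fst u < r" if "u \<in> V" for u using that by (auto simp: PX_verts_def)
  have par: "(even a \<longleftrightarrow> odd b) \<longleftrightarrow> (b = (a + 1) mod r \<or> a = (b + 1) mod r)" if "a < r" "b < r" for a b :: nat
  proof -
    have "a = 0 \<or> a = 1 \<or> a = 2 \<or> a = 3" "b = 0 \<or> b = 1 \<or> b = 2 \<or> b = 3" using that r4 by auto
    thus ?thesis unfolding r4 by (elim disjE) simp_all
  qed
  have "adj u w \<longleftrightarrow> u \<in> V \<and> w \<in> V \<and> (fst w = (fst u + 1) mod r \<or> fst u = (fst w + 1) mod r)"
    unfolding PX_step_def using l[of u] l[of w] by (cases "u \<in> V"; cases "w \<in> V"; simp)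
  thus ?thesis using par i by blast
qed

lemma finite_V: "finite V"
  by (rule finite_PX_verts)

lemma closed: "g \<in> H \<Longrightarrow> v \<in> V \<Longrightarrow> act g v \<in> V"
  using vert_closed by (simp add: gverts_PX)

lemma act_mult: "v \<in> V \<Longrightarrow> act (g \<otimes>\<^bsub>G\<^esub> h) v = act g (act h v)"
  and act_one: "v \<in> V \<Longrightarrow> act \<one>\<^bsub>G\<^esub> v = v"
  using mult_verts[of v g h] one_verts[of v] by (simp_all add: gverts_PX)

lemma act_inv: "g \<in> H \<Longrightarrow> v \<in> V \<Longrightarrow> act (inv\<^bsub>G\<^esub> g) (act g v) = v"
  using inv_verts[of g v] by (simp add: gverts_PX)

lemma act_inj: "g \<in> H \<Longrightarrow> u \<in> V \<Longrightarrow> v \<in> V \<Longrightarrow> act g u = act g v \<longleftrightarrow> u = v"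
  by (metis act_inv)

lemma H_mult: "g \<in> H \<Longrightarrow> h \<in> H \<Longrightarrow> g \<otimes>\<^bsub>G\<^esub> h \<in> H"
  using G.m_closed[of g h] by simp

lemma opposite_exists: "\<exists>w. adj v w" if "v \<in> V"
proof -
  have "(0, [0]) \<in> V" "(1, [0]) \<in> V" using p_pos by (auto simp: PX_verts_def r4 s1)
  thus ?thesis using that unfolding adj_iff by (metis even_zero fst_conv odd_one)
qed

lemma same_side_image:
  assumes "g \<in> H" "u \<in> V" "v \<in> V"
  shows "(even (fst (act g u)) \<longleftrightarrow> even (fst (act g v))) \<longleftrightarrow> (even (fst u) \<longleftrightarrow> even (fst v))"
proof -
  obtain w where w: "adj v w" using opposite_exists[OF assms(3)] by blast
  have "adj (act g v) (act g w)" using adj_image[OF assms(1) w] .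
  moreover have "adj (act g u) (act g w)" if "adj u w" using adj_image[OF assms(1) that] .
  moreover have "adj (act g u) (act g v)" if "adj u v" using adj_image[OF assms(1) that] .
  ultimately show ?thesis using w assms closed[OF assms(1)] unfolding adj_iff by blast
qed

text \<open>In a simple graph an arc is an ordered pair of adjacent vertices, so regularity can be
  used without mentioning edges.\<close>

lemma regular_pairs:
  assumes "adj u w" "adj u' w'"
  shows "\<exists>!g. g \<in> H \<and> act g u = u' \<and> act g w = w'"
proof -
  let ?\<Gamma> = "PX_graph p r s"
  have e: "({u, w}, 0) \<in> gedges ?\<Gamma>" "({u', w'}, 0) \<in> gedges ?\<Gamma>" using assms by (simp_all only: adj_iff_edge)
  have "u' \<noteq> w'" using assms(2)[unfolded adj_iff] by auto
  have "(g \<in> H \<and> arc_act g (({u, w}, 0), u) = (({u', w'}, 0), u')) \<longleftrightarrow> (g \<in> H \<and> act g u = u' \<and> act g w = w')" for g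
  proof (cases "g \<in> H")
    case True
    have "snd g ({u, w}, 0) = ({act g u, act g w}, 0)" using simple_edge_image[OF simple True e(1)] by simp
    thus ?thesis using \<open>u' \<noteq> w'\<close> by (auto simp: arc_act_def doubleton_eq_iff)
  qed simp
  moreover have "\<exists>!g. g \<in> H \<and> arc_act g (({u, w}, 0), u) = (({u', w'}, 0), u')"
  proof -
    have "(({u, w}, 0), u) \<in> arcs ?\<Gamma>" "(({u', w'}, 0), u') \<in> arcs ?\<Gamma>" using e by (simp_all add: arcs_def)
    thus ?thesis using regular[unfolded arc_regular_def] by blast
  qed
  ultimately show ?thesis by simp
qed

lemma trivial_if_fixes_edge: "g = \<one>\<^bsub>G\<^esub>" if "g \<in> H" "adj u w" "act g u = u" "act g w = w"
proof -
  have "u \<in> V" "w \<in> V" using that(2)[unfolded adj_iff] by auto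
  hence "\<one>\<^bsub>G\<^esub> \<in> H \<and> act \<one>\<^bsub>G\<^esub> u = u \<and> act \<one>\<^bsub>G\<^esub> w = w" using act_one G.one_closed by simp
  thus ?thesis using regular_pairs[OF that(2,2)] that by blast
qed

lemma card_side: "card (side v) = 2 * p"
proof -
  define c where "c = (if even (fst v) then 0 else 1 :: nat)"
  have "side v = (\<lambda>(i, a). (i, [a])) ` ({c, c + 2} \<times> {..<p})"
  proof (intro equalityI subsetI)
    fix u assume "u \<in> side v"
    hence "u \<in> V" "even (fst u) \<longleftrightarrow> even (fst v)" by (auto simp: side_def)
    then obtain i a where u: "u = (i, [a])" "i < 4" "a < p" "even i \<longleftrightarrow> even (fst v)"
      by (auto simp: PX_verts_def length_Suc_conv r4 s1)
    have "i = 0 \<or> i = 1 \<or> i = 2 \<or> i = 3" using u(2) by auto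
    hence "i \<in> {c, c + 2}" using u(4) by (auto simp: c_def)
    thus "u \<in> (\<lambda>(i, a). (i, [a])) ` ({c, c + 2} \<times> {..<p})" using u by auto
  next
    fix u :: "nat \<times> nat list" assume "u \<in> (\<lambda>(i, a). (i, [a])) ` ({c, c + 2} \<times> {..<p})"
    thus "u \<in> side v" unfolding side_def PX_verts_def c_def using r4 s1 by (auto split: if_splits)
  qed
  moreover have "inj_on (\<lambda>(i, a). (i, [a])) ({c, c + 2} \<times> {..<p})" by (auto simp: inj_on_def)
  ultimately show ?thesis by (simp add: card_image card_cartesian_product)
qed

section \<open>Sylow subgroups of the vertex stabilisers\<close>

definition Q where "Q v = {g \<in> H. act g v = v \<and> g [^]\<^bsub>G\<^esub> p = \<one>\<^bsub>G\<^esub>}"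

lemma subgroup_stab:
  assumes "v \<in> V"
  shows "subgroup {g \<in> H. act g v = v} G"
proof (rule G.subgroupI)
  have "\<one>\<^bsub>G\<^esub> \<in> {g \<in> H. act g v = v}" using act_one[OF assms] G.one_closed by simp
  thus "{g \<in> H. act g v = v} \<noteq> {}" by blast
  show "inv\<^bsub>G\<^esub> g \<in> {g \<in> H. act g v = v}" if "g \<in> {g \<in> H. act g v = v}" for g
    using that inv_closed[of g] act_inv[OF _ assms, of g] by simp
  show "g \<otimes>\<^bsub>G\<^esub> h \<in> {g \<in> H. act g v = v}" if "g \<in> {g \<in> H. act g v = v}" "h \<in> {g \<in> H. act g v = v}" for g h
    using that H_mult[of g h] act_mult[OF assms, of g h] by simp
qed auto

text \<open>Regularity on arcs makes the stabiliser of \<open>v\<close> regular on the opposite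
  side, hence of order \<open>2 * p\<close>, and \<open>Q v\<close> is its Sylow
  \<open>p\<close>-subgroup. The description by an equation makes \<open>Q\<close> visibly
  compatible with conjugation.\<close>

lemma Q_subgroup: "subgroup (Q v) G" and card_Q: "card (Q v) = p" if v: "v \<in> V"
proof -
  define S where "S = {g \<in> H. act g v = v}"
  obtain w where w: "adj v w" using opposite_exists[OF v] by blast
  have "bij_betw (\<lambda>g. act g w) S (side w)"
  proof (rule bij_betw_imageI)
    show "inj_on (\<lambda>g. act g w) S"
    proof (rule inj_onI)
      fix g h assume gh: "g \<in> S" "h \<in> S" "act g w = act h w"
      have "adj v (act g w)" using gh(1) adj_image[OF _ w, of g] by (simp add: S_def)
      from regular_pairs[OF w this] gh show "g = h" unfolding S_def by auto
    qed
    show "(\<lambda>g. act g w) ` S = side w"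
    proof (intro equalityI subsetI)
      fix x assume "x \<in> (\<lambda>g. act g w) ` S"
      then obtain g where g: "g \<in> H" "act g v = v" "x = act g w" by (auto simp: S_def)
      have "adj v x" using g adj_image[OF g(1) w] by simp
      thus "x \<in> side w" using w unfolding adj_iff side_def by blast
    next
      fix x assume "x \<in> side w"
      hence "adj v x" using w unfolding adj_iff side_def by blast
      then obtain g where "g \<in> H" "act g v = v" "act g w = x" using regular_pairs[OF w] by blast
      thus "x \<in> (\<lambda>g. act g w) ` S" by (auto simp: S_def)
    qed
  qed
  hence cS: "card S = 2 * p" using bij_betw_same_card card_side by metis
  have sub: "subgroup S G" unfolding S_def by (rule subgroup_stab[OF v])
  interpret S: group "G\<lparr>carrier := S\<rparr>" by (rule G.subgroup_imp_group[OF sub])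
  have "{x \<in> carrier (G\<lparr>carrier := S\<rparr>). x [^]\<^bsub>G\<lparr>carrier := S\<rparr>\<^esub> p = \<one>\<^bsub>G\<lparr>carrier := S\<rparr>\<^esub>} = Q v"
    by (auto simp: Q_def S_def nat_pow_def)
  moreover have "order (G\<lparr>carrier := S\<rparr>) = 2 * p" using cS by (simp add: order_def)
  ultimately have *: "subgroup (Q v) (G\<lparr>carrier := S\<rparr>)" "card (Q v) = p"
    using S.subgroup_of_order_twice_prime[OF p] by simp_all
  show "card (Q v) = p" by (rule *)
  show "subgroup (Q v) G" using G.incl_subgroup[OF sub *(1)] .
qed

lemma Q_sub_H: "Q v \<subseteq> H"
  by (auto simp: Q_def)

lemma Q_conj:
  assumes "g \<in> Q v" "h \<in> H" "v \<in> V"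
  shows "h \<otimes>\<^bsub>G\<^esub> g \<otimes>\<^bsub>G\<^esub> inv\<^bsub>G\<^esub> h \<in> Q (act h v)"
proof -
  have c: "g \<in> carrier G" "h \<in> carrier G" using assms by (auto simp: Q_def)
  have pow: "(h \<otimes>\<^bsub>G\<^esub> g \<otimes>\<^bsub>G\<^esub> inv\<^bsub>G\<^esub> h) [^]\<^bsub>G\<^esub> n = h \<otimes>\<^bsub>G\<^esub> g [^]\<^bsub>G\<^esub> n \<otimes>\<^bsub>G\<^esub> inv\<^bsub>G\<^esub> h" for n :: nat
  proof (induction n)
    case 0 show ?case using G.r_inv[OF c(2)] G.r_one[OF c(2)] by (simp only: G.nat_pow_0)
  next
    case (Suc n)
    let ?i = "inv\<^bsub>G\<^esub> h" and ?n = "g [^]\<^bsub>G\<^esub> n"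
    have i: "?i \<in> carrier G" "?n \<in> carrier G" using c G.inv_closed G.nat_pow_closed by blast+
    have "(h \<otimes>\<^bsub>G\<^esub> ?n \<otimes>\<^bsub>G\<^esub> ?i) \<otimes>\<^bsub>G\<^esub> (h \<otimes>\<^bsub>G\<^esub> g \<otimes>\<^bsub>G\<^esub> ?i) = h \<otimes>\<^bsub>G\<^esub> ?n \<otimes>\<^bsub>G\<^esub> (?i \<otimes>\<^bsub>G\<^esub> h) \<otimes>\<^bsub>G\<^esub> (g \<otimes>\<^bsub>G\<^esub> ?i)"
      using c i by (simp only: G.m_assoc G.m_closed)
    also have "\<dots> = h \<otimes>\<^bsub>G\<^esub> (?n \<otimes>\<^bsub>G\<^esub> g) \<otimes>\<^bsub>G\<^esub> ?i"
      using c i by (simp only: G.m_assoc G.m_closed G.l_inv G.r_one)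
    finally show ?case by (simp only: G.nat_pow_Suc Suc)
  qed
  have "act (h \<otimes>\<^bsub>G\<^esub> g \<otimes>\<^bsub>G\<^esub> inv\<^bsub>G\<^esub> h) (act h v) = act h v"
    using assms act_mult[OF closed[OF assms(2,3)]] act_mult[of "act (inv\<^bsub>G\<^esub> h) (act h v)" h g] act_inv[OF assms(2,3)]
    by (simp add: Q_def)
  moreover have "(h \<otimes>\<^bsub>G\<^esub> g \<otimes>\<^bsub>G\<^esub> inv\<^bsub>G\<^esub> h) [^]\<^bsub>G\<^esub> p = \<one>\<^bsub>G\<^esub>"
  proof -
    have "g [^]\<^bsub>G\<^esub> p = \<one>\<^bsub>G\<^esub>" using assms(1) by (simp only: Q_def mem_Collect_eq)
    thus ?thesis unfolding pow using c by (simp only: G.r_one G.r_inv)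
  qed
  moreover have "h \<otimes>\<^bsub>G\<^esub> g \<otimes>\<^bsub>G\<^esub> inv\<^bsub>G\<^esub> h \<in> H"
    using H_mult[OF H_mult[of h g] inv_closed[of h]] assms Q_sub_H by blast
  ultimately show ?thesis unfolding Q_def by blast
qed

text \<open>If \<open>g\<close> in \<open>Q v\<close> fixes \<open>u\<close>, it lies in
  \<open>Q u\<close> as well, and two groups of prime order with a common nontrivial element
  coincide.\<close>

lemma Q_eq_if_common_element:
  assumes "u \<in> V" "v \<in> V" "g \<in> Q v" "g \<noteq> \<one>\<^bsub>G\<^esub>" "act g u = u"
  shows "Q u = Q v"
proof -
  have gu: "g \<in> Q u" using assms by (simp add: Q_def)
  have I: "subgroup (Q u \<inter> Q v) G" using Q_subgroup assms G.subgroups_Inter_pair by blast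
  have fin: "finite (Q x)" if "x \<in> V" for x using card_Q[OF that] p_pos card_ge_0_finite by metis
  have sub: "subgroup (Q u \<inter> Q v) (G\<lparr>carrier := Q x\<rparr>)" if "x \<in> V" "Q u \<inter> Q v \<subseteq> Q x" for x
    using G.subgroup_incl[OF I Q_subgroup[OF that(1)] that(2)] .
  have full: "card (Q u \<inter> Q v) = p"
  proof -
    interpret Qu: group "G\<lparr>carrier := Q u\<rparr>" by (rule G.subgroup_imp_group[OF Q_subgroup[OF assms(1)]])
    have "card (Q u \<inter> Q v) dvd order (G\<lparr>carrier := Q u\<rparr>)"
      using Qu.lagrange[OF sub[OF assms(1)]] by (metis dvd_triv_right inf_le1)
    hence "card (Q u \<inter> Q v) dvd p" using card_Q[OF assms(1)] by (simp add: order_def)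
    moreover have "card (Q u \<inter> Q v) \<noteq> 1"
    proof
      assume "card (Q u \<inter> Q v) = 1"
      then obtain x where "Q u \<inter> Q v = {x}" by (auto simp: card_1_singleton_iff)
      moreover have "g \<in> Q u \<inter> Q v" "\<one>\<^bsub>G\<^esub> \<in> Q u \<inter> Q v" using gu assms(3) subgroup.one_closed[OF I] by auto
      ultimately show False using assms(4) by auto
    qed
    ultimately show ?thesis using p(1) by (metis prime_nat_iff)
  qed
  have "Q u \<inter> Q v = Q u" using fin[OF assms(1)] full card_Q[OF assms(1)] by (intro card_subset_eq) auto
  moreover have "Q u \<inter> Q v = Q v" using fin[OF assms(2)] full card_Q[OF assms(2)] by (intro card_subset_eq) auto
  ultimately show ?thesis by simp
qed

lemma Q_nontrivial: "\<exists>g \<in> Q v. g \<noteq> \<one>\<^bsub>G\<^esub>" if "v \<in> V"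
proof (rule ccontr)
  assume "\<not> (\<exists>g \<in> Q v. g \<noteq> \<one>\<^bsub>G\<^esub>)"
  hence "Q v \<subseteq> {\<one>\<^bsub>G\<^esub>}" by blast
  hence "card (Q v) \<le> 1" using card_mono[of "{\<one>\<^bsub>G\<^esub>}" "Q v"] by simp
  thus False using card_Q[OF that] p_gt_1 by simp
qed

lemma Q_free_opposite:
  assumes "adj u w" "g \<in> Q w" "act g u = u"
  shows "g = \<one>\<^bsub>G\<^esub>"
  using trivial_if_fixes_edge[OF _ assms(1), of g] assms by (simp add: Q_def)

lemma Q_preserves_side:
  assumes "v \<in> V" "g \<in> Q v" "u \<in> V"
  shows "act g u \<in> side u"
proof -
  have g: "g \<in> H" "act g v = v" using assms(2) by (auto simp: Q_def)
  show ?thesis using same_side_image[OF g(1) assms(3,1)] g(2) closed[OF g(1) assms(3)] unfolding side_def by auto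
qed

text \<open>Freeness makes every orbit as large as \<open>T\<close>, and the orbits partition
  \<open>A\<close>.\<close>

lemma free_action_card_dvd:
  assumes T: "subgroup T G" and A: "A \<subseteq> V" "\<And>g x. g \<in> T \<Longrightarrow> x \<in> A \<Longrightarrow> act g x \<in> A"
    and free: "\<And>g x. g \<in> T \<Longrightarrow> x \<in> A \<Longrightarrow> act g x = x \<Longrightarrow> g = \<one>\<^bsub>G\<^esub>"
  shows "card T dvd card A"
proof -
  define orb where "orb = (\<lambda>x. (\<lambda>g. act g x) ` T)"
  have TH: "T \<subseteq> H" using subgroup.subset[OF T] by simp
  have inj: "inj_on (\<lambda>g. act g x) T" if x: "x \<in> A" for x
  proof (rule inj_onI)
    fix g h assume gh: "g \<in> T" "h \<in> T" "act g x = act h x"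
    have xV: "x \<in> V" using x A by blast
    have c: "g \<in> carrier G" "h \<in> carrier G" using gh TH by auto
    have "act (inv\<^bsub>G\<^esub> h \<otimes>\<^bsub>G\<^esub> g) x = x" using act_mult[OF xV] gh(3) act_inv[of h x] gh(2) TH xV by auto
    moreover have "inv\<^bsub>G\<^esub> h \<otimes>\<^bsub>G\<^esub> g \<in> T" using T gh by (meson subgroup.m_closed subgroup.m_inv_closed)
    ultimately have "inv\<^bsub>G\<^esub> h \<otimes>\<^bsub>G\<^esub> g = \<one>\<^bsub>G\<^esub>" using free x by blast
    thus "g = h" using c by (metis G.inv_equality G.inv_inv G.inv_closed)
  qed
  have self: "x \<in> orb x" if "x \<in> A" for x
    using act_one[of x] that A subgroup.one_closed[OF T] unfolding orb_def by (intro image_eqI[of _ _ "\<one>\<^bsub>G\<^esub>"]) auto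
  have orb_sub: "orb x \<subseteq> A" if "x \<in> A" for x unfolding orb_def using A(2)[OF _ that] by blast
  have orb_mono: "orb y \<subseteq> orb x" if x: "x \<in> A" and y: "y \<in> orb x" for x y
  proof
    fix z assume "z \<in> orb y"
    then obtain g h where gh: "g \<in> T" "h \<in> T" "y = act g x" "z = act h y" using y by (auto simp: orb_def)
    have "z = act (h \<otimes>\<^bsub>G\<^esub> g) x" using gh act_mult[of x h g] x A by auto
    thus "z \<in> orb x" using subgroup.m_closed[OF T gh(2,1)] by (auto simp: orb_def)
  qed
  have orb_sym: "x \<in> orb y" if x: "x \<in> A" and y: "y \<in> orb x" for x y
  proof -
    obtain g where g: "g \<in> T" "y = act g x" using y by (auto simp: orb_def)
    have "g \<in> H" "x \<in> V" using g(1) TH x A(1) by blast+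
    hence "x = act (inv\<^bsub>G\<^esub> g) y" using g(2) act_inv by simp
    thus ?thesis using subgroup.m_inv_closed[OF T g(1)] by (auto simp: orb_def)
  qed
  have disj: "orb x = orb y" if xy: "x \<in> A" "y \<in> A" "orb x \<inter> orb y \<noteq> {}" for x y
  proof -
    obtain z where z: "z \<in> orb x" "z \<in> orb y" using xy(3) by blast
    have zA: "z \<in> A" using z orb_sub xy by blast
    have "orb x = orb z" using orb_mono[OF xy(1) z(1)] orb_mono[OF zA orb_sym[OF xy(1) z(1)]] by blast
    moreover have "orb y = orb z" using orb_mono[OF xy(2) z(2)] orb_mono[OF zA orb_sym[OF xy(2) z(2)]] by blast
    ultimately show ?thesis by simp
  qed
  have U: "\<Union> (orb ` A) = A" using self orb_sub by blast
  have finA: "finite A" using A(1) finite_V by (rule finite_subset)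
  have "card T dvd card (\<Union> (orb ` A))"
  proof (rule dvd_partition)
    show "finite (\<Union> (orb ` A))" using U finA by simp
    show "\<forall>c\<in>orb ` A. card T dvd card c" using card_image[OF inj] by (auto simp: orb_def)
    show "\<forall>c1\<in>orb ` A. \<forall>c2\<in>orb ` A. c1 \<noteq> c2 \<longrightarrow> c1 \<inter> c2 = {}" using disj by blast
  qed
  thus ?thesis using U by simp
qed

text \<open>This is the set of fixed points of \<open>Q v\<close>, since by
  \<open>Q_eq_if_common_element\<close> a vertex fixed by a nontrivial element of \<open>Q v\<close>
  has the same subgroup. Written as an equality of subgroups, it is at once an equivalence
  class.\<close>

definition fixcl :: "nat \<times> nat list \<Rightarrow> (nat \<times> nat list) set" where "fixcl v = {u \<in> V. Q u = Q v}"

text \<open>An element fixing two adjacent vertices is trivial, so a nontrivial element of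
  \<open>Q v\<close> has no fixed point on the opposite side.\<close>

lemma fixcl_side: "fixcl v \<subseteq> side v" if v: "v \<in> V"
proof
  fix u assume "u \<in> fixcl v"
  hence u: "u \<in> V" "Q u = Q v" by (auto simp: fixcl_def)
  obtain g where g: "g \<in> Q v" "g \<noteq> \<one>\<^bsub>G\<^esub>" using Q_nontrivial[OF v] by blast
  have "act g u = u" using g(1) u(2) by (auto simp: Q_def)
  hence "\<not> adj u v" using Q_free_opposite g by blast
  thus "u \<in> side v" using u v unfolding adj_iff side_def by blast
qed

text \<open>\<open>Q v\<close> acts freely on the vertices of \<open>side v\<close> that it does not
  fix, so \<open>p\<close> divides their number and hence also that of the fixed points. The latter
  is positive because of \<open>v\<close> and at most \<open>2 * p\<close>.\<close>

lemma card_fixcl: "card (fixcl v) = p \<or> card (fixcl v) = 2 * p" if v: "v \<in> V"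
proof -
  have fin: "finite (side v)" using finite_V by (auto simp: side_def)
  have "card (Q v) dvd card (side v - fixcl v)"
  proof (rule free_action_card_dvd[OF Q_subgroup[OF v]])
    show "side v - fixcl v \<subseteq> V" by (auto simp: side_def)
    fix g x assume g: "g \<in> Q v" and x: "x \<in> side v - fixcl v"
    have gH: "g \<in> H" using g by (simp add: Q_def)
    have xV: "x \<in> V" using x by (auto simp: side_def)
    show "g = \<one>\<^bsub>G\<^esub>" if "act g x = x"
      using Q_eq_if_common_element[OF xV v g _ that] x xV by (auto simp: fixcl_def)
    show "act g x \<in> side v - fixcl v"
    proof
      show "act g x \<in> side v" using Q_preserves_side[OF v g xV] x by (auto simp: side_def)
      show "act g x \<notin> fixcl v"
      proof
        assume "act g x \<in> fixcl v"
        hence "g \<in> Q (act g x)" using g by (simp add: fixcl_def)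
        hence "act g (act g x) = act g x" by (simp add: Q_def)
        hence fx: "act g x = x" using act_inj[OF gH closed[OF gH xV] xV] by simp
        thus False using \<open>act g x \<in> fixcl v\<close> x by simp
      qed
    qed
  qed
  moreover have "card (side v - fixcl v) = 2 * p - card (fixcl v)"
    using card_Diff_subset[of "fixcl v" "side v"] fixcl_side[OF v] fin card_side finite_subset by metis
  moreover have le: "card (fixcl v) \<le> 2 * p" using card_mono[OF fin fixcl_side[OF v]] card_side by simp
  moreover have "v \<in> fixcl v" using v by (simp add: fixcl_def)
  hence "card (fixcl v) > 0" using fixcl_side[OF v] fin finite_subset by (metis card_gt_0_iff empty_iff)
  ultimately have d: "p dvd 2 * p - card (fixcl v)" and pos: "card (fixcl v) > 0" using card_Q[OF v] by auto
  have "p dvd card (fixcl v)" using d le by (metis dvd_diffD1 dvd_triv_right)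
  then obtain k where k: "card (fixcl v) = p * k" by blast
  hence "k \<le> 2" "k > 0" using le pos p_pos by auto
  hence "k = 1 \<or> k = 2" by auto
  thus ?thesis using k by auto
qed

text \<open>A conjugate by \<open>h\<close> of a nontrivial element of the common subgroup lies in
  both subgroups on the right-hand sides, and one shared nontrivial element is enough.\<close>

lemma Q_image_eq:
  assumes "u \<in> V" "v \<in> V" "h \<in> H" "Q u = Q v"
  shows "Q (act h u) = Q (act h v)"
proof -
  obtain g where g: "g \<in> Q u" "g \<noteq> \<one>\<^bsub>G\<^esub>" using Q_nontrivial[OF assms(1)] by blast
  let ?c = "h \<otimes>\<^bsub>G\<^esub> g \<otimes>\<^bsub>G\<^esub> inv\<^bsub>G\<^esub> h"
  have c: "g \<in> carrier G" "h \<in> carrier G" using g assms by (auto simp: Q_def)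
  have 1: "?c \<in> Q (act h u)" "?c \<in> Q (act h v)" using Q_conj[OF _ assms(3)] g assms by auto
  have ne: "?c \<noteq> \<one>\<^bsub>G\<^esub>" using G.conj_eq_one_iff[OF c] g(2) by blast
  have "act ?c (act h v) = act h v" using 1(2) unfolding Q_def by blast
  thus ?thesis using Q_eq_if_common_element[OF closed[OF assms(3,2)] closed[OF assms(3,1)] 1(1) ne] by blast
qed

text \<open>An equivalence relation invariant under \<open>H\<close> whose classes have
  \<open>p\<close> elements and stay within a side. There are thus two classes on each side, the
  substitutes for the four fibres of the index.\<close>

definition block_relation :: "(nat \<times> nat list \<Rightarrow> nat \<times> nat list \<Rightarrow> bool) \<Rightarrow> bool" where
  "block_relation E \<longleftrightarrow>
     (\<forall>u\<in>V. E u u) \<and> (\<forall>u\<in>V. \<forall>v\<in>V. E u v \<longrightarrow> E v u) \<and>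
     (\<forall>u\<in>V. \<forall>v\<in>V. \<forall>w\<in>V. E u v \<longrightarrow> E v w \<longrightarrow> E u w) \<and>
     (\<forall>u\<in>V. \<forall>v\<in>V. E u v \<longrightarrow> v \<in> side u) \<and>
     (\<forall>g\<in>H. \<forall>u\<in>V. \<forall>v\<in>V. E u v \<longrightarrow> E (act g u) (act g v)) \<and>
     (\<forall>u\<in>V. card {v \<in> V. E u v} = p)"

section \<open>Existence of an invariant partition into blocks\<close>

lemma transitive_on_verts:
  assumes "u \<in> V" "v \<in> V"
  shows "\<exists>g \<in> H. act g u = v"
proof -
  obtain w w' where w: "adj u w" "adj v w'" using opposite_exists assms by metis
  obtain g where "g \<in> H \<and> act g u = v \<and> act g w = w'" using regular_pairs[OF w] by (rule ex1E) blast
  thus ?thesis by blast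
qed

text \<open>Used in both directions: transitivity makes the size constant, so the same alternative
  of \<open>card_fixcl\<close> holds at all vertices.\<close>

lemma card_fixcl_le:
  assumes "u \<in> V" "v \<in> V"
  shows "card (fixcl u) \<le> card (fixcl v)"
proof -
  obtain g where g: "g \<in> H" "act g u = v" using transitive_on_verts[OF assms] by blast
  show ?thesis
  proof (rule card_inj_on_le[of "fst g"])
    show "inj_on (fst g) (fixcl u)" using act_inj[OF g(1)] by (auto simp: inj_on_def fixcl_def)
    show "fst g ` fixcl u \<subseteq> fixcl v"
    proof
      fix y assume "y \<in> fst g ` fixcl u"
      then obtain x where x: "x \<in> V" "Q x = Q u" "y = act g x" unfolding fixcl_def by blast
      have "Q y = Q v" using Q_image_eq[OF x(1) assms(1) g(1) x(2)] g(2) x(3) by simp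
      thus "y \<in> fixcl v" using closed[OF g(1) x(1)] x(3) by (simp add: fixcl_def)
    qed
    show "finite (fixcl v)" using finite_V by (simp add: fixcl_def)
  qed
qed

text \<open>Either the subgroups \<open>Q v\<close> separate each side into two classes, or they are constant on each
  side; in the latter case the orbits of the subgroups of the other side are the blocks.\<close>

lemma block_relation_exists: "\<exists>E. block_relation E"
proof -
  obtain v0 where v0: "v0 \<in> V" using p_pos by (auto simp: PX_verts_def r4 s1 intro!: that[of "(0, [0])"])
  have const: "card (fixcl v) = card (fixcl v0)" if "v \<in> V" for v
    using card_fixcl_le[OF v0 that] card_fixcl_le[OF that v0] by simp
  show ?thesis
  proof (cases "card (fixcl v0) = p")
    case True
    have "block_relation (\<lambda>u v. Q u = Q v)"
      unfolding block_relation_def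
    proof (intro conjI ballI impI)
      show "v \<in> side u" if "u \<in> V" "v \<in> V" "Q u = Q v" for u v
        using fixcl_side[OF that(1)] that by (auto simp: fixcl_def)
      show "Q (act g u) = Q (act g v)" if "g \<in> H" "u \<in> V" "v \<in> V" "Q u = Q v" for g u v
        using Q_image_eq[OF that(2,3,1,4)] .
      show "card {v \<in> V. Q u = Q v} = p" if "u \<in> V" for u
      proof -
        have "{v \<in> V. Q u = Q v} = fixcl u" by (auto simp: fixcl_def)
        thus ?thesis using const[OF that] True by simp
      qed
    qed simp_all
    thus ?thesis by blast
  next
    case False
    have full: "fixcl v = side v" if "v \<in> V" for v
    proof (rule card_subset_eq)
      show "finite (side v)" using finite_V by (simp add: side_def)
      show "fixcl v \<subseteq> side v" by (rule fixcl_side[OF that])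
      show "card (fixcl v) = card (side v)" using card_fixcl[OF that] const[OF that] False card_side by simp
    qed
    have Qc: "Q u = Q v" if "u \<in> V" "v \<in> V" "even (fst u) \<longleftrightarrow> even (fst v)" for u v
      using full[OF that(2)] that unfolding side_def fixcl_def by blast
    define E where "E = (\<lambda>u v. \<exists>w. adj u w \<and> (\<exists>q \<in> Q w. act q u = v))"
    have EI: "E u v" if "adj u w" "q \<in> Q w" "act q u = v" for u v w q using that unfolding E_def by blast
    have E_side: "v \<in> side u" if "u \<in> V" and E: "E u v" for u v
    proof -
      obtain w q where "adj u w" "q \<in> Q w" "act q u = v" using E unfolding E_def by blast
      thus ?thesis using Q_preserves_side[of w q u] that(1) unfolding adj_iff by blast
    qed
    \<comment> \<open>All vertices opposite to \<open>u\<close> have the same subgroup, so the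
      witness \<open>w\<close> in \<open>E\<close> can be prescribed. Symmetry and transitivity of
      \<open>E\<close> rest on using one \<open>w\<close> for both pairs.\<close>
    have E_fix: "\<exists>q \<in> Q w. act q u = v" if E: "E u v" and w: "adj u w" for u v w
    proof -
      obtain w' q where w': "adj u w'" "q \<in> Q w'" "act q u = v" using E unfolding E_def by blast
      have "Q w' = Q w" using Qc[of w' w] w w'(1) unfolding adj_iff by blast
      thus ?thesis using w' by blast
    qed
    have "block_relation E"
      unfolding block_relation_def
    proof (intro conjI ballI impI)
      fix u assume u: "u \<in> V"
      obtain w where w: "adj u w" using opposite_exists[OF u] by blast
      have wV: "w \<in> V" using w unfolding adj_iff by blast
      show "E u u" using EI[OF w subgroup.one_closed[OF Q_subgroup[OF wV]] act_one[OF u]] .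
      show "card {v \<in> V. E u v} = p"
      proof -
        have "{v \<in> V. E u v} = (\<lambda>q. act q u) ` Q w"
        proof (intro equalityI subsetI)
          fix v assume "v \<in> {v \<in> V. E u v}"
          thus "v \<in> (\<lambda>q. act q u) ` Q w" using E_fix[OF _ w] by blast
        next
          fix v assume "v \<in> (\<lambda>q. act q u) ` Q w"
          then obtain q where q: "q \<in> Q w" "v = act q u" by blast
          have "v \<in> V" using q closed[OF _ u, of q] Q_sub_H by blast
          thus "v \<in> {v \<in> V. E u v}" using EI[OF w q(1)] q(2) by blast
        qed
        \<comment> \<open>Elements of \<open>Q w\<close> all fix \<open>w\<close>, so by regularity
          they are told apart by the image of the neighbour \<open>u\<close>.\<close>
        moreover have "inj_on (\<lambda>q. act q u) (Q w)"
        proof (rule inj_onI)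
          fix q q' assume q: "q \<in> Q w" "q' \<in> Q w" "act q u = act q' u"
          have H: "q \<in> H" "q' \<in> H" "act q w = w" "act q' w = w" using q by (auto simp: Q_def)
          have "adj (act q u) w" using adj_image[OF H(1) w] H(3) by simp
          from regular_pairs[OF w this] show "q = q'" using H q(3) by auto
        qed
        ultimately show ?thesis using card_Q[OF wV] by (simp add: card_image)
      qed
      fix v assume v: "v \<in> V"
      show "v \<in> side u" if "E u v" using E_side[OF u that] .
      show "E v u" if E: "E u v"
      proof -
        obtain q where q: "q \<in> Q w" "act q u = v" using E_fix[OF E w] by blast
        have "adj v w" using w E_side[OF u E] v unfolding adj_iff side_def by blast
        moreover have "inv\<^bsub>G\<^esub> q \<in> Q w" using subgroup.m_inv_closed[OF Q_subgroup[OF wV] q(1)] .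
        moreover have "act (inv\<^bsub>G\<^esub> q) v = u" using act_inv[of q u] u q Q_sub_H by blast
        ultimately show ?thesis by (rule EI)
      qed
      show "E u x" if x: "x \<in> V" and E: "E u v" "E v x" for x
      proof -
        obtain q where q: "q \<in> Q w" "act q u = v" using E_fix[OF E(1) w] by blast
        have "adj v w" using w E_side[OF u E(1)] v unfolding adj_iff side_def by blast
        then obtain q' where q': "q' \<in> Q w" "act q' v = x" using E_fix[OF E(2)] by blast
        have "q' \<otimes>\<^bsub>G\<^esub> q \<in> Q w" using subgroup.m_closed[OF Q_subgroup[OF wV] q'(1) q(1)] .
        moreover have "act (q' \<otimes>\<^bsub>G\<^esub> q) u = x" using act_mult[OF u] q q' by simp
        ultimately show ?thesis by (rule EI[OF w])
      qed
    next
      fix g u v assume g: "g \<in> H" and u: "u \<in> V" and v: "v \<in> V" and E: "E u v"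
      obtain w where w: "adj u w" using opposite_exists[OF u] by blast
      have wV: "w \<in> V" using w unfolding adj_iff by blast
      obtain q where q: "q \<in> Q w" "act q u = v" using E_fix[OF E w] by blast
      have "act (g \<otimes>\<^bsub>G\<^esub> q \<otimes>\<^bsub>G\<^esub> inv\<^bsub>G\<^esub> g) (act g u) = act g v"
        using act_mult[OF closed[OF g u], of "g \<otimes>\<^bsub>G\<^esub> q" "inv\<^bsub>G\<^esub> g"] act_inv[OF g u] act_mult[OF u, of g q] q(2) by simp
      thus "E (act g u) (act g v)" by (rule EI[OF adj_image[OF g w] Q_conj[OF q(1) g wV]])
    qed
    thus ?thesis by blast
  qed
qed

text \<open>All edges between blocks of different sides are present, so the graph is a blow-up of a
  4-cycle with respect to the blocks just as it is with respect to the index; the block label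
  \<open>\<pi>\<close> now replaces \<open>fst\<close>.\<close>

lemma semidirect_product:
  assumes "\<not> p dvd r"
  shows "is_semidirect_product_of G (Zp_power p (s + 1)) (dihedral_group r)"
proof -
  obtain E where E: "block_relation E" using block_relation_exists by blast
  have refl: "E u u" if "u \<in> V" for u using E that unfolding block_relation_def by blast
  have sym: "E v u" if "u \<in> V" "v \<in> V" "E u v" for u v using E that unfolding block_relation_def by blast
  have trans: "E u w" if "u \<in> V" "v \<in> V" "w \<in> V" "E u v" "E v w" for u v w using E that unfolding block_relation_def by blast
  have E_side: "v \<in> side u" if "u \<in> V" "v \<in> V" "E u v" for u v using E that unfolding block_relation_def by blast
  have E_act: "E (act g u) (act g v)" if "g \<in> H" "u \<in> V" "v \<in> V" "E u v" for g u v using E that unfolding block_relation_def by blast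
  have E_card: "card {v \<in> V. E u v} = p" if "u \<in> V" for u using E that unfolding block_relation_def by blast
  define a where "a = (0 :: nat, [0 :: nat])"
  define b where "b = (1 :: nat, [0 :: nat])"
  have ab: "a \<in> V" "b \<in> V" "even (fst a)" "odd (fst b)" using p_pos by (auto simp: a_def b_def PX_verts_def r4 s1)
  \<comment> \<open>The blocks of the arbitrary representatives \<open>a\<close> and
    \<open>b\<close> receive the labels 0 and 1, the rest of their sides 2 and 3. Labels and indices
    have the same parity, so adjacency becomes adjacency modulo 4 of the labels.\<close>
  define \<pi> where "\<pi> = (\<lambda>v :: nat \<times> nat list. if even (fst v) then if E a v then 0 else 2 else if E b v then 1 else 3 :: nat)"
  have \<pi>4: "\<pi> v < r" for v by (simp add: \<pi>_def r4)
  have \<pi>_even: "even (\<pi> v) \<longleftrightarrow> even (fst v)" for v by (simp add: \<pi>_def)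
  \<comment> \<open>Removing the block of \<open>c\<close> from its side leaves \<open>p\<close>
    vertices, and the block of \<open>u\<close> fits inside this remainder and fills it. Hence the
    labels 2 and 3 denote single blocks.\<close>
  have two: "E u v" if c: "c \<in> V" and uv: "u \<in> side c" "v \<in> side c" "\<not> E c u" "\<not> E c v" for c u v
  proof -
    have V: "u \<in> V" "v \<in> V" using uv by (auto simp: side_def)
    let ?C = "\<lambda>x. {y \<in> V. E x y}"
    have fin: "finite (side c)" using finite_V by (simp add: side_def)
    have sub: "?C c \<subseteq> side c" using E_side[OF c] by blast
    have "card (side c - ?C c) = p"
      using card_Diff_subset[OF finite_subset[OF sub fin] sub] card_side E_card[OF c] by simp
    moreover have "?C u \<subseteq> side c - ?C c"
    proof
      fix y assume y: "y \<in> ?C u"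
      have "y \<in> side c" using E_side[OF V(1)] y uv(1) unfolding side_def by blast
      moreover have "\<not> E c y" using trans[OF c _ V(1), of y] sym[OF V(1), of y] y uv(3) by blast
      ultimately show "y \<in> side c - ?C c" by blast
    qed
    ultimately have "?C u = side c - ?C c" using E_card[OF V(1)] fin by (intro card_subset_eq) auto
    thus ?thesis using uv by blast
  qed
  have \<pi>_E: "\<pi> u = \<pi> v \<longleftrightarrow> E u v" if uv: "u \<in> V" "v \<in> V" for u v
  proof
    assume eq: "\<pi> u = \<pi> v"
    hence par: "even (fst u) \<longleftrightarrow> even (fst v)" using \<pi>_even by metis
    define c where "c = (if even (fst u) then a else b)"
    have c: "c \<in> V" "u \<in> side c" "v \<in> side c" using ab par uv by (auto simp: c_def side_def)
    have "E c u \<longleftrightarrow> E c v" using eq par by (auto simp: \<pi>_def c_def split: if_splits)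
    thus "E u v" using two[OF c] trans[OF uv(1) c(1) uv(2)] sym[OF c(1) uv(1)] by blast
  next
    assume Euv: "E u v"
    hence par: "even (fst u) \<longleftrightarrow> even (fst v)" using E_side[OF uv] by (auto simp: side_def)
    have "E c u \<longleftrightarrow> E c v" if "c \<in> V" for c
      using trans[OF that uv _ Euv] trans[OF that uv(2,1) _ sym[OF uv Euv]] by blast
    thus "\<pi> u = \<pi> v" using ab par by (simp add: \<pi>_def)
  qed
  define Y where "Y = (\<lambda>i. {v \<in> V. \<pi> v = i})"
  have Y_ne: "\<exists>v \<in> V. \<pi> v = i" if i: "i < r" for i
  proof -
    have base: "\<pi> a = 0" "\<pi> b = 1" using refl ab by (auto simp: \<pi>_def)
    have other: "\<exists>v \<in> side c. \<not> E c v" if c: "c \<in> V" for c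
    proof (rule ccontr)
      assume "\<not> (\<exists>v \<in> side c. \<not> E c v)"
      hence "side c \<subseteq> {v \<in> V. E c v}" unfolding side_def by blast
      hence "card (side c) \<le> card {v \<in> V. E c v}" using finite_V by (intro card_mono) auto
      thus False using card_side E_card[OF c] p_pos by simp
    qed
    obtain a' where "a' \<in> side a" "\<not> E a a'" using other[OF ab(1)] by blast
    hence "a' \<in> V" "\<pi> a' = 2" using ab by (auto simp: side_def \<pi>_def)
    moreover obtain b' where "b' \<in> side b" "\<not> E b b'" using other[OF ab(2)] by blast
    hence "b' \<in> V" "\<pi> b' = 3" using ab by (auto simp: side_def \<pi>_def)
    moreover have "i = 0 \<or> i = 1 \<or> i = 2 \<or> i = 3" using i r4 by auto
    ultimately show ?thesis using base ab by blast
  qed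
  have cardY: "card (Y i) = p" if i: "i < r" for i
  proof -
    obtain v where v: "v \<in> V" "\<pi> v = i" using Y_ne[OF i] by blast
    have "Y i = {u \<in> V. E v u}" unfolding Y_def v(2)[symmetric] using \<pi>_E[OF v(1)] by (intro Collect_cong) metis
    thus ?thesis using E_card[OF v(1)] by simp
  qed
  define R where "R = (\<lambda>u w. u \<in> V \<and> w \<in> V \<and> \<pi> w = (\<pi> u + 1) mod r)"
  have par4: "(even i \<longleftrightarrow> odd j) \<longleftrightarrow> (j = (i + 1) mod r \<or> i = (j + 1) mod r)" if "i < r" "j < r" for i j :: nat
  proof -
    have "i = 0 \<or> i = 1 \<or> i = 2 \<or> i = 3" "j = 0 \<or> j = 1 \<or> j = 2 \<or> j = 3" using that r4 by auto
    thus ?thesis unfolding r4 by (elim disjE) simp_all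
  qed
  have R_adj: "R u w \<or> R w u \<longleftrightarrow> adj u w" for u w
    using par4[OF \<pi>4 \<pi>4, of u w] \<pi>_even unfolding R_def adj_iff by blast
  \<comment> \<open>Only one label precedes and one follows that of \<open>v\<close>, so neighbours
    on the same side are neighbours in the same block, a relation that \<open>H\<close>
    preserves.\<close>
  have R_same: "(R v w \<longleftrightarrow> R v w') \<longleftrightarrow> \<pi> w = \<pi> w'" if "adj v w" "adj v w'" for v w w'
  proof -
    have V: "v \<in> V" "w \<in> V" "w' \<in> V" and par: "even (\<pi> v) \<longleftrightarrow> odd (\<pi> w)" "even (\<pi> v) \<longleftrightarrow> odd (\<pi> w')"
      using that \<pi>_even unfolding adj_iff by blast+
    have lt: "\<pi> v < 4" "\<pi> w < 4" "\<pi> w' < 4" using \<pi>4 r4 by auto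
    have "(j = (i + 1) mod 4 \<longleftrightarrow> k = (i + 1) mod 4) \<longleftrightarrow> j = k"
      if "i < 4" "j < 4" "k < 4" "even i \<longleftrightarrow> odd j" "even i \<longleftrightarrow> odd k" for i j k :: nat
    proof -
      have "i = 0 \<or> i = 1 \<or> i = 2 \<or> i = 3" "j = 0 \<or> j = 1 \<or> j = 2 \<or> j = 3" "k = 0 \<or> k = 1 \<or> k = 2 \<or> k = 3" using that by auto
      thus ?thesis using that by (elim disjE) simp_all
    qed
    from this[OF lt par] show ?thesis using V unfolding R_def r4 by blast
  qed
  show ?thesis
  proof (rule semidirect_product_over_cycle[where \<pi> = \<pi> and I = "{..<r}" and Y = Y and \<beta> = "\<lambda>_. fst", unfolded gverts_PX])
    show "r \<ge> 3" using r4 by simp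
    show "\<pi> v < r" for v by (rule \<pi>4)
    show "\<exists>e\<in>gedges (PX_graph p r s). \<exists>u w. fst e = {u, w} \<and> \<pi> u = i \<and> \<pi> w = (i + 1) mod r" if i: "i < r" for i
    proof -
      obtain u where u: "u \<in> V" "\<pi> u = i" using Y_ne[OF i] by blast
      have "(i + 1) mod r < r" using r4 by simp
      then obtain w where w: "w \<in> V" "\<pi> w = (i + 1) mod r" using Y_ne by blast
      have "R u w" using u w by (simp add: R_def)
      hence "({u, w}, 0) \<in> gedges (PX_graph p r s)" using R_adj[of u w] adj_iff_edge[of u w] by blast
      thus ?thesis using u w by (intro bexI[of _ "({u, w}, 0)"] exI[of _ u] exI[of _ w]) auto
    qed
    show "\<exists>d\<in>carrier (dihedral_group r). \<forall>v\<in>V. \<pi> (fst g v) = dihedral_act r d (\<pi> v)" if g: "g \<in> H" for g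
    proof (rule orientation_respecting_map[where R = R])
      show "r \<ge> 3" using r4 by simp
      show "u \<in> V \<and> w \<in> V \<and> \<pi> w = (\<pi> u + 1) mod r" if "R u w" for u w using that by (simp add: R_def)
      show "\<pi> v < r" for v by (rule \<pi>4)
      show "fst g v \<in> V" if "v \<in> V" for v using closed[OF g that] .
      show "(\<lambda>u w. R u w \<or> R w u)\<^sup>*\<^sup>* u w" if uw: "u \<in> V" "w \<in> V" for u w
      proof (cases "adj u w")
        case True thus ?thesis unfolding R_adj by (rule r_into_rtranclp)
      next
        case False
        obtain x where x: "adj u x" using opposite_exists[OF uw(1)] by blast
        hence "adj x w" using False uw unfolding adj_iff by blast
        thus ?thesis unfolding R_adj using x by (metis (no_types, lifting) r_into_rtranclp rtranclp_trans)
      qed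
      show "R (fst g u) (fst g w) \<or> R (fst g w) (fst g u)" if "R u w \<or> R w u" for u w
        using that adj_image[OF g] unfolding R_adj by blast
      show "(R v w \<longleftrightarrow> R v w') \<longleftrightarrow> (R (fst g v) (fst g w) \<longleftrightarrow> R (fst g v) (fst g w'))"
        if "R v w \<or> R w v" "R v w' \<or> R w' v" for v w w'
      proof -
        have adj: "adj v w" "adj v w'" using that unfolding R_adj by blast+
        have V: "w \<in> V" "w' \<in> V" using adj unfolding adj_iff by blast+
        have "E w w' \<longleftrightarrow> E (act g w) (act g w')"
          using E_act[OF g V] E_act[OF inv_closed[OF g] closed[OF g V(1)] closed[OF g V(2)]] act_inv[OF g V(1)] act_inv[OF g V(2)] by auto
        thus ?thesis
          unfolding R_same[OF adj] R_same[OF adj_image[OF g adj(1)] adj_image[OF g adj(2)]]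
            \<pi>_E[OF V] \<pi>_E[OF closed[OF g V(1)] closed[OF g V(2)]] .
      qed
    qed
    \<comment> \<open>Every vertex labelled 0 is adjacent to every vertex labelled 1. This gives
      \<open>p * p\<close> arcs, which is \<open>p ^ (s + 1)\<close> for
      \<open>s = 1\<close>.\<close>
    have "{a \<in> arcs (PX_graph p r s). \<pi> ` fst (fst a) = {0, 1} \<and> \<pi> (snd a) = 0} = (\<lambda>(u, w). (({u, w}, 0), u)) ` (Y 0 \<times> Y 1)" (is "?A = ?f ` ?B")
    proof (intro equalityI subsetI)
      fix x assume "x \<in> ?A"
      then obtain e u where x: "x = (e, u)" "e \<in> gedges (PX_graph p r s)" "u \<in> fst e" "\<pi> ` fst e = {0, 1}" "\<pi> u = 0"
        by (cases x) (auto simp: arcs_def)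
      obtain u' w' where e: "e = ({u', w'}, 0)" "PX_step p r s u' w'" using x(2) unfolding gedges_PX[OF s_ge_1] by blast
      have V: "u' \<in> V" "w' \<in> V" using e(2) by (auto simp: PX_step_def)
      have im: "{\<pi> u', \<pi> w'} = {0, 1}" using x(4) e(1) by simp
      have "\<exists>w \<in> V. e = ({u, w}, 0) \<and> u \<in> V \<and> \<pi> w = 1"
      proof (cases "u = u'")
        case True thus ?thesis using V e(1) im x(5) by (intro bexI[of _ w']) (auto simp: doubleton_eq_iff)
      next
        case False
        hence "u = w'" using x(3) e(1) by simp
        thus ?thesis using V e(1) im x(5) by (intro bexI[of _ u']) (auto simp: doubleton_eq_iff)
      qed
      then obtain w where "w \<in> V" "e = ({u, w}, 0)" "u \<in> V" "\<pi> w = 1" by blast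
      thus "x \<in> ?f ` ?B" using x(1,5) by (intro image_eqI[of _ _ "(u, w)"]) (auto simp: Y_def)
    next
      fix x assume "x \<in> ?f ` ?B"
      then obtain u w where x: "x = (({u, w}, 0), u)" "u \<in> V" "w \<in> V" "\<pi> u = 0" "\<pi> w = 1" by (auto simp: Y_def)
      have "R u w" using x r4 by (simp add: R_def)
      hence "({u, w}, 0) \<in> gedges (PX_graph p r s)" using R_adj[of u w] adj_iff_edge[of u w] by blast
      thus "x \<in> ?A" using x by (simp add: arcs_def)
    qed
    moreover have "inj_on ?f ?B"
    proof (rule inj_onI)
      fix x y assume "x \<in> ?B" "y \<in> ?B" "?f x = ?f y"
      thus "x = y" by (cases x, cases y) (auto simp: doubleton_eq_iff)
    qed
    ultimately show "card {a \<in> arcs (PX_graph p r s). \<pi> ` fst (fst a) = {0, 1} \<and> \<pi> (snd a) = 0} = p ^ (s + 1)"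
      using cardY[of 0] cardY[of 1] r4 s1 by (simp add: card_image card_cartesian_product power2_eq_square)
    show "card (Y i) = p" if "i \<in> {..<r}" for i using that cardY by simp
    show "bij_betw (fst g) (Y i) (Y i)" if g: "g \<in> {g \<in> H. \<forall>v\<in>V. \<pi> (fst g v) = \<pi> v}" for i g
    proof (rule bij_betw_endo)
      show "finite (Y i)" using finite_V by (simp add: Y_def)
      show "inj_on (fst g) (Y i)" using act_inj[of g] g by (auto simp: Y_def inj_on_def)
      show "fst g ` Y i \<subseteq> Y i" using g closed[of g] by (auto simp: Y_def)
    qed
    show "fst (g \<otimes>\<^bsub>G\<^esub> h) v = fst g (fst h v)" if "v \<in> Y i" for i g h v
      using that by (intro act_mult) (auto simp: Y_def)
    show "g = \<one>\<^bsub>G\<^esub>" if g: "g \<in> {g \<in> H. \<forall>v\<in>V. \<pi> (fst g v) = \<pi> v}"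
      and fixed: "\<And>i v. i \<in> {..<r} \<Longrightarrow> v \<in> Y i \<Longrightarrow> fst g v = v" for g
    proof (rule simple_eq_one[OF simple])
      show "g \<in> H" using g by simp
      show "fst g v = v" if "v \<in> gverts (PX_graph p r s)" for v using fixed[of "\<pi> v" v] that \<pi>4 by (simp add: Y_def gverts_PX)
    qed
  qed (use p assms in auto)
qed

end

section \<open>Combination of the four families of graphs\<close>

theorem theorem4p2:
  fixes p r s :: nat and \<delta> :: int
    and H :: "((nat \<times> nat list \<Rightarrow> nat \<times> nat list) \<times>
               ((nat \<times> nat list) set \<times> nat \<Rightarrow> (nat \<times> nat list) set \<times> nat)) set"
  assumes "Factorial_Ring.prime p" and "odd p"
    and "\<delta> \<in> {1, -1}"
    and "r \<ge> 3" and "r \<ge> s + 1" and "\<not> p dvd r"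
    and "subgroup H (aut_group (aug_PX p r s \<delta>))"
    and "arc_regular (aug_PX p r s \<delta>) H"
  shows "is_semidirect_product_of ((aut_group (aug_PX p r s \<delta>))\<lparr>carrier := H\<rparr>)
           (Zp_power p (s + 1)) (dihedral_group r)"
proof (cases "s = 0")
  case True
  show ?thesis
  proof (cases "\<delta> = 1")
    case d: True
    hence eq: "aug_PX p r s \<delta> = multicycle p r" using True by (simp add: aug_PX_def)
    have "s + 1 = 1" using True by simp
    thus ?thesis using multicycle_semidirect_product assms unfolding eq by metis
  next
    case d: False
    hence eq: "aug_PX p r s \<delta> = cycle_graph (p * r)" using True by (simp add: aug_PX_def)
    have "s + 1 = 1" using True by simp
    thus ?thesis using cycle_graph_semidirect_product assms unfolding eq by metis
  qed
next
  case False
  hence s: "s \<ge> 1" by simp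
  hence eq: "aug_PX p r s \<delta> = PX_graph p r s" by (simp add: aug_PX_def)
  note H = assms(7,8)[unfolded eq]
  show ?thesis
  proof (cases "r = 4 \<and> s = 1")
    case True
    have "arc_regular_complete_bipartite p r s H"
      using arc_regular_group_PX[OF s H] s assms(1,2) True
      by (simp add: arc_regular_complete_bipartite_def arc_regular_complete_bipartite_axioms_def arc_regular_PX_def arc_regular_PX_axioms_def)
    thus ?thesis unfolding eq using assms(6) by (rule arc_regular_complete_bipartite.semidirect_product)
  next
    case False
    thus ?thesis unfolding eq using PX_graph_semidirect_product[OF assms(4,1,2,6) s False H] by blast
  qed
qed

end
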